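(* For the symmetric Gaussian interference channel with common information and every $\alpha\ge0$, $$\mathbf{d}_{\sf ICCI}(\alpha)=\begin{cases}\mathbf{d}_{\sf IC}(\alpha)+\frac{\alpha}{2}, & 0\le\alpha<\frac12,\\ \mathbf{d}_{\sf IC}(\alpha)+\frac{2-3\alpha}{2}, & \frac12\le\alpha<\frac23,\\ \mathbf{d}_{\sf IC}(\alpha), & \frac23\le\alpha<2,\\ \mathbf{d}_{\sf IC}(\alpha)+\frac{\alpha-2}{2}, & 2\le\alpha,\end{cases}$$ and therefore $\mathbf{d}_{\uparrow}(\alpha)=\mathbf{d}_{\sf ICCI}(\alpha)-\mathbf{d}_{\sf IC}(\alpha)$ equals $\frac{\alpha}{2}$ for $0\le\alpha<\frac12$, $\frac{2-3\alpha}{2}$ for $\frac12\le\alpha<\frac23$, $0$ for $\frac23\le\alpha<2$, and $\frac{\alpha-2}{2}$ for $\alpha\ge2$.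
   Context: Gaussian interference channel with common information (IC-CI): $Y_1(t)=h_{11}X_1(t)+h_{12}X_2(t)+Z_1(t)$, $Y_2(t)=h_{21}X_1(t)+h_{22}X_2(t)+Z_2(t)$, with $X_i(t),Y_i(t)\in\mathbb{C}$, noises $Z_i(t)\sim\mathcal{CN}(0,1)$ i.i.d. over time and independent of messages, channel coefficients $H=(h_{11},h_{12},h_{21},h_{22})$ deterministic and known to all terminals. An $(n,R_0,R_1,R_2,P_e^{(n)})$ code: independent messages $\mathcal{M}_0$ (common, to be decoded by both receivers) and $\mathcal{M}_1,\mathcal{M}_2$ (individual, $\mathcal{M}_i$ for receiver $i$), $\mathcal{M}_k$ uniform on $\{1,\dots,2^{nR_k}\}$; encoders $X_i(t)=f_i(\mathcal{M}_0,\mathcal{M}_i,t,H)$ with $\frac1n\sum_{t=1}^n\mathbb{E}|X_i(t)|^2\le1$; decoders $(\hat M_{0i},\hat M_i)=g_i(Y_i^n,H)$; $P_e^{(n)}$ is the probability that any of $\hat M_1,\hat M_2,\hat M_{01},\hat M_{02}$ is wrong. $(R_0,R_1,R_2)$ is achievable if some sequence of codes has $P_e^{(n)}\to0$; the capacity region $\mathbf{C}(H)$ is the closure of the achievable set. GDoF region: for $\overline{\alpha}=(\alpha_{11},\alpha_{12},\alpha_{21},\alpha_{22})\in\mathbb{R}_+^4$, $\mathbf{D}(\overline{\alpha})$ is the set of $(d_0,d_1,d_2)\in\mathbb{R}_+^3$ such that, for channels with $|h_{ij}|^2=P^{\alpha_{ij}}$ ($P>0$), there are rate triples $(R_0,R_1,R_2)\in\mathbf{C}(H)$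 (depending on $P$) with $d_k=\lim_{P\to\infty}R_k/\log_2P$, $k=0,1,2$. Symmetric case: $\alpha_{11}=\alpha_{22}=1$, $\alpha_{12}=\alpha_{21}=\alpha$. Define $\mathbf{d}_{\sf ICCI}(\alpha)=\max\{\frac12(d_0+d_1+d_2):(d_0,d_1,d_2)\in\mathbf{D}(\overline{\alpha}),\ d_1=d_2\}$ and $\mathbf{d}_{\sf IC}(\alpha)=\max\{\frac12(d_0+d_1+d_2):(d_0,d_1,d_2)\in\mathbf{D}(\overline{\alpha}),\ d_1=d_2,\ d_0=0\}$, with $\overline{\alpha}=(1,\alpha,\alpha,1)$ (these are the maximal per-user degrees of freedom with and without the common message). It is known (Etkin–Tse–Wang) that $\mathbf{d}_{\sf IC}(\alpha)$ equals $1-\alpha$ on $[0,\frac12)$, $\alpha$ on $[\frac12,\frac23)$, $1-\frac{\alpha}{2}$ on $[\frac23,1)$, $\frac{\alpha}{2}$ on $[1,2)$, and $1$ on $[2,\infty)$. *)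

theory Defs
  imports "HOL-Probability.Probability"
begin

text \<open>Channel coefficients: h i j for i, j in {1,2}; only these four entries matter.\<close>
type_synonym chan = "nat \<Rightarrow> nat \<Rightarrow> complex"

definition nmsg :: "nat \<Rightarrow> real \<Rightarrow> nat" where
  "nmsg n R = nat \<lceil>2 powr (real n * R)\<rceil>"

definition cgauss :: "complex measure" where
  "cgauss = density lborel (\<lambda>z. ennreal (exp (- (cmod z)\<^sup>2) / pi))"

definition noise :: "nat \<Rightarrow> (nat \<Rightarrow> complex \<times> complex) measure" where
  "noise n = PiM {1..n} (\<lambda>_. cgauss \<Otimes>\<^sub>M cgauss)"

definition outsp :: "nat \<Rightarrow> (nat \<Rightarrow> complex) measure" where
  "outsp n = PiM {1..n} (\<lambda>_. borel)"

definition Y1 :: "chan \<Rightarrow> nat \<Rightarrow> (nat \<Rightarrow> nat \<Rightarrow> nat \<Rightarrow> complex) \<Rightarrow> (nat \<Rightarrow> nat \<Rightarrow> nat \<Rightarrow> complex)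
    \<Rightarrow> nat \<Rightarrow> nat \<Rightarrow> nat \<Rightarrow> (nat \<Rightarrow> complex \<times> complex) \<Rightarrow> nat \<Rightarrow> complex" where
  "Y1 h n f1 f2 m0 m1 m2 z = (\<lambda>t. if t \<in> {1..n}
      then h 1 1 * f1 m0 m1 t + h 1 2 * f2 m0 m2 t + fst (z t) else undefined)"

definition Y2 :: "chan \<Rightarrow> nat \<Rightarrow> (nat \<Rightarrow> nat \<Rightarrow> nat \<Rightarrow> complex) \<Rightarrow> (nat \<Rightarrow> nat \<Rightarrow> nat \<Rightarrow> complex)
    \<Rightarrow> nat \<Rightarrow> nat \<Rightarrow> nat \<Rightarrow> (nat \<Rightarrow> complex \<times> complex) \<Rightarrow> nat \<Rightarrow> complex" where
  "Y2 h n f1 f2 m0 m1 m2 z = (\<lambda>t. if t \<in> {1..n}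
      then h 2 1 * f1 m0 m1 t + h 2 2 * f2 m0 m2 t + snd (z t) else undefined)"

text \<open>A valid (n,R0,R1,R2) code: power constraints (average over uniform messages and time)
  and measurable decoders g_i returning (estimate of M0, estimate of M_i).\<close>
definition valid_code :: "nat \<Rightarrow> real \<Rightarrow> real \<Rightarrow> real \<Rightarrow>
    (nat \<Rightarrow> nat \<Rightarrow> nat \<Rightarrow> complex) \<Rightarrow> (nat \<Rightarrow> nat \<Rightarrow> nat \<Rightarrow> complex) \<Rightarrow>
    ((nat \<Rightarrow> complex) \<Rightarrow> nat \<times> nat) \<Rightarrow> ((nat \<Rightarrow> complex) \<Rightarrow> nat \<times> nat) \<Rightarrow> bool" where
  "valid_code n R0 R1 R2 f1 f2 g1 g2 \<longleftrightarrow>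
     n \<ge> 1 \<and>
     (1 / real n) * (\<Sum>t\<in>{1..n}. (\<Sum>m0\<in>{1..nmsg n R0}. \<Sum>m1\<in>{1..nmsg n R1}. (cmod (f1 m0 m1 t))\<^sup>2)
         / (real (nmsg n R0) * real (nmsg n R1))) \<le> 1 \<and>
     (1 / real n) * (\<Sum>t\<in>{1..n}. (\<Sum>m0\<in>{1..nmsg n R0}. \<Sum>m2\<in>{1..nmsg n R2}. (cmod (f2 m0 m2 t))\<^sup>2)
         / (real (nmsg n R0) * real (nmsg n R2))) \<le> 1 \<and>
     g1 \<in> outsp n \<rightarrow>\<^sub>M count_space UNIV \<and>
     g2 \<in> outsp n \<rightarrow>\<^sub>M count_space UNIV"

definition perr :: "chan \<Rightarrow> nat \<Rightarrow> real \<Rightarrow> real \<Rightarrow> real \<Rightarrow>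
    (nat \<Rightarrow> nat \<Rightarrow> nat \<Rightarrow> complex) \<Rightarrow> (nat \<Rightarrow> nat \<Rightarrow> nat \<Rightarrow> complex) \<Rightarrow>
    ((nat \<Rightarrow> complex) \<Rightarrow> nat \<times> nat) \<Rightarrow> ((nat \<Rightarrow> complex) \<Rightarrow> nat \<times> nat) \<Rightarrow> real" where
  "perr h n R0 R1 R2 f1 f2 g1 g2 =
     (\<Sum>m0\<in>{1..nmsg n R0}. \<Sum>m1\<in>{1..nmsg n R1}. \<Sum>m2\<in>{1..nmsg n R2}.
        measure (noise n) {z \<in> space (noise n).
           g1 (Y1 h n f1 f2 m0 m1 m2 z) \<noteq> (m0, m1) \<or> g2 (Y2 h n f1 f2 m0 m1 m2 z) \<noteq> (m0, m2)})
     / (real (nmsg n R0) * real (nmsg n R1) * real (nmsg n R2))"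

definition achievable :: "chan \<Rightarrow> (real \<times> real \<times> real) set" where
  "achievable h = {(R0, R1, R2). R0 \<ge> 0 \<and> R1 \<ge> 0 \<and> R2 \<ge> 0 \<and>
     (\<exists>F1 F2 G1 G2. (\<forall>n\<ge>1. valid_code n R0 R1 R2 (F1 n) (F2 n) (G1 n) (G2 n)) \<and>
        (\<lambda>n. perr h n R0 R1 R2 (F1 n) (F2 n) (G1 n) (G2 n)) \<longlonglongrightarrow> 0)}"

definition capacity_region :: "chan \<Rightarrow> (real \<times> real \<times> real) set" where
  "capacity_region h = closure (achievable h)"

definition gdof_region :: "(nat \<Rightarrow> nat \<Rightarrow> real) \<Rightarrow> (real \<times> real \<times> real) set" where
  "gdof_region alpha = {(d0, d1, d2). d0 \<ge> 0 \<and> d1 \<ge> 0 \<and> d2 \<ge> 0 \<and>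
     (\<forall>H :: real \<Rightarrow> chan.
        (\<forall>P>0. \<forall>i\<in>{1,2}. \<forall>j\<in>{1,2}. (cmod (H P i j))\<^sup>2 = P powr alpha i j) \<longrightarrow>
        (\<exists>R :: real \<Rightarrow> real \<times> real \<times> real.
           (\<forall>P>0. R P \<in> capacity_region (H P)) \<and>
           ((\<lambda>P. fst (R P) / log 2 P) \<longlongrightarrow> d0) at_top \<and>
           ((\<lambda>P. fst (snd (R P)) / log 2 P) \<longlongrightarrow> d1) at_top \<and>
           ((\<lambda>P. snd (snd (R P)) / log 2 P) \<longlongrightarrow> d2) at_top))}"

definition alpha_sym :: "real \<Rightarrow> nat \<Rightarrow> nat \<Rightarrow> real" where
  "alpha_sym a = (\<lambda>i j. if i = j then 1 else a)"

definition obj_ICCI :: "real \<Rightarrow> real set" where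
  "obj_ICCI a = {(d0 + d1 + d2) / 2 | d0 d1 d2. (d0, d1, d2) \<in> gdof_region (alpha_sym a) \<and> d1 = d2}"

definition obj_IC :: "real \<Rightarrow> real set" where
  "obj_IC a = {(d0 + d1 + d2) / 2 | d0 d1 d2. (d0, d1, d2) \<in> gdof_region (alpha_sym a) \<and> d1 = d2 \<and> d0 = 0}"

definition d_ICCI :: "real \<Rightarrow> real" where
  "d_ICCI a = (GREATEST v. v \<in> obj_ICCI a)"

definition d_IC :: "real \<Rightarrow> real" where
  "d_IC a = (GREATEST v. v \<in> obj_IC a)"

end

theory Submission
  imports Defs
begin

text \<open>
  Converse. All outer bounds are packing arguments in the spirit of a strong converse, with no
  entropies. The probability that both receivers decode correctly is an integral of Gaussian kernels
  over disjoint decoding regions; a kernel is dominated by a wider one that does not depend on the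
  message being summed over, and the sum of the indicators of the regions is at most 1. This gives
  \<open>d1 \<le> 1\<close>, \<open>d0 + d1 + d2 \<le> max (2 - \<alpha>) \<alpha>\<close> and (the Etkin-Tse-Wang bound) \<open>d1 + d2 \<le> 2 max \<alpha> (1 - \<alpha>)\<close>.

  Achievability. Each user superposes a common layer sent by both users, a layer decoded by both
  receivers, and a private layer with power \<open>P powr (- \<alpha>)\<close>, which stays below the noise at the other
  receiver. Codewords are drawn uniformly from a fine grid in the complex plane and decoded by
  minimum distance, ignoring errors in undesired layers. Averaged over the codebook, a wrong codeword
  in a single layer received with amplitude \<open>G\<close> costs a factor \<open>O(1 / G\<^sup>2)\<close> per symbol whatever the
  other layers do, so the phases of the channel coefficients play no role.
\<close>

section \<open>Gaussian kernels\<close>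

text \<open>\<open>gdof_region\<close> quantifies over all channels with given magnitudes. The
  converse may therefore test a single channel with real coefficients, while the code must survive
  arbitrary phases. Phases matter only for the layer sent by both users: its two gains add, and for
  \<alpha> = 1 they may cancel. At \<alpha> = 1 the common layer is therefore left empty, and
  individual messages alone already meet the sum bound. Constants per symbol cost a bounded number
  of bits and disappear after division by \<open>log 2 P\<close>. Kernel estimates may thus be crude
  as long as the exponent of P is right. The power constraint averages over messages, whereas a
  kernel must be dominated for each codeword. Discarding messages of large energy repairs this and
  still leaves half of the total success probability. With d1 = d2 = d, the sum bound alone yields
  d_ICCI, and the minimum of 1, max (2 - \<alpha>) \<alpha> / 2 and max \<alpha> (1 - \<alpha>) is
  d_IC. The matching schemes are described by three numbers: the exponents d0, c and p of the
  common, the jointly decoded and the private layers.\<close>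

abbreviation gker :: "real \<Rightarrow> complex \<Rightarrow> ennreal" where
  "gker c z \<equiv> ennreal (exp (- (c * (cmod z)\<^sup>2)))"

lemma nn_integral_real_gaussian:
  fixes c m :: real
  assumes c: "c > 0"
  shows "(\<integral>\<^sup>+x. ennreal (exp (- (c * (x - m)\<^sup>2))) \<partial>lborel) = ennreal (sqrt (pi / c))"
proof -
  \<comment> \<open>The variance 1 / (2 * c) turns the kernel into a normal density times
    \<open>sqrt (pi / c)\<close>.\<close>
  define s where "s = sqrt (1 / (2 * c))"
  have s: "s > 0" "s\<^sup>2 = 1 / (2 * c)" using c by (auto simp: s_def)
  have dens: "exp (- (c * (x - m)\<^sup>2)) = sqrt (pi / c) * normal_density m s x" for x
  proof -
    have "2 * pi * s\<^sup>2 = pi / c" "2 * s\<^sup>2 = 1 / c" using c by (simp_all add: s(2))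
    then show ?thesis using c by (simp add: normal_density_def)
  qed
  have "(\<integral>\<^sup>+x. ennreal (exp (- (c * (x - m)\<^sup>2))) \<partial>lborel)
      = ennreal (sqrt (pi / c)) * (\<integral>\<^sup>+x. ennreal (normal_density m s x) \<partial>lborel)"
    using c by (subst nn_integral_cmult[symmetric]) (simp_all only: dens ennreal_mult'[symmetric], auto simp: ennreal_mult)
  also have "(\<integral>\<^sup>+x. ennreal (normal_density m s x) \<partial>lborel) = 1"
    using prob_space.emeasure_space_1[OF prob_space_normal_density[OF s(1), of m]]
    by (simp add: emeasure_density)
  finally show ?thesis by simp
qed

lemma nn_integral_gker:
  assumes c: "c > 0"
  shows "(\<integral>\<^sup>+z. gker c (z - w) \<partial>lborel) = ennreal (pi / c)"
proof -
  define f where "f b x = exp (- (c * (x - w \<bullet> b)\<^sup>2))" for b :: complex and x :: real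
  have "exp (- (c * (cmod (z - w))\<^sup>2)) = (\<Prod>b\<in>Basis. f b (z \<bullet> b))" for z
    by (simp add: f_def Basis_complex_def inner_complex_def cmod_power2 exp_add[symmetric] algebra_simps)
  then have "(\<integral>\<^sup>+z. gker c (z - w) \<partial>lborel) = (\<integral>\<^sup>+z. (\<Prod>b\<in>Basis. ennreal (f b (z \<bullet> b))) \<partial>lborel)"
    by (simp add: prod_ennreal f_def)
  also have "\<dots> = (\<Prod>b\<in>Basis. (\<integral>\<^sup>+x. ennreal (f b x) \<partial>lborel))"
    by (subst nn_integral_lborel_prod) (auto simp: f_def)
  also have "\<dots> = (\<Prod>b\<in>(Basis::complex set). ennreal (sqrt (pi / c)))"
    unfolding f_def by (simp add: nn_integral_real_gaussian[OF c])
  also have "\<dots> = ennreal (pi / c)"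
    using c by (simp add: power2_eq_square ennreal_mult'[symmetric])
  finally show ?thesis .
qed

lemma nn_integral_gker_affine:
  assumes c: "c > 0" and a: "a \<noteq> 0"
  shows "(\<integral>\<^sup>+z. gker c (a * z - w) \<partial>lborel) = ennreal (pi / (c * (cmod a)\<^sup>2))"
proof -
  have "c * (cmod (a * z - w))\<^sup>2 = (c * (cmod a)\<^sup>2) * (cmod (z - w / a))\<^sup>2" for z
  proof -
    have "a * z - w = a * (z - w / a)" using a by (simp add: field_simps)
    then show ?thesis by (metis norm_mult power_mult_distrib mult.assoc)
  qed
  then have "(\<integral>\<^sup>+z. gker c (a * z - w) \<partial>lborel) = (\<integral>\<^sup>+z. gker (c * (cmod a)\<^sup>2) (z - w / a) \<partial>lborel)"
    by (simp only:)
  then show ?thesis using c a by (simp add: nn_integral_gker)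
qed

text \<open>Squared Euclidean norm of the block indexed by \<open>I\<close>. Coordinates outside
  \<open>I\<close> do not count, so \<open>undefined\<close> values there are harmless.\<close>

definition sqn :: "nat set \<Rightarrow> (nat \<Rightarrow> complex) \<Rightarrow> real" where
  "sqn I v = (\<Sum>t\<in>I. (cmod (v t))\<^sup>2)"

lemma sqn_nonneg [simp]: "0 \<le> sqn I v"
  by (simp add: sqn_def sum_nonneg)

abbreviation LB :: "nat set \<Rightarrow> (nat \<Rightarrow> complex) measure" where
  "LB I \<equiv> PiM I (\<lambda>_. lborel)"

interpretation lbp: product_sigma_finite "\<lambda>_::nat. lborel :: complex measure"
  by standard

lemma measurable_sqn [measurable (raw)]:
  assumes "\<And>t. t \<in> I \<Longrightarrow> (\<lambda>y. v y t) \<in> borel_measurable M"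
  shows "(\<lambda>y. sqn I (v y)) \<in> borel_measurable M"
  unfolding sqn_def using assms by (intro borel_measurable_sum) measurable

lemma exp_sqn: "ennreal (exp (- (c * sqn I v))) = (\<Prod>t\<in>I. gker c (v t))" if "finite I"
  using that by (simp add: sqn_def prod_ennreal sum_distrib_left flip: sum_negf exp_sum)

lemma nn_integral_exp_sqn:
  assumes "finite I" "c > 0" "a \<noteq> 0"
  shows "(\<integral>\<^sup>+y. ennreal (exp (- (c * sqn I (\<lambda>t. a * y t - b t)))) \<partial>LB I)
       = ennreal ((pi / (c * (cmod a)\<^sup>2)) ^ card I)"
proof -
  have "(\<integral>\<^sup>+y. ennreal (exp (- (c * sqn I (\<lambda>t. a * y t - b t)))) \<partial>LB I)
      = (\<integral>\<^sup>+y. (\<Prod>t\<in>I. gker c (a * y t - b t)) \<partial>LB I)"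
    by (simp only: exp_sqn[OF assms(1)])
  also have "\<dots> = (\<Prod>t\<in>I. \<integral>\<^sup>+z. gker c (a * z - b t) \<partial>lborel)"
    by (rule lbp.product_nn_integral_prod[OF assms(1)]) simp
  also have "\<dots> = (\<Prod>t\<in>I. ennreal (pi / (c * (cmod a)\<^sup>2)))"
    by (simp add: nn_integral_gker_affine[OF assms(2,3)])
  finally show ?thesis using assms by (simp add: ennreal_power)
qed

text \<open>Measures on a finite product agree once they agree on boxes, and there translation
  invariance of \<open>lborel\<close> acts coordinatewise. The restriction keeps translates
  extensional, just as \<open>Y1\<close> and \<open>Y2\<close> are \<open>undefined\<close> outside
  \<open>{1..n}\<close>.\<close>

lemma LB_translate:
  assumes I: "finite I"
  shows "distr (LB I) (LB I) (\<lambda>y. \<lambda>t\<in>I. s t + y t) = LB I"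
proof (rule lbp.PiM_eqI[OF I])
  fix A :: "nat \<Rightarrow> complex set" assume A: "\<And>i. i \<in> I \<Longrightarrow> A i \<in> sets lborel"
  have [measurable]: "(\<lambda>y. \<lambda>t\<in>I. s t + y t) \<in> LB I \<rightarrow>\<^sub>M LB I" by measurable
  have tr: "emeasure lborel ((+) (s i) -` A i) = emeasure lborel (A i)" if "i \<in> I" for i
  proof -
    have "emeasure lborel (A i) = emeasure (distr lborel borel ((+) (s i))) (A i)"
      by (simp add: lborel_distr_plus)
    also have "\<dots> = emeasure lborel ((+) (s i) -` A i)"
      using A[OF that] by (subst emeasure_distr) auto
    finally show ?thesis by simp
  qed
  have "emeasure (distr (LB I) (LB I) (\<lambda>y. \<lambda>t\<in>I. s t + y t)) (Pi\<^sub>E I A)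
      = emeasure (LB I) ((\<lambda>y. \<lambda>t\<in>I. s t + y t) -` Pi\<^sub>E I A \<inter> space (LB I))"
    using A I by (subst emeasure_distr) (auto intro!: sets_PiM_I_finite)
  also have "(\<lambda>y. \<lambda>t\<in>I. s t + y t) -` Pi\<^sub>E I A \<inter> space (LB I) = Pi\<^sub>E I (\<lambda>i. (+) (s i) -` A i)"
    by (auto simp: space_PiM PiE_iff extensional_def)
  also have "emeasure (LB I) \<dots> = (\<Prod>i\<in>I. emeasure lborel ((+) (s i) -` A i))"
    using A I by (subst lbp.emeasure_PiM) (auto intro!: measurable_sets_borel[of "(+) (s _)" borel])
  also have "\<dots> = (\<Prod>i\<in>I. emeasure lborel (A i))"
    by (intro prod.cong refl tr)
  finally show "emeasure (distr (LB I) (LB I) (\<lambda>y. \<lambda>t\<in>I. s t + y t)) (Pi\<^sub>E I A)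
      = (\<Prod>i\<in>I. emeasure lborel (A i))" .
qed simp

lemma nn_integral_LB_translate:
  assumes "finite I" and [measurable]: "F \<in> borel_measurable (LB I)"
  shows "(\<integral>\<^sup>+y. F (\<lambda>t\<in>I. s t + y t) \<partial>LB I) = (\<integral>\<^sup>+y. F y \<partial>LB I)"
proof -
  have "(\<integral>\<^sup>+y. F y \<partial>LB I) = (\<integral>\<^sup>+y. F y \<partial>distr (LB I) (LB I) (\<lambda>y. \<lambda>t\<in>I. s t + y t))"
    by (simp add: LB_translate[OF assms(1)])
  also have "\<dots> = (\<integral>\<^sup>+y. F (\<lambda>t\<in>I. s t + y t) \<partial>LB I)"
    by (rule nn_integral_distr) measurable
  finally show ?thesis by simp
qed

section \<open>The noise as a product of complex Gaussian measures\<close>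

lemma sets_cgauss [measurable_cong]: "sets cgauss = sets borel"
  by (simp add: cgauss_def)

lemma space_cgauss [simp]: "space cgauss = UNIV"
  by (simp add: cgauss_def)

lemma prob_space_cgauss: "prob_space cgauss"
proof
  have "emeasure cgauss (space cgauss) = (\<integral>\<^sup>+z. ennreal (1 / pi) * gker 1 (z - 0) \<partial>lborel)"
    unfolding cgauss_def by (simp add: emeasure_density ennreal_mult'[symmetric])
  also have "\<dots> = ennreal (1 / pi) * ennreal (pi / 1)"
    by (subst nn_integral_cmult) (simp_all only: nn_integral_gker, auto)
  finally show "emeasure cgauss (space cgauss) = 1"
    by (simp add: ennreal_mult'[symmetric])
qed

interpretation cg: prob_space cgauss by (rule prob_space_cgauss)
interpretation cgp: product_sigma_finite "\<lambda>_::nat. cgauss" by standard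
interpretation cg2: pair_prob_space cgauss cgauss by standard
interpretation cg2p: product_sigma_finite "\<lambda>_::nat. cgauss \<Otimes>\<^sub>M cgauss" by standard

lemma sets_PiM_cgauss [measurable_cong]: "sets (PiM I (\<lambda>_. cgauss)) = sets (LB I)"
  by (rule sets_PiM_cong) (simp_all add: sets_cgauss)

lemma space_PiM_cgauss [simp]: "space (PiM I (\<lambda>_. cgauss)) = space (LB I)"
  by (rule sets_eq_imp_space_eq[OF sets_PiM_cgauss])

text \<open>Passing to Lebesgue measure makes different signals comparable: each becomes a shift of
  one kernel, against a common measure.\<close>

lemma PiM_cgauss_density:
  assumes I: "finite I"
  shows "PiM I (\<lambda>_. cgauss) = density (LB I) (\<lambda>y. ennreal (exp (- sqn I y) / pi ^ card I))"
proof (rule cgp.PiM_eqI[OF I, symmetric])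
  show "sets (density (LB I) (\<lambda>y. ennreal (exp (- sqn I y) / pi ^ card I))) = sets (PiM I (\<lambda>_. cgauss))"
    by (simp add: sets_PiM_cgauss)
next
  fix A assume "\<And>i. i \<in> I \<Longrightarrow> A i \<in> sets cgauss"
  then have A: "\<And>i. i \<in> I \<Longrightarrow> A i \<in> sets borel" by (simp add: sets_cgauss)
  define g where "g z = ennreal (exp (- (cmod z)\<^sup>2) / pi)" for z
  have [measurable]: "g \<in> borel_measurable borel" unfolding g_def by measurable
  have dens: "ennreal (exp (- sqn I y) / pi ^ card I) = (\<Prod>i\<in>I. g (y i))" for y
    using I by (simp add: g_def sqn_def prod_ennreal prod_dividef exp_sum flip: sum_negf)
  have ind: "indicator (Pi\<^sub>E I A) y = (\<Prod>i\<in>I. indicator (A i) (y i) :: ennreal)" if "y \<in> space (LB I)" for y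
    using that I by (auto simp: indicator_def space_PiM PiE_iff intro!: prod.neutral)
  have "emeasure (density (LB I) (\<lambda>y. ennreal (exp (- sqn I y) / pi ^ card I))) (Pi\<^sub>E I A)
     = (\<integral>\<^sup>+y. (\<Prod>i\<in>I. g (y i)) * indicator (Pi\<^sub>E I A) y \<partial>LB I)"
    using A I unfolding dens by (subst emeasure_density) (auto intro!: sets_PiM_I_finite)
  also have "\<dots> = (\<integral>\<^sup>+y. (\<Prod>i\<in>I. g (y i) * indicator (A i) (y i)) \<partial>LB I)"
    by (intro nn_integral_cong) (simp add: ind prod.distrib)
  also have "\<dots> = (\<Prod>i\<in>I. \<integral>\<^sup>+z. g z * indicator (A i) z \<partial>lborel)"
    using A I by (intro lbp.product_nn_integral_prod) auto
  also have "\<dots> = (\<Prod>i\<in>I. emeasure cgauss (A i))"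
    using A by (intro prod.cong refl) (simp add: cgauss_def emeasure_density g_def)
  finally show "emeasure (density (LB I) (\<lambda>y. ennreal (exp (- sqn I y) / pi ^ card I))) (Pi\<^sub>E I A)
      = (\<Prod>i\<in>I. emeasure cgauss (A i))" .
qed

text \<open>\<open>noise\<close> draws a pair at each time, while decoding needs one noise vector
  per receiver. Zipping two independent vectors gives the law of \<open>noise\<close>, so the noise
  vectors of the receivers are independent.\<close>

lemma unzip_PiM_cgauss:
  fixes I :: "nat set"
  assumes I: "finite I"
  shows "distr (PiM I (\<lambda>_. cgauss) \<Otimes>\<^sub>M PiM I (\<lambda>_. cgauss)) (PiM I (\<lambda>_. cgauss \<Otimes>\<^sub>M cgauss))
           (\<lambda>(x, y). \<lambda>t\<in>I. (x t, y t)) = PiM I (\<lambda>_. cgauss \<Otimes>\<^sub>M cgauss)"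
proof (rule cg2p.PiM_eqI[OF I])
  let ?M = "PiM I (\<lambda>_. cgauss)" and ?N = "PiM I (\<lambda>_. cgauss \<Otimes>\<^sub>M cgauss)"
  interpret PI: prob_space ?M by (rule prob_space_PiM) (rule prob_space_cgauss)
  fix A assume A: "\<And>i. i \<in> I \<Longrightarrow> A i \<in> sets (cgauss \<Otimes>\<^sub>M cgauss)"
  let ?f = "\<lambda>(x, y). \<lambda>t\<in>I. (x t, y t)"
  have f[measurable]: "?f \<in> ?M \<Otimes>\<^sub>M ?M \<rightarrow>\<^sub>M ?N" by measurable
  have bx: "Pi\<^sub>E I A \<in> sets ?N" using A I by (auto intro!: sets_PiM_I_finite)
  have A'[measurable]: "i \<in> I \<Longrightarrow> A i \<in> sets (borel \<Otimes>\<^sub>M borel)" for i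
    using A[of i] sets_pair_measure_cong[OF sets_cgauss sets_cgauss] by simp
  have mi: "i \<in> I \<Longrightarrow> (\<lambda>p. indicator (A i) p :: ennreal) \<in> borel_measurable (borel \<Otimes>\<^sub>M borel)" for i
    by measurable
  have "emeasure (distr (?M \<Otimes>\<^sub>M ?M) ?N ?f) (Pi\<^sub>E I A) = (\<integral>\<^sup>+p. indicator (Pi\<^sub>E I A) (?f p) \<partial>(?M \<Otimes>\<^sub>M ?M))"
    using bx by (subst nn_integral_distr[OF f, symmetric]) auto
  also have "\<dots> = (\<integral>\<^sup>+p. (\<Prod>i\<in>I. indicator (A i) (fst p i, snd p i)) \<partial>(?M \<Otimes>\<^sub>M ?M))"
    using I by (intro nn_integral_cong) (auto simp: indicator_def PiE_iff intro!: prod.neutral)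
  also have "\<dots> = (\<integral>\<^sup>+x. \<integral>\<^sup>+y. (\<Prod>i\<in>I. indicator (A i) (x i, y i)) \<partial>?M \<partial>?M)"
    by (subst PI.nn_integral_fst[symmetric]) (auto intro!: borel_measurable_prod mi measurable_compose[OF _ mi])
  also have "\<dots> = (\<integral>\<^sup>+x. (\<Prod>i\<in>I. \<integral>\<^sup>+z. indicator (A i) (x i, z) \<partial>cgauss) \<partial>?M)"
    using A I by (intro nn_integral_cong cgp.product_nn_integral_prod) (auto intro!: measurable_compose[OF _ mi])
  also have "\<dots> = (\<Prod>i\<in>I. \<integral>\<^sup>+w. \<integral>\<^sup>+z. indicator (A i) (w, z) \<partial>cgauss \<partial>cgauss)"
    using I by (intro cgp.product_nn_integral_prod cg.borel_measurable_nn_integral) 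
      (auto simp: split_beta intro!: measurable_compose[OF _ mi])
  also have "\<dots> = (\<Prod>i\<in>I. emeasure (cgauss \<Otimes>\<^sub>M cgauss) (A i))"
    using A by (intro prod.cong refl) (simp add: cg.emeasure_pair_measure)
  finally show "emeasure (distr (?M \<Otimes>\<^sub>M ?M) ?N ?f) (Pi\<^sub>E I A) = (\<Prod>i\<in>I. emeasure (cgauss \<Otimes>\<^sub>M cgauss) (A i))" .
qed simp

section \<open>Probability of correct decoding\<close>

text \<open>Probability that the signal \<open>s\<close> plus unit complex Gaussian noise falls into
  \<open>D\<close>, as \<open>emeasure_shifted_noise\<close> confirms. The integral form is the one
  that packing arguments can bound.\<close>

definition gprob :: "nat set \<Rightarrow> (nat \<Rightarrow> complex) set \<Rightarrow> (nat \<Rightarrow> complex) \<Rightarrow> ennreal" where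
  "gprob I D s = (\<integral>\<^sup>+y. indicator D y * ennreal (exp (- sqn I (\<lambda>t. y t - s t)) / pi ^ card I) \<partial>LB I)"

lemma sqn_cong: "(\<And>t. t \<in> I \<Longrightarrow> u t = v t) \<Longrightarrow> sqn I u = sqn I v"
  by (simp add: sqn_def)

lemma emeasure_shifted_noise:
  assumes I: "finite I" and D[measurable]: "D \<in> sets (LB I)"
  shows "emeasure (PiM I (\<lambda>_. cgauss)) {x \<in> space (LB I). (\<lambda>t\<in>I. s t + x t) \<in> D} = gprob I D s"
proof -
  have [measurable]: "(\<lambda>y. \<lambda>t\<in>I. s t + y t) \<in> LB I \<rightarrow>\<^sub>M LB I" by measurable
  have m: "{x \<in> space (LB I). (\<lambda>t\<in>I. s t + x t) \<in> D} \<in> sets (LB I)" by measurable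
  have "emeasure (PiM I (\<lambda>_. cgauss)) {x \<in> space (LB I). (\<lambda>t\<in>I. s t + x t) \<in> D}
      = (\<integral>\<^sup>+x. ennreal (exp (- sqn I x) / pi ^ card I)
            * indicator {x \<in> space (LB I). (\<lambda>t\<in>I. s t + x t) \<in> D} x \<partial>LB I)"
    unfolding PiM_cgauss_density[OF I] by (rule emeasure_density) (use m in measurable)
  also have "\<dots> = (\<integral>\<^sup>+x. indicator D (\<lambda>t\<in>I. s t + x t)
       * ennreal (exp (- sqn I (\<lambda>t. (\<lambda>t\<in>I. s t + x t) t - s t)) / pi ^ card I) \<partial>LB I)"
    by (intro nn_integral_cong) (auto simp: indicator_def intro!: arg_cong[where f = "\<lambda>u. exp (- u) / _"] sqn_cong)
  also have "\<dots> = gprob I D s" unfolding gprob_def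
    by (rule nn_integral_LB_translate[OF I]) measurable
  finally show ?thesis .
qed

text \<open>Decoding region of the output \<open>d\<close>. Regions of distinct outputs are
  disjoint; together with measurability, this is how a decoder enters the converse.\<close>

definition decs :: "nat \<Rightarrow> ((nat \<Rightarrow> complex) \<Rightarrow> nat \<times> nat) \<Rightarrow> nat \<times> nat \<Rightarrow> (nat \<Rightarrow> complex) set" where
  "decs n g d = {y \<in> space (LB {1..n}). g y = d}"

lemma sets_outsp: "sets (outsp n) = sets (LB {1..n})"
  unfolding outsp_def by (rule sets_PiM_cong) auto

lemma decs_sets [measurable]:
  assumes "g \<in> outsp n \<rightarrow>\<^sub>M count_space UNIV"
  shows "decs n g d \<in> sets (LB {1..n})"
proof -
  have "g -` {d} \<inter> space (outsp n) \<in> sets (outsp n)"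
    by (rule measurable_sets[OF assms]) simp
  also have "g -` {d} \<inter> space (outsp n) = decs n g d"
    using sets_eq_imp_space_eq[OF sets_outsp] by (auto simp: decs_def)
  finally show ?thesis by (simp add: sets_outsp)
qed

lemma noise_split:
  assumes [measurable]: "A \<in> sets (LB {1..n})" "B \<in> sets (LB {1..n})"
  shows "{z \<in> space (noise n). (\<lambda>t\<in>{1..n}. fst (z t)) \<in> A \<and> (\<lambda>t\<in>{1..n}. snd (z t)) \<in> B} \<in> sets (noise n)"
    "emeasure (noise n) {z \<in> space (noise n). (\<lambda>t\<in>{1..n}. fst (z t)) \<in> A \<and> (\<lambda>t\<in>{1..n}. snd (z t)) \<in> B}
      = emeasure (PiM {1..n} (\<lambda>_. cgauss)) A * emeasure (PiM {1..n} (\<lambda>_. cgauss)) B"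
proof -
  let ?M = "PiM {1..n} (\<lambda>_. cgauss)" and ?N = "PiM {1..n} (\<lambda>_. cgauss \<Otimes>\<^sub>M cgauss)"
  let ?E = "{z \<in> space (noise n). (\<lambda>t\<in>{1..n}. fst (z t)) \<in> A \<and> (\<lambda>t\<in>{1..n}. snd (z t)) \<in> B}"
  interpret PI: prob_space ?M by (rule prob_space_PiM) (rule prob_space_cgauss)
  let ?f = "\<lambda>(x, y). \<lambda>t\<in>{1..n}. (x t, y t)"
  have f[measurable]: "?f \<in> ?M \<Otimes>\<^sub>M ?M \<rightarrow>\<^sub>M ?N" by measurable
  have m1[measurable]: "(\<lambda>z. \<lambda>t\<in>{1..n}. fst (z t)) \<in> ?N \<rightarrow>\<^sub>M ?M" by measurable
  have m2[measurable]: "(\<lambda>z. \<lambda>t\<in>{1..n}. snd (z t)) \<in> ?N \<rightarrow>\<^sub>M ?M" by measurable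
  have AB[measurable]: "A \<in> sets ?M" "B \<in> sets ?M" by (simp_all only: sets_PiM_cgauss assms)
  show E: "?E \<in> sets (noise n)" unfolding noise_def by measurable
  have "emeasure (noise n) ?E = emeasure (distr (?M \<Otimes>\<^sub>M ?M) ?N ?f) ?E"
    unfolding noise_def by (subst unzip_PiM_cgauss) auto
  also have "\<dots> = emeasure (?M \<Otimes>\<^sub>M ?M) (?f -` ?E \<inter> space (?M \<Otimes>\<^sub>M ?M))"
    using E by (subst emeasure_distr[OF f]) (auto simp: noise_def)
  also have "?f -` ?E \<inter> space (?M \<Otimes>\<^sub>M ?M) = A \<times> B"
  proof -
    have "A \<subseteq> space ?M" "B \<subseteq> space ?M" using sets.sets_into_space[OF AB(1)] sets.sets_into_space[OF AB(2)] by blast+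
    moreover have "restrict x {1..n} = x" if "x \<in> space ?M" for x
      using that by (auto simp: space_PiM PiE_iff extensional_def)
    moreover have "?f p \<in> space (noise n)" for p
      by (auto simp: noise_def space_PiM space_pair_measure split: prod.splits)
    ultimately show ?thesis
      by (auto simp: space_pair_measure cong: restrict_cong split: prod.splits) 
  qed
  also have "emeasure (?M \<Otimes>\<^sub>M ?M) (A \<times> B) = emeasure ?M A * emeasure ?M B"
    using AB by (rule PI.emeasure_pair_measure_Times)
  finally show "emeasure (noise n) ?E = emeasure ?M A * emeasure ?M B" .
qed

lemma prob_space_noise: "prob_space (noise n)"
  unfolding noise_def by (rule prob_space_PiM) (rule cg2.prob_space_axioms)

definition sig1 :: "chan \<Rightarrow> (nat \<Rightarrow> nat \<Rightarrow> nat \<Rightarrow> complex) \<Rightarrow> (nat \<Rightarrow> nat \<Rightarrow> nat \<Rightarrow> complex)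
    \<Rightarrow> nat \<Rightarrow> nat \<Rightarrow> nat \<Rightarrow> nat \<Rightarrow> complex" where
  "sig1 h f1 f2 m0 m1 m2 t = h 1 1 * f1 m0 m1 t + h 1 2 * f2 m0 m2 t"

definition sig2 :: "chan \<Rightarrow> (nat \<Rightarrow> nat \<Rightarrow> nat \<Rightarrow> complex) \<Rightarrow> (nat \<Rightarrow> nat \<Rightarrow> nat \<Rightarrow> complex)
    \<Rightarrow> nat \<Rightarrow> nat \<Rightarrow> nat \<Rightarrow> nat \<Rightarrow> complex" where
  "sig2 h f1 f2 m0 m1 m2 t = h 2 1 * f1 m0 m1 t + h 2 2 * f2 m0 m2 t"

lemma Y1_eq: "Y1 h n f1 f2 m0 m1 m2 z = (\<lambda>t\<in>{1..n}. sig1 h f1 f2 m0 m1 m2 t + fst (z t))"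
  by (auto simp: Y1_def sig1_def restrict_def)

lemma Y2_eq: "Y2 h n f1 f2 m0 m1 m2 z = (\<lambda>t\<in>{1..n}. sig2 h f1 f2 m0 m1 m2 t + snd (z t))"
  by (auto simp: Y2_def sig2_def restrict_def)

text \<open>Given the messages, both signals are deterministic, so the events at the receivers
  depend on independent noise vectors and their probabilities multiply. The sets are general because
  decoding regions and their complements both occur.\<close>

lemma emeasure_correct_general:
  assumes [measurable]: "A \<in> sets (LB {1..n})" "B \<in> sets (LB {1..n})"
  shows "{z \<in> space (noise n). Y1 h n f1 f2 m0 m1 m2 z \<in> A \<and> Y2 h n f1 f2 m0 m1 m2 z \<in> B} \<in> sets (noise n)"
    and "emeasure (noise n) {z \<in> space (noise n). Y1 h n f1 f2 m0 m1 m2 z \<in> A \<and> Y2 h n f1 f2 m0 m1 m2 z \<in> B}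
      = gprob {1..n} A (sig1 h f1 f2 m0 m1 m2) * gprob {1..n} B (sig2 h f1 f2 m0 m1 m2)"
proof -
  let ?s1 = "sig1 h f1 f2 m0 m1 m2" and ?s2 = "sig2 h f1 f2 m0 m1 m2"
  define A' where "A' = {x \<in> space (LB {1..n}). (\<lambda>t\<in>{1..n}. ?s1 t + x t) \<in> A}"
  define B' where "B' = {x \<in> space (LB {1..n}). (\<lambda>t\<in>{1..n}. ?s2 t + x t) \<in> B}"
  have tr: "(\<lambda>y. \<lambda>t\<in>{1..n}. s t + y t) \<in> LB {1..n} \<rightarrow>\<^sub>M LB {1..n}" for s :: "nat \<Rightarrow> complex" by measurable
  have [measurable]: "A' \<in> sets (LB {1..n})" "B' \<in> sets (LB {1..n})"
    unfolding A'_def B'_def using tr[of ?s1] tr[of ?s2] by measurable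
  have eq: "{z \<in> space (noise n). Y1 h n f1 f2 m0 m1 m2 z \<in> A \<and> Y2 h n f1 f2 m0 m1 m2 z \<in> B}
     = {z \<in> space (noise n). (\<lambda>t\<in>{1..n}. fst (z t)) \<in> A' \<and> (\<lambda>t\<in>{1..n}. snd (z t)) \<in> B'}"
    by (auto simp: Y1_eq Y2_eq A'_def B'_def space_PiM cong: restrict_cong)
  show "{z \<in> space (noise n). Y1 h n f1 f2 m0 m1 m2 z \<in> A \<and> Y2 h n f1 f2 m0 m1 m2 z \<in> B} \<in> sets (noise n)"
    unfolding eq by (rule noise_split) measurable
  show "emeasure (noise n) {z \<in> space (noise n). Y1 h n f1 f2 m0 m1 m2 z \<in> A \<and> Y2 h n f1 f2 m0 m1 m2 z \<in> B}
      = gprob {1..n} A ?s1 * gprob {1..n} B ?s2"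
    unfolding eq noise_split(2)[OF \<open>A' \<in> _\<close> \<open>B' \<in> _\<close>]
    unfolding A'_def B'_def by (simp only: emeasure_shifted_noise finite_atLeastAtMost assms)
qed

lemma gprob_le_1: assumes "finite I" "D \<in> sets (LB I)" shows "gprob I D s \<le> 1"
proof -
  interpret PI: prob_space "PiM I (\<lambda>_. cgauss)" by (rule prob_space_PiM) (rule prob_space_cgauss)
  show ?thesis unfolding emeasure_shifted_noise[OF assms, symmetric] by (rule PI.emeasure_le_1)
qed

lemma gprob_space: assumes "finite I" shows "gprob I (space (LB I)) s = 1"
proof -
  interpret PI: prob_space "PiM I (\<lambda>_. cgauss)" by (rule prob_space_PiM) (rule prob_space_cgauss)
  have "{x \<in> space (LB I). (\<lambda>t\<in>I. s t + x t) \<in> space (LB I)} = space (PiM I (\<lambda>_. cgauss))"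
    by (auto simp: space_PiM)
  then show ?thesis using emeasure_shifted_noise[OF assms, of "space (LB I)" s]
    using PI.emeasure_space_1 by simp
qed

lemma Y1_in_decs: "Y1 h n f1 f2 m0 m1 m2 z \<in> decs n g d \<longleftrightarrow> g (Y1 h n f1 f2 m0 m1 m2 z) = d"
  by (auto simp: decs_def Y1_eq space_PiM)

lemma Y2_in_decs: "Y2 h n f1 f2 m0 m1 m2 z \<in> decs n g d \<longleftrightarrow> g (Y2 h n f1 f2 m0 m1 m2 z) = d"
  by (auto simp: decs_def Y2_eq space_PiM)

lemma error_prob_eq:
  assumes g: "g1 \<in> outsp n \<rightarrow>\<^sub>M count_space UNIV" "g2 \<in> outsp n \<rightarrow>\<^sub>M count_space UNIV"
  shows "ennreal (1 - measure (noise n) {z \<in> space (noise n).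
           g1 (Y1 h n f1 f2 m0 m1 m2 z) \<noteq> d1 \<or> g2 (Y2 h n f1 f2 m0 m1 m2 z) \<noteq> d2})
    = gprob {1..n} (decs n g1 d1) (sig1 h f1 f2 m0 m1 m2) * gprob {1..n} (decs n g2 d2) (sig2 h f1 f2 m0 m1 m2)"
proof -
  interpret prob_space "noise n" by (rule prob_space_noise)
  let ?C = "{z \<in> space (noise n). Y1 h n f1 f2 m0 m1 m2 z \<in> decs n g1 d1 \<and> Y2 h n f1 f2 m0 m1 m2 z \<in> decs n g2 d2}"
  note E = emeasure_correct_general[OF decs_sets[OF g(1), of d1] decs_sets[OF g(2), of d2], of h f1 f2 m0 m1 m2]
  have "{z \<in> space (noise n). g1 (Y1 h n f1 f2 m0 m1 m2 z) \<noteq> d1 \<or> g2 (Y2 h n f1 f2 m0 m1 m2 z) \<noteq> d2}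
     = space (noise n) - ?C"
    by (auto simp: Y1_in_decs Y2_in_decs)
  then show ?thesis using E by (simp add: prob_compl emeasure_eq_measure)
qed

lemma nmsg_ge_1: "R \<ge> 0 \<Longrightarrow> nmsg n R \<ge> 1"
proof -
  assume "R \<ge> 0"
  then have "2 powr (real n * R) \<ge> 1" by (simp add: ge_one_powr_ge_zero)
  then have "1 \<le> \<lceil>2 powr (real n * R)\<rceil>" by linarith
  then show ?thesis unfolding nmsg_def by linarith
qed

lemma nmsg_ge: "2 powr (real n * R) \<le> real (nmsg n R)"
  unfolding nmsg_def using real_nat_ceiling_ge by blast

section \<open>Packing bounds\<close>

lemma sum_indicator_disjoint_le_1:
  assumes "finite J" "disjoint_family_on D J"
  shows "(\<Sum>m\<in>J. indicator (D m) y :: ennreal) \<le> 1"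
proof -
  have "(\<Sum>m\<in>J. indicator (D m) y :: ennreal) = indicator (\<Union>(D ` J)) y"
    by (rule indicator_UN_disjoint[OF assms, symmetric])
  then show ?thesis by (simp add: indicator_def split: if_splits)
qed

text \<open>Disjointness of decoding regions enters the converse only here: at each \<open>y\<close>
  at most one summand survives, and it is dominated by \<open>\<kappa> y\<close>.\<close>

lemma packing_bound:
  fixes k :: "'b \<Rightarrow> 'a \<Rightarrow> ennreal"
  assumes J: "finite J" "disjoint_family_on D J"
    and D [measurable]: "\<And>m. m \<in> J \<Longrightarrow> D m \<in> sets M"
    and k [measurable]: "\<And>m. m \<in> J \<Longrightarrow> k m \<in> borel_measurable M"
    and le: "\<And>m y. m \<in> J \<Longrightarrow> y \<in> space M \<Longrightarrow> k m y \<le> \<kappa> y"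
  shows "(\<Sum>m\<in>J. \<integral>\<^sup>+y. indicator (D m) y * k m y \<partial>M) \<le> (\<integral>\<^sup>+y. \<kappa> y \<partial>M)"
proof -
  have "(\<Sum>m\<in>J. \<integral>\<^sup>+y. indicator (D m) y * k m y \<partial>M) = (\<integral>\<^sup>+y. (\<Sum>m\<in>J. indicator (D m) y * k m y) \<partial>M)"
    by (rule nn_integral_sum[symmetric]) measurable
  also have "\<dots> \<le> (\<integral>\<^sup>+y. \<kappa> y \<partial>M)"
  proof (rule nn_integral_mono)
    fix y assume y: "y \<in> space M"
    have "(\<Sum>m\<in>J. indicator (D m) y * k m y) \<le> (\<Sum>m\<in>J. indicator (D m) y * \<kappa> y)"
      using le y by (intro sum_mono mult_left_mono) auto
    also have "\<dots> \<le> 1 * \<kappa> y"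
      unfolding sum_distrib_right[symmetric] by (intro mult_right_mono sum_indicator_disjoint_le_1[OF J]) auto
    finally show "(\<Sum>m\<in>J. indicator (D m) y * k m y) \<le> \<kappa> y" by simp
  qed
  finally show ?thesis .
qed

text \<open>Weighted Cauchy-Schwarz. In terms of kernels, a product of Gaussians of widths
  \<open>A\<close> and \<open>B\<close> in \<open>u\<close> and \<open>v\<close> is dominated by a
  Gaussian of width \<open>A + B\<close> in \<open>u - v\<close>, where a term common to
  \<open>u\<close> and \<open>v\<close> has cancelled. This is how a message is eliminated.\<close>

lemma cmod_diff_weighted:
  fixes u v :: complex
  assumes "A > 0" "B > 0"
  shows "(cmod (u - v))\<^sup>2 / (A + B) \<le> (cmod u)\<^sup>2 / A + (cmod v)\<^sup>2 / B"
proof -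
  have "(cmod (u - v))\<^sup>2 \<le> (cmod u + cmod v)\<^sup>2"
    by (intro power_mono norm_triangle_ineq4) auto
  also have "\<dots> \<le> ((cmod u)\<^sup>2 / A + (cmod v)\<^sup>2 / B) * (A + B)"
  proof -
    have "((cmod u)\<^sup>2 / A + (cmod v)\<^sup>2 / B) * (A + B) - (cmod u + cmod v)\<^sup>2
        = (cmod u * B - cmod v * A)\<^sup>2 / (A * B)"
      using assms by (simp add: field_simps power2_eq_square)
    moreover have "\<dots> \<ge> 0" using assms by simp
    ultimately show ?thesis by linarith
  qed
  finally show ?thesis using assms by (simp add: pos_divide_le_eq)
qed

lemma sqn_diff_weighted:
  assumes "A > 0" "B > 0"
  shows "sqn I (\<lambda>t. u t - v t) / (A + B) \<le> sqn I u / A + sqn I v / B"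
  unfolding sqn_def sum_divide_distrib sum.distrib[symmetric]
  by (intro sum_mono cmod_diff_weighted assms)

lemma sqn_scale: "sqn I (\<lambda>t. a * u t) = (cmod a)\<^sup>2 * sqn I u"
  by (simp add: sqn_def norm_mult power_mult_distrib sum_distrib_left)

lemma sqn_minus_commute: "sqn I (\<lambda>t. u t - v t) = sqn I (\<lambda>t. v t - u t)"
  by (simp add: sqn_def norm_minus_commute)

text \<open>Based on |y|^2 \<le> 2 |y - s|^2 + 2 |s|^2: the energy of \<open>s\<close> costs a
  factor exp (1/2) per symbol, and the wide kernel that remains is independent of \<open>s\<close>.
  Only half of the exponent is spent, so that the other half can serve a second purpose.\<close>

lemma half_gaussian_dom:
  assumes E: "E \<ge> 1" and s: "sqn I s \<le> E * real (card I)"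
  shows "exp (- (sqn I (\<lambda>t. y t - s t) / 2)) \<le> 2 ^ card I * exp (- (1 / (4 * E) * sqn I y))"
proof -
  define n where "n = real (card I)"
  have "sqn I (\<lambda>t. (y t - s t) - (- s t)) / (1 + 1) \<le> sqn I (\<lambda>t. y t - s t) / 1 + sqn I (\<lambda>t. - s t) / 1"
    by (rule sqn_diff_weighted) auto
  then have "sqn I y \<le> 2 * sqn I (\<lambda>t. y t - s t) + 2 * (E * n)"
    using s by (simp add: sqn_def n_def)
  then have "1 / (4 * E) * sqn I y \<le> 1 / (4 * E) * (2 * sqn I (\<lambda>t. y t - s t) + 2 * (E * n))"
    using E by (intro mult_left_mono) auto
  also have "\<dots> = sqn I (\<lambda>t. y t - s t) / (2 * E) + n / 2" using E by (simp add: field_simps)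
  also have "sqn I (\<lambda>t. y t - s t) / (2 * E) \<le> sqn I (\<lambda>t. y t - s t) / 2"
    using E by (intro divide_left_mono) auto
  finally have "- (sqn I (\<lambda>t. y t - s t) / 2) \<le> n * (1/2) + - (1 / (4 * E) * sqn I y)" by simp
  then have "exp (- (sqn I (\<lambda>t. y t - s t) / 2)) \<le> exp (n * (1/2)) * exp (- (1 / (4 * E) * sqn I y))"
    by (simp add: exp_add[symmetric])
  also have "exp (n * (1/2)) = exp (1/2) ^ card I" using exp_of_nat_mult[of "card I" "1/2::real"] by (simp add: n_def)
  also have "exp (1/2) ^ card I \<le> (2::real) ^ card I"
    using exp_bound_half[of "1/2::real"] by (intro power_mono) auto
  finally show ?thesis by simp
qed

lemma gaussian_dom:
  assumes E: "E \<ge> 1" and s: "sqn I s \<le> E * real (card I)"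
  shows "exp (- sqn I (\<lambda>t. y t - s t)) \<le> 2 ^ card I * exp (- (1 / (4 * E) * sqn I y))"
  by (rule order_trans[OF _ half_gaussian_dom[OF assms]]) simp

lemma gprob_alt:
  "gprob I D s = ennreal (1 / pi ^ card I) * (\<integral>\<^sup>+y. indicator D y * ennreal (exp (- sqn I (\<lambda>t. y t - s t))) \<partial>LB I)"
  if [measurable]: "D \<in> sets (LB I)"
  unfolding gprob_def by (subst nn_integral_cmult[symmetric], measurable)
    (auto intro!: nn_integral_cong simp: indicator_def ennreal_mult'[symmetric])

text \<open>All kernels are wrapped into one of width \<open>4 * E\<close> around the interference
  \<open>v\<close>. Its volume is 4 * pi * E per symbol; with the factor 2 of the domination and the
  normalisation 1 / pi this makes \<open>8 * E\<close>.\<close>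

lemma single_user_packing:
  assumes I: "finite I" and J: "finite J" "disjoint_family_on D J"
    and D: "\<And>m. m \<in> J \<Longrightarrow> D m \<in> sets (LB I)"
    and E: "E \<ge> 1" and x: "\<And>m. m \<in> J \<Longrightarrow> sqn I (x m) \<le> E * real (card I)"
  shows "(\<Sum>m\<in>J. gprob I (D m) (\<lambda>t. x m t + v t)) \<le> ennreal ((8 * E) ^ card I)"
proof -
  let ?n = "card I"
  have "(\<Sum>m\<in>J. gprob I (D m) (\<lambda>t. x m t + v t)) = ennreal (1 / pi ^ ?n) *
     (\<Sum>m\<in>J. \<integral>\<^sup>+y. indicator (D m) y * ennreal (exp (- sqn I (\<lambda>t. y t - (x m t + v t)))) \<partial>LB I)"
    unfolding sum_distrib_left by (intro sum.cong refl gprob_alt D)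
  also have "(\<Sum>m\<in>J. \<integral>\<^sup>+y. indicator (D m) y * ennreal (exp (- sqn I (\<lambda>t. y t - (x m t + v t)))) \<partial>LB I)
     \<le> (\<integral>\<^sup>+y. ennreal (2 ^ ?n) * ennreal (exp (- (1 / (4 * E) * sqn I (\<lambda>t. 1 * y t - v t)))) \<partial>LB I)"
  proof (rule packing_bound[OF J D])
    fix m y assume m: "m \<in> J"
    have "exp (- sqn I (\<lambda>t. (y t - v t) - x m t)) \<le> 2 ^ ?n * exp (- (1 / (4 * E) * sqn I (\<lambda>t. y t - v t)))"
      by (rule gaussian_dom[OF E x[OF m]])
    then show "ennreal (exp (- sqn I (\<lambda>t. y t - (x m t + v t))))
      \<le> ennreal (2 ^ ?n) * ennreal (exp (- (1 / (4 * E) * sqn I (\<lambda>t. 1 * y t - v t))))"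
      by (simp add: ennreal_mult'[symmetric] algebra_simps)
  qed measurable
  also have "\<dots> = ennreal (2 ^ ?n) * ennreal ((pi / (1 / (4 * E) * (cmod 1)\<^sup>2)) ^ ?n)"
    using E I by (subst nn_integral_cmult, measurable, subst nn_integral_exp_sqn) auto
  also have "ennreal (1 / pi ^ ?n) * \<dots> = ennreal ((8 * E) ^ ?n)"
  proof -
    have "1 / pi ^ ?n * (2 ^ ?n * X ^ ?n) = (1 / pi * (2 * X)) ^ ?n" for X :: real
      by (simp add: power_mult_distrib power_divide)
    from this[of "pi / (1 / (4 * E) * (cmod 1)\<^sup>2)"]
    have eq: "1 / pi ^ ?n * (2 ^ ?n * (pi / (1 / (4 * E) * (cmod 1)\<^sup>2)) ^ ?n) = (8 * E) ^ ?n" by simp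
    show ?thesis unfolding eq[symmetric]
      by (subst ennreal_mult'[symmetric], simp, subst ennreal_mult'[symmetric]) auto
  qed
  finally show ?thesis by (simp add: mult_left_mono)
qed

text \<open>Analogue of adding the entropy of \<open>y1\<close> and that of \<open>y2\<close> given
  \<open>y1\<close> and \<open>x1\<close>. Once \<open>x1\<close> is known, \<open>y1\<close> is a
  noisy copy of \<open>b * x2\<close> and locates \<open>y2\<close> up to noise. Packing the sets
  \<open>D2\<close> into that small region bounds the sum over \<open>m2\<close>; packing the sets
  \<open>D1\<close> into the range of \<open>y1\<close> bounds the sum over \<open>m0\<close> and
  \<open>m1\<close>.\<close>

lemma sum_rate_packing:
  fixes a b c d :: complex
  assumes I: "finite I" and J: "finite J0" "\<And>m0. m0 \<in> J0 \<Longrightarrow> finite (J1 m0)" "\<And>m0. m0 \<in> J0 \<Longrightarrow> finite (J2 m0)"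
    and disj1: "disjoint_family_on (\<lambda>(m0, m1). D1 m0 m1) (SIGMA m0:J0. J1 m0)"
    and disj2: "\<And>m0. m0 \<in> J0 \<Longrightarrow> disjoint_family_on (D2 m0) (J2 m0)"
    and D: "\<And>m0 m. D1 m0 m \<in> sets (LB I)" "\<And>m0 m. D2 m0 m \<in> sets (LB I)"
    and E: "E \<ge> 1"
    and s: "\<And>m0 m1 m2. m0 \<in> J0 \<Longrightarrow> m1 \<in> J1 m0 \<Longrightarrow> m2 \<in> J2 m0 \<Longrightarrow>
        sqn I (\<lambda>t. a * x1 m0 m1 t + b * x2 m0 m2 t) \<le> E * real (card I)"
    and bd: "b \<noteq> 0" "d \<noteq> 0"
  shows "(\<Sum>m0\<in>J0. \<Sum>m1\<in>J1 m0. \<Sum>m2\<in>J2 m0.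
      gprob I (D1 m0 m1) (\<lambda>t. a * x1 m0 m1 t + b * x2 m0 m2 t) *
      gprob I (D2 m0 m2) (\<lambda>t. c * x1 m0 m1 t + d * x2 m0 m2 t))
    \<le> ennreal ((16 * E * (1 + (cmod (d / b))\<^sup>2)) ^ card I)"
proof -
  let ?n = "card I"
  \<comment> \<open>Scaling \<open>y2\<close> by \<open>r\<close> makes its \<open>x2\<close> term
    equal to the one in \<open>y1\<close>, so that \<open>r * y2 - y1\<close> depends on
    \<open>x1\<close> only, apart from noise.\<close>
  define r where "r = b / d"
  define \<rho> where "\<rho> = (cmod r)\<^sup>2"
  have r: "r \<noteq> 0" "r * d = b" and \<rho>: "\<rho> > 0" using bd by (auto simp: r_def \<rho>_def)
  define K where "K = 2 ^ ?n * (2 * pi * (1 + \<rho>) / \<rho>) ^ ?n"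
  have K: "K > 0" using \<rho> by (simp add: K_def)
  define S1 where "S1 m0 m1 m2 t = a * x1 m0 m1 t + b * x2 m0 m2 t" for m0 m1 m2 t
  define S2 where "S2 m0 m1 m2 t = c * x1 m0 m1 t + d * x2 m0 m2 t" for m0 m1 m2 t
  define k1 where "k1 m0 m1 m2 y = ennreal (exp (- sqn I (\<lambda>t. y t - S1 m0 m1 m2 t)))" for m0 m1 m2 y
  define k2 where "k2 m0 m1 m2 y = ennreal (exp (- sqn I (\<lambda>t. y t - S2 m0 m1 m2 t)))" for m0 m1 m2 y
  have [measurable]: "k1 m0 m1 m2 \<in> borel_measurable (LB I)" "k2 m0 m1 m2 \<in> borel_measurable (LB I)" for m0 m1 m2
    unfolding k1_def k2_def by measurable
  note D[measurable]
  define \<tau> where "\<tau> y = ennreal (exp (- (1 / (4 * E) * sqn I y)))" for y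
  have \<tau>[measurable]: "\<tau> \<in> borel_measurable (LB I)" unfolding \<tau>_def by measurable
  define L where "L m0 m1 y1 y2 = ennreal (exp (- (1 / (2 * (1 + \<rho>)) *
      sqn I (\<lambda>t. r * y2 t - (y1 t - (a - r * c) * x1 m0 m1 t)))))" for m0 m1 y1 y2
  have [measurable]: "L m0 m1 y1 \<in> borel_measurable (LB I)" for m0 m1 y1
    unfolding L_def by measurable
  have dom: "k1 m0 m1 m2 y1 * k2 m0 m1 m2 y2 \<le> ennreal (2 ^ ?n) * \<tau> y1 * L m0 m1 y1 y2"
    if "m0 \<in> J0" "m1 \<in> J1 m0" "m2 \<in> J2 m0" for m0 m1 m2 y1 y2
  proof -
    define A where "A = sqn I (\<lambda>t. y1 t - S1 m0 m1 m2 t)"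
    define B where "B = sqn I (\<lambda>t. y2 t - S2 m0 m1 m2 t)"
    define C where "C = sqn I (\<lambda>t. r * y2 t - (y1 t - (a - r * c) * x1 m0 m1 t))"
    have "C = sqn I (\<lambda>t. (y1 t - S1 m0 m1 m2 t) - r * (y2 t - S2 m0 m1 m2 t))"
      unfolding C_def
    proof (subst sqn_minus_commute, rule sqn_cong)
      fix t
      have e: "b * x2 m0 m2 t = r * (d * x2 m0 m2 t)" by (simp only: r(2) mult.assoc[symmetric])
      show "y1 t - (a - r * c) * x1 m0 m1 t - r * y2 t = y1 t - S1 m0 m1 m2 t - r * (y2 t - S2 m0 m1 m2 t)"
        unfolding S1_def S2_def e by (simp add: algebra_simps)
    qed
    also have "\<dots> / (1 + \<rho>) \<le> A / 1 + sqn I (\<lambda>t. r * (y2 t - S2 m0 m1 m2 t)) / \<rho>"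
      unfolding A_def by (rule sqn_diff_weighted) (use \<rho> in auto)
    also have "sqn I (\<lambda>t. r * (y2 t - S2 m0 m1 m2 t)) / \<rho> = B"
      using \<rho> unfolding sqn_scale B_def \<rho>_def by simp
    finally have "C / (1 + \<rho>) \<le> A + B" by simp
    moreover have "B \<ge> 0" by (simp add: B_def)
    \<comment> \<open>Half of the kernel in \<open>y1\<close> and all of the kernel in
      \<open>y2\<close> pay for \<open>L\<close>; the other half in \<open>y1\<close> pays for
      \<open>\<tau>\<close>.\<close>
    ultimately have "C / (1 + \<rho>) / 2 \<le> (A + 2 * B) / 2"
      by (intro divide_right_mono) auto
    then have "1 / (2 * (1 + \<rho>)) * C \<le> A / 2 + B" by (simp add: add_divide_distrib mult.commute)
    then have "exp (- A) * exp (- B) \<le> exp (- (A / 2)) * exp (- (1 / (2 * (1 + \<rho>)) * C))"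
      by (simp add: exp_add[symmetric])
    also have "exp (- (A / 2)) \<le> 2 ^ ?n * exp (- (1 / (4 * E) * sqn I y1))"
      unfolding A_def by (rule half_gaussian_dom[OF E]) (use s[OF that] in \<open>simp add: S1_def\<close>)
    finally show ?thesis
      by (simp add: k1_def k2_def L_def \<tau>_def A_def[symmetric] B_def[symmetric] C_def[symmetric]
          ennreal_mult'[symmetric] mult_right_mono)
  qed
  have intL: "(\<integral>\<^sup>+y2. L m0 m1 y1 y2 \<partial>LB I) = ennreal ((2 * pi * (1 + \<rho>) / \<rho>) ^ ?n)" for m0 m1 y1
    unfolding L_def using \<rho> by (subst nn_integral_exp_sqn[OF I _ r(1)]) (auto simp: \<rho>_def[symmetric] field_simps)
  define F where "F m0 m1 y1 = (\<Sum>m2\<in>J2 m0. k1 m0 m1 m2 y1 * (\<integral>\<^sup>+y2. indicator (D2 m0 m2) y2 * k2 m0 m1 m2 y2 \<partial>LB I))" for m0 m1 y1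
  have [measurable]: "F m0 m1 \<in> borel_measurable (LB I)" for m0 m1 unfolding F_def by measurable
  have F: "F m0 m1 y1 \<le> ennreal K * \<tau> y1" if m: "m0 \<in> J0" "m1 \<in> J1 m0" for m0 m1 y1
  proof -
    have "F m0 m1 y1 = (\<Sum>m2\<in>J2 m0. \<integral>\<^sup>+y2. indicator (D2 m0 m2) y2 * (k1 m0 m1 m2 y1 * k2 m0 m1 m2 y2) \<partial>LB I)"
      unfolding F_def by (intro sum.cong refl, subst nn_integral_cmult[symmetric]) (auto simp: mult_ac)
    also have "\<dots> \<le> (\<integral>\<^sup>+y2. ennreal (2 ^ ?n) * \<tau> y1 * L m0 m1 y1 y2 \<partial>LB I)"
      by (rule packing_bound[OF J(3) disj2 D(2)]) (use m dom in auto)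
    also have "\<dots> = ennreal K * \<tau> y1"
      using \<rho> by (subst nn_integral_cmult, measurable) (simp add: intL K_def ennreal_mult' mult_ac)
    finally show ?thesis .
  qed
  have "(\<Sum>m0\<in>J0. \<Sum>m1\<in>J1 m0. \<Sum>m2\<in>J2 m0. gprob I (D1 m0 m1) (S1 m0 m1 m2) * gprob I (D2 m0 m2) (S2 m0 m1 m2))
     = ennreal (1 / pi ^ ?n * (1 / pi ^ ?n)) * (\<Sum>m0\<in>J0. \<Sum>m1\<in>J1 m0. \<integral>\<^sup>+y1. indicator (D1 m0 m1) y1 * F m0 m1 y1 \<partial>LB I)"
    unfolding sum_distrib_left
  proof (intro sum.cong refl)
    fix m0 m1
    have "(\<Sum>m2\<in>J2 m0. gprob I (D1 m0 m1) (S1 m0 m1 m2) * gprob I (D2 m0 m2) (S2 m0 m1 m2))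
      = (\<Sum>m2\<in>J2 m0. ennreal (1 / pi ^ ?n * (1 / pi ^ ?n)) * (\<integral>\<^sup>+y1. indicator (D1 m0 m1) y1 * (k1 m0 m1 m2 y1 * (\<integral>\<^sup>+y2. indicator (D2 m0 m2) y2 * k2 m0 m1 m2 y2 \<partial>LB I)) \<partial>LB I))"
    proof (intro sum.cong refl)
      fix m2
      have "(\<integral>\<^sup>+y1. indicator (D1 m0 m1) y1 * (k1 m0 m1 m2 y1 * (\<integral>\<^sup>+y2. indicator (D2 m0 m2) y2 * k2 m0 m1 m2 y2 \<partial>LB I)) \<partial>LB I)
        = (\<integral>\<^sup>+y1. indicator (D1 m0 m1) y1 * k1 m0 m1 m2 y1 \<partial>LB I) * (\<integral>\<^sup>+y2. indicator (D2 m0 m2) y2 * k2 m0 m1 m2 y2 \<partial>LB I)"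
        by (subst nn_integral_multc[symmetric]) (auto simp: mult_ac)
      then show "gprob I (D1 m0 m1) (S1 m0 m1 m2) * gprob I (D2 m0 m2) (S2 m0 m1 m2)
        = ennreal (1 / pi ^ ?n * (1 / pi ^ ?n)) * (\<integral>\<^sup>+y1. indicator (D1 m0 m1) y1 * (k1 m0 m1 m2 y1 * (\<integral>\<^sup>+y2. indicator (D2 m0 m2) y2 * k2 m0 m1 m2 y2 \<partial>LB I)) \<partial>LB I)"
        by (simp only: gprob_alt[OF D(1)] gprob_alt[OF D(2)] k1_def k2_def ennreal_mult' mult_ac
              zero_le_divide_1_iff zero_le_power pi_ge_zero)
    qed
    also have "\<dots> = ennreal (1 / pi ^ ?n * (1 / pi ^ ?n)) * (\<integral>\<^sup>+y1. indicator (D1 m0 m1) y1 * F m0 m1 y1 \<partial>LB I)"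
      unfolding F_def sum_distrib_left by (subst nn_integral_sum) (auto simp: sum_distrib_left)
    finally show "(\<Sum>m2\<in>J2 m0. gprob I (D1 m0 m1) (S1 m0 m1 m2) * gprob I (D2 m0 m2) (S2 m0 m1 m2))
      = ennreal (1 / pi ^ ?n * (1 / pi ^ ?n)) * (\<integral>\<^sup>+y1. indicator (D1 m0 m1) y1 * F m0 m1 y1 \<partial>LB I)" .
  qed
  also have "(\<Sum>m0\<in>J0. \<Sum>m1\<in>J1 m0. \<integral>\<^sup>+y1. indicator (D1 m0 m1) y1 * F m0 m1 y1 \<partial>LB I)
     = (\<Sum>m\<in>(SIGMA m0:J0. J1 m0). \<integral>\<^sup>+y1. indicator ((\<lambda>(m0, m1). D1 m0 m1) m) y1 * F (fst m) (snd m) y1 \<partial>LB I)"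
    using J by (subst sum.Sigma) (auto simp: split_beta)
  also have "\<dots> \<le> (\<integral>\<^sup>+y1. ennreal K * \<tau> y1 \<partial>LB I)"
    by (rule packing_bound[OF _ disj1]) (use J F D in auto)
  also have "\<dots> = ennreal K * ennreal ((pi / (1 / (4 * E) * (cmod 1)\<^sup>2)) ^ ?n)"
  proof (subst nn_integral_cmult)
    have "(\<integral>\<^sup>+y. \<tau> y \<partial>LB I) = (\<integral>\<^sup>+y. ennreal (exp (- (1 / (4 * E) * sqn I (\<lambda>t. 1 * y t - 0)))) \<partial>LB I)"
      by (simp add: \<tau>_def)
    also have "\<dots> = ennreal ((pi / (1 / (4 * E) * (cmod 1)\<^sup>2)) ^ ?n)"
      using E I by (subst nn_integral_exp_sqn) auto
    finally show "ennreal K * (\<integral>\<^sup>+y. \<tau> y \<partial>LB I) = ennreal K * ennreal ((pi / (1 / (4 * E) * (cmod 1)\<^sup>2)) ^ ?n)" by simp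
  qed measurable
  also have "ennreal (1 / pi ^ ?n * (1 / pi ^ ?n)) * \<dots> = ennreal ((16 * E * (1 + (cmod (d / b))\<^sup>2)) ^ ?n)"
  proof -
    have gen: "1 / pi ^ ?n * (1 / pi ^ ?n) * (2 ^ ?n * X ^ ?n * Z ^ ?n) = (1 / pi * (1 / pi) * (2 * X * Z)) ^ ?n" for X Z :: real
      by (simp add: power_mult_distrib power_divide)
    have "(cmod (d / b))\<^sup>2 = 1 / \<rho>" by (simp add: \<rho>_def r_def norm_divide power_divide)
    moreover have "1 / pi ^ ?n * (1 / pi ^ ?n) * (K * (pi / (1 / (4 * E) * (cmod 1)\<^sup>2)) ^ ?n)
       = (1 / pi * (1 / pi) * (2 * (2 * pi * (1 + \<rho>) / \<rho>) * (pi / (1 / (4 * E) * (cmod 1)\<^sup>2)))) ^ ?n"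
      unfolding K_def by (rule gen)
    moreover have "1 / pi * (1 / pi) * (2 * (2 * pi * (1 + \<rho>) / \<rho>) * (pi / (1 / (4 * E) * (cmod 1)\<^sup>2)))
       = 16 * E * (1 + 1 / \<rho>)"
      using \<rho> by (simp add: field_simps)
    ultimately have eq: "1 / pi ^ ?n * (1 / pi ^ ?n) * (K * (pi / (1 / (4 * E) * (cmod 1)\<^sup>2)) ^ ?n)
       = (16 * E * (1 + (cmod (d / b))\<^sup>2)) ^ ?n" by presburger
    show ?thesis unfolding eq[symmetric] using K
      by (subst ennreal_mult'[symmetric], simp, subst ennreal_mult'[symmetric]) auto
  qed
  finally show ?thesis by (simp add: S1_def S2_def mult_left_mono)
qed

text \<open>Moving the own signal \<open>v\<close> into the decoding region leaves the noisy
  interference \<open>u\<close> as integration variable, whose kernel no longer involves the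
  receiver's own message. The genie argument compares these kernels.\<close>

lemma gprob_translate:
  assumes I: "finite I" and [measurable]: "D \<in> sets (LB I)"
  shows "gprob I D (\<lambda>t. v t + w t) = ennreal (1 / pi ^ card I) *
    (\<integral>\<^sup>+u. indicator D (\<lambda>t\<in>I. v t + u t) * ennreal (exp (- sqn I (\<lambda>t. u t - w t))) \<partial>LB I)"
proof -
  have "(\<integral>\<^sup>+y. indicator D y * ennreal (exp (- sqn I (\<lambda>t. y t - (v t + w t)))) \<partial>LB I)
     = (\<integral>\<^sup>+u. indicator D (\<lambda>t\<in>I. v t + u t) * ennreal (exp (- sqn I (\<lambda>t. (\<lambda>t\<in>I. v t + u t) t - (v t + w t)))) \<partial>LB I)"
    by (rule nn_integral_LB_translate[OF I, symmetric]) measurable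
  also have "\<dots> = (\<integral>\<^sup>+u. indicator D (\<lambda>t\<in>I. v t + u t) * ennreal (exp (- sqn I (\<lambda>t. u t - w t))) \<partial>LB I)"
    by (intro nn_integral_cong arg_cong2[where f = "(*)"] refl arg_cong[where f = "\<lambda>u. ennreal (exp (- u))"] sqn_cong) simp
  finally show ?thesis by (simp add: gprob_alt)
qed

text \<open>The genie argument without entropies. Write \<open>u1\<close>, \<open>u2\<close> for the noisy interference seen at
  receivers 2 and 1; then \<open>f1\<close>, \<open>f2\<close> are, up to normalisation, mixture densities of these two
  independent vectors. On the region \<open>f2 u2 \<le> \<kappa> * f1 u1\<close> only the decoder of receiver 1 is needed, and
  on its complement only that of receiver 2; balancing \<open>\<kappa>\<close> gives the geometric mean in
  \<open>genie_packing\<close>.\<close>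

lemma genie_half:
  fixes a c :: complex
  assumes I: "finite I" and J: "finite J1" "finite J2"
    and disj: "disjoint_family_on D J1" and D: "\<And>m. D m \<in> sets (LB I)"
    and E: "E \<ge> 1" and x2: "\<And>m. m \<in> J2 \<Longrightarrow> sqn I (x2 m) \<le> E * real (card I)"
    and ac: "a \<noteq> 0" "c \<noteq> 0"
    and \<kappa>: "\<kappa> > 0"
    and f1: "\<And>u. f1 u = (\<Sum>m\<in>J1. exp (- (sqn I (\<lambda>t. u t - c * x1 m t) / 2)))"
    and f2: "\<And>u. f2 u = (\<Sum>m\<in>J2. exp (- (sqn I (\<lambda>t. u t - x2 m t) / 2)))"
  shows "(\<integral>\<^sup>+u1. \<integral>\<^sup>+u2. (\<Sum>m1\<in>J1. \<Sum>m2\<in>J2. indicator {(u1, u2). f2 u2 \<le> \<kappa> * f1 u1} (u1, u2) *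
        (indicator (D m1) (\<lambda>t\<in>I. a * x1 m1 t + u2 t) *
        (ennreal (exp (- sqn I (\<lambda>t. u1 t - c * x1 m1 t))) * ennreal (exp (- sqn I (\<lambda>t. u2 t - x2 m2 t)))))) \<partial>LB I \<partial>LB I)
    \<le> ennreal (\<kappa> * real (card J1) * (4 * pi\<^sup>2 * (4 * E + (cmod (a / c))\<^sup>2)) ^ card I)"
proof -
  let ?n = "card I"
  define r where "r = a / c"
  define \<rho> where "\<rho> = (cmod r)\<^sup>2"
  have r: "r \<noteq> 0" "r * c = a" and \<rho>: "\<rho> > 0" using ac by (auto simp: r_def \<rho>_def)
  note D[measurable]
  have tr[measurable]: "(\<lambda>u. indicator (D m) (\<lambda>t\<in>I. v t + u t) :: ennreal) \<in> borel_measurable (LB I)" for v m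
  proof -
    have [measurable]: "(\<lambda>u. \<lambda>t\<in>I. v t + u t) \<in> LB I \<rightarrow>\<^sub>M LB I" by measurable
    show ?thesis by measurable
  qed
  define \<tau> where "\<tau> u = exp (- (1 / (4 * E) * sqn I u))" for u
  define p where "p m u = exp (- sqn I (\<lambda>t. u t - c * x1 m t))" for m u
  define g where "g m u = exp (- (sqn I (\<lambda>t. u t - x2 m t) / 2))" for m u
  have [measurable]: "\<tau> \<in> borel_measurable (LB I)" "p m \<in> borel_measurable (LB I)" "g m' \<in> borel_measurable (LB I)" for m m'
    unfolding \<tau>_def p_def g_def by measurable
  have f10: "f1 u \<ge> 0" for u unfolding f1 by (intro sum_nonneg) auto
  have [measurable]: "f1 \<in> borel_measurable (LB I)" "f2 \<in> borel_measurable (LB I)"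
    unfolding f1[abs_def] f2[abs_def] by measurable
  \<comment> \<open>User 2 is eliminated. Its kernel splits into two equal halves: one sums to
    \<open>f2\<close> and is traded for \<open>\<kappa> * f1\<close>, the other is bounded by
    \<open>\<tau>\<close> and keeps \<open>u2\<close> integrable.\<close>
  have step1: "(\<Sum>m1\<in>J1. \<Sum>m2\<in>J2. indicator {(u1, u2). f2 u2 \<le> \<kappa> * f1 u1} (u1, u2) *
        (indicator (D m1) (\<lambda>t\<in>I. a * x1 m1 t + u2 t) *
        (ennreal (exp (- sqn I (\<lambda>t. u1 t - c * x1 m1 t))) * ennreal (exp (- sqn I (\<lambda>t. u2 t - x2 m2 t))))))
     \<le> ennreal (\<kappa> * 2 ^ ?n * f1 u1) * (\<Sum>m1\<in>J1. indicator (D m1) (\<lambda>t\<in>I. a * x1 m1 t + u2 t) * ennreal (p m1 u1 * \<tau> u2))"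
    (is "?L \<le> ?R") for u1 u2
  proof (cases "f2 u2 \<le> \<kappa> * f1 u1")
    case True
    have "?L = (\<Sum>m1\<in>J1. indicator (D m1) (\<lambda>t\<in>I. a * x1 m1 t + u2 t) * ennreal (p m1 u1) *
         ennreal (\<Sum>m2\<in>J2. exp (- sqn I (\<lambda>t. u2 t - x2 m2 t))))"
      using True by (simp add: p_def sum_distrib_left mult.assoc flip: sum_ennreal)
    also have "\<dots> \<le> (\<Sum>m1\<in>J1. indicator (D m1) (\<lambda>t\<in>I. a * x1 m1 t + u2 t) * ennreal (p m1 u1) *
         ennreal (\<kappa> * 2 ^ ?n * f1 u1 * \<tau> u2))"
    proof (intro sum_mono mult_left_mono ennreal_leI)
      have "(\<Sum>m2\<in>J2. exp (- sqn I (\<lambda>t. u2 t - x2 m2 t))) \<le> (\<Sum>m2\<in>J2. g m2 u2 * (2 ^ ?n * \<tau> u2))"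
      proof (rule sum_mono)
        fix m2 assume m2: "m2 \<in> J2"
        have "exp (- sqn I (\<lambda>t. u2 t - x2 m2 t)) = g m2 u2 * exp (- (sqn I (\<lambda>t. u2 t - x2 m2 t) / 2))"
          by (simp add: g_def exp_add[symmetric])
        also have "\<dots> \<le> g m2 u2 * (2 ^ ?n * \<tau> u2)"
          unfolding \<tau>_def by (intro mult_left_mono half_gaussian_dom E x2 m2) (simp add: g_def)
        finally show "exp (- sqn I (\<lambda>t. u2 t - x2 m2 t)) \<le> g m2 u2 * (2 ^ ?n * \<tau> u2)" .
      qed
      also have "\<dots> = f2 u2 * (2 ^ ?n * \<tau> u2)" by (simp add: f2 g_def sum_distrib_right)
      also have "\<dots> \<le> \<kappa> * f1 u1 * (2 ^ ?n * \<tau> u2)"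
        by (intro mult_right_mono True) (simp add: \<tau>_def)
      finally show "(\<Sum>m2\<in>J2. exp (- sqn I (\<lambda>t. u2 t - x2 m2 t))) \<le> \<kappa> * 2 ^ ?n * f1 u1 * \<tau> u2" by (simp add: mult_ac)
    qed auto
    also have "\<dots> = ?R"
      using f10[of u1] \<kappa> unfolding sum_distrib_left
      by (intro sum.cong refl) (simp add: p_def \<tau>_def ennreal_mult mult_ac)
    finally show ?thesis .
  qed simp
  \<comment> \<open>For fixed \<open>u1\<close> the messages of user 1 are packed in the space of
    \<open>y = a * x1 + u2\<close>. Since \<open>u1\<close> reveals \<open>c * x1\<close> up to
    noise, \<open>y\<close> lies near \<open>r * u1\<close> at width \<open>4 * E + \<rho>\<close>,
    whatever \<open>m1\<close> is.\<close>
  have inner: "(\<integral>\<^sup>+u2. (\<Sum>m1\<in>J1. indicator (D m1) (\<lambda>t\<in>I. a * x1 m1 t + u2 t) * ennreal (p m1 u1 * \<tau> u2)) \<partial>LB I)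
     \<le> ennreal ((pi * (4 * E + \<rho>)) ^ ?n)" for u1
  proof -
    have "(\<integral>\<^sup>+u2. (\<Sum>m1\<in>J1. indicator (D m1) (\<lambda>t\<in>I. a * x1 m1 t + u2 t) * ennreal (p m1 u1 * \<tau> u2)) \<partial>LB I)
      = (\<Sum>m1\<in>J1. \<integral>\<^sup>+u2. indicator (D m1) (\<lambda>t\<in>I. a * x1 m1 t + u2 t) * ennreal (p m1 u1 * \<tau> u2) \<partial>LB I)"
      by (rule nn_integral_sum) measurable
    also have "\<dots> = (\<Sum>m1\<in>J1. \<integral>\<^sup>+y. indicator (D m1) y * ennreal (p m1 u1 * exp (- (1 / (4 * E) * sqn I (\<lambda>t. y t - a * x1 m1 t)))) \<partial>LB I)"
    proof (intro sum.cong refl)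
      fix m1
      have "(\<integral>\<^sup>+y. indicator (D m1) y * ennreal (p m1 u1 * exp (- (1 / (4 * E) * sqn I (\<lambda>t. y t - a * x1 m1 t)))) \<partial>LB I)
        = (\<integral>\<^sup>+u. indicator (D m1) (\<lambda>t\<in>I. a * x1 m1 t + u t) * ennreal (p m1 u1 * exp (- (1 / (4 * E) * sqn I (\<lambda>t. (\<lambda>t\<in>I. a * x1 m1 t + u t) t - a * x1 m1 t)))) \<partial>LB I)"
        by (rule nn_integral_LB_translate[OF I, symmetric]) measurable
      also have "\<dots> = (\<integral>\<^sup>+u2. indicator (D m1) (\<lambda>t\<in>I. a * x1 m1 t + u2 t) * ennreal (p m1 u1 * \<tau> u2) \<partial>LB I)"
        unfolding \<tau>_def
        by (intro nn_integral_cong arg_cong2[where f = "(*)"] refl arg_cong[where f = "\<lambda>u. ennreal (_ * exp (- (_ * u)))"] sqn_cong) simp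
      finally show "(\<integral>\<^sup>+u2. indicator (D m1) (\<lambda>t\<in>I. a * x1 m1 t + u2 t) * ennreal (p m1 u1 * \<tau> u2) \<partial>LB I)
        = (\<integral>\<^sup>+y. indicator (D m1) y * ennreal (p m1 u1 * exp (- (1 / (4 * E) * sqn I (\<lambda>t. y t - a * x1 m1 t)))) \<partial>LB I)" ..
    qed
    also have "\<dots> \<le> (\<integral>\<^sup>+y. ennreal (exp (- (1 / (4 * E + \<rho>) * sqn I (\<lambda>t. 1 * y t - r * u1 t)))) \<partial>LB I)"
    proof (rule packing_bound[OF J(1) disj D])
      fix m1 y
      have "sqn I (\<lambda>t. y t - r * u1 t) = sqn I (\<lambda>t. (y t - a * x1 m1 t) - r * (u1 t - c * x1 m1 t))"
        by (intro sqn_cong) (simp only: right_diff_distrib mult.assoc[symmetric] r(2), simp)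
      also have "\<dots> / (4 * E + \<rho>) \<le> sqn I (\<lambda>t. y t - a * x1 m1 t) / (4 * E) + sqn I (\<lambda>t. r * (u1 t - c * x1 m1 t)) / \<rho>"
        by (rule sqn_diff_weighted) (use E \<rho> in auto)
      also have "sqn I (\<lambda>t. r * (u1 t - c * x1 m1 t)) / \<rho> = sqn I (\<lambda>t. u1 t - c * x1 m1 t)"
        using \<rho> unfolding sqn_scale \<rho>_def by simp
      finally show "ennreal (p m1 u1 * exp (- (1 / (4 * E) * sqn I (\<lambda>t. y t - a * x1 m1 t))))
        \<le> ennreal (exp (- (1 / (4 * E + \<rho>) * sqn I (\<lambda>t. 1 * y t - r * u1 t))))"
        by (intro ennreal_leI) (simp add: p_def exp_add[symmetric])
    qed measurable
    also have "\<dots> = ennreal ((pi * (4 * E + \<rho>)) ^ ?n)"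
      using E \<rho> I by (subst nn_integral_exp_sqn) auto
    finally show ?thesis .
  qed
  have "(\<integral>\<^sup>+u1. \<integral>\<^sup>+u2. (\<Sum>m1\<in>J1. \<Sum>m2\<in>J2. indicator {(u1, u2). f2 u2 \<le> \<kappa> * f1 u1} (u1, u2) *
        (indicator (D m1) (\<lambda>t\<in>I. a * x1 m1 t + u2 t) *
        (ennreal (exp (- sqn I (\<lambda>t. u1 t - c * x1 m1 t))) * ennreal (exp (- sqn I (\<lambda>t. u2 t - x2 m2 t)))))) \<partial>LB I \<partial>LB I)
     \<le> (\<integral>\<^sup>+u1. ennreal (\<kappa> * 2 ^ ?n * f1 u1) * ennreal ((pi * (4 * E + \<rho>)) ^ ?n) \<partial>LB I)"
  proof (rule nn_integral_mono)
    fix u1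
    have "(\<integral>\<^sup>+u2. (\<Sum>m1\<in>J1. \<Sum>m2\<in>J2. indicator {(u1, u2). f2 u2 \<le> \<kappa> * f1 u1} (u1, u2) *
        (indicator (D m1) (\<lambda>t\<in>I. a * x1 m1 t + u2 t) *
        (ennreal (exp (- sqn I (\<lambda>t. u1 t - c * x1 m1 t))) * ennreal (exp (- sqn I (\<lambda>t. u2 t - x2 m2 t)))))) \<partial>LB I)
      \<le> (\<integral>\<^sup>+u2. ennreal (\<kappa> * 2 ^ ?n * f1 u1) * (\<Sum>m1\<in>J1. indicator (D m1) (\<lambda>t\<in>I. a * x1 m1 t + u2 t) * ennreal (p m1 u1 * \<tau> u2)) \<partial>LB I)"
      by (intro nn_integral_mono step1)
    also have "\<dots> = ennreal (\<kappa> * 2 ^ ?n * f1 u1) * (\<integral>\<^sup>+u2. (\<Sum>m1\<in>J1. indicator (D m1) (\<lambda>t\<in>I. a * x1 m1 t + u2 t) * ennreal (p m1 u1 * \<tau> u2)) \<partial>LB I)"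
      by (rule nn_integral_cmult) measurable
    also have "\<dots> \<le> ennreal (\<kappa> * 2 ^ ?n * f1 u1) * ennreal ((pi * (4 * E + \<rho>)) ^ ?n)"
      by (intro mult_left_mono inner) auto
    finally show "(\<integral>\<^sup>+u2. (\<Sum>m1\<in>J1. \<Sum>m2\<in>J2. indicator {(u1, u2). f2 u2 \<le> \<kappa> * f1 u1} (u1, u2) *
        (indicator (D m1) (\<lambda>t\<in>I. a * x1 m1 t + u2 t) *
        (ennreal (exp (- sqn I (\<lambda>t. u1 t - c * x1 m1 t))) * ennreal (exp (- sqn I (\<lambda>t. u2 t - x2 m2 t)))))) \<partial>LB I)
      \<le> ennreal (\<kappa> * 2 ^ ?n * f1 u1) * ennreal ((pi * (4 * E + \<rho>)) ^ ?n)" .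
  qed
  also have "\<dots> = ennreal (\<kappa> * 2 ^ ?n * (pi * (4 * E + \<rho>)) ^ ?n) * (\<integral>\<^sup>+u1. ennreal (f1 u1) \<partial>LB I)"
    using \<kappa> f10 E \<rho> by (subst nn_integral_cmult[symmetric]) (auto simp: ennreal_mult'[symmetric] ennreal_mult''[symmetric] mult_ac intro!: nn_integral_cong)
  \<comment> \<open>The factor \<open>card J1\<close> arises as the mass of \<open>f1\<close>, a sum
    of that many Gaussians of equal mass.\<close>
  also have "(\<integral>\<^sup>+u1. ennreal (f1 u1) \<partial>LB I) = (\<Sum>m\<in>J1. \<integral>\<^sup>+u. ennreal (exp (- (1 / 2 * sqn I (\<lambda>t. 1 * u t - c * x1 m t)))) \<partial>LB I)"
    by (subst nn_integral_sum[symmetric]) (auto simp: f1 simp flip: sum_ennreal)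
  also have "\<dots> = (\<Sum>m\<in>J1. ennreal ((pi / (1 / 2 * (cmod 1)\<^sup>2)) ^ ?n))"
    using I by (intro sum.cong refl nn_integral_exp_sqn) auto
  also have "\<dots> = ennreal (real (card J1) * (2 * pi) ^ ?n)"
    by (simp add: ennreal_mult'' ennreal_of_nat_eq_real_of_nat mult_ac)
  also have "ennreal (\<kappa> * 2 ^ ?n * (pi * (4 * E + \<rho>)) ^ ?n) * \<dots> = ennreal (\<kappa> * real (card J1) * (4 * pi\<^sup>2 * (4 * E + \<rho>)) ^ ?n)"
  proof -
    have "\<kappa> * 2 ^ ?n * (pi * (4 * E + \<rho>)) ^ ?n * (real (card J1) * (2 * pi) ^ ?n)
      = \<kappa> * real (card J1) * (2 * (pi * (4 * E + \<rho>)) * (2 * pi)) ^ ?n"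
      by (simp only: power_mult_distrib mult_ac)
    also have "2 * (pi * (4 * E + \<rho>)) * (2 * pi) = 4 * pi\<^sup>2 * (4 * E + \<rho>)" by (simp add: power2_eq_square)
    finally have eq: "\<kappa> * 2 ^ ?n * (pi * (4 * E + \<rho>)) ^ ?n * (real (card J1) * (2 * pi) ^ ?n)
      = \<kappa> * real (card J1) * (4 * pi\<^sup>2 * (4 * E + \<rho>)) ^ ?n" .
    show ?thesis unfolding eq[symmetric] by (rule ennreal_mult''[symmetric]) simp
  qed
  finally show ?thesis unfolding \<rho>_def r_def .
qed

lemma genie_packing:
  fixes a b c d :: complex
  assumes I: "finite I" and J: "finite J1" "finite J2"
    and disj: "disjoint_family_on D1 J1" "disjoint_family_on D2 J2"
    and D: "\<And>m. D1 m \<in> sets (LB I)" "\<And>m. D2 m \<in> sets (LB I)"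
    and E: "E \<ge> 1" and x1: "\<And>m. m \<in> J1 \<Longrightarrow> sqn I (\<lambda>t. c * x1 m t) \<le> E * real (card I)"
    and x2: "\<And>m. m \<in> J2 \<Longrightarrow> sqn I (\<lambda>t. b * x2 m t) \<le> E * real (card I)"
    and nz: "a \<noteq> 0" "b \<noteq> 0" "c \<noteq> 0" "d \<noteq> 0"
    and ratio: "(cmod (a / c))\<^sup>2 \<le> \<rho>" "(cmod (d / b))\<^sup>2 \<le> \<rho>"
    and M: "real (card J1) \<le> M1" "real (card J2) \<le> M2" "M1 > 0" "M2 > 0"
  shows "(\<Sum>m1\<in>J1. \<Sum>m2\<in>J2.
      gprob I (D1 m1) (\<lambda>t. a * x1 m1 t + b * x2 m2 t) * gprob I (D2 m2) (\<lambda>t. c * x1 m1 t + d * x2 m2 t))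
    \<le> ennreal (2 * sqrt (M1 * M2) * (4 * (4 * E + \<rho>)) ^ card I)"
proof -
  let ?n = "card I"
  \<comment> \<open>This value makes \<open>\<kappa> * M1\<close> and \<open>M2 / \<kappa>\<close>
    both equal to \<open>sqrt (M1 * M2)\<close>.\<close>
  define \<kappa> where "\<kappa> = sqrt (M2 / M1)"
  have \<kappa>: "\<kappa> > 0" using M by (simp add: \<kappa>_def)
  note D[measurable]
  interpret LI: sigma_finite_measure "LB I" by (rule lbp.sigma_finite[OF I])
  interpret LL: pair_sigma_finite "LB I" "LB I" ..
  define f1 where "f1 u = (\<Sum>m\<in>J1. exp (- (sqn I (\<lambda>t. u t - c * x1 m t) / 2)))" for u
  define f2 where "f2 u = (\<Sum>m\<in>J2. exp (- (sqn I (\<lambda>t. u t - b * x2 m t) / 2)))" for u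
  define p1 where "p1 m u = ennreal (exp (- sqn I (\<lambda>t. u t - c * x1 m t)))" for m u
  define p2 where "p2 m u = ennreal (exp (- sqn I (\<lambda>t. u t - b * x2 m t)))" for m u
  define A where "A m u = (indicator (D1 m) (\<lambda>t\<in>I. a * x1 m t + u t) :: ennreal)" for m u
  define B where "B m u = (indicator (D2 m) (\<lambda>t\<in>I. d * x2 m t + u t) :: ennreal)" for m u
  have tr[measurable]: "(\<lambda>u. \<lambda>t\<in>I. v t + u t) \<in> LB I \<rightarrow>\<^sub>M LB I" for v :: "nat \<Rightarrow> complex" by measurable
  have [measurable]: "f1 \<in> borel_measurable (LB I)" "f2 \<in> borel_measurable (LB I)"
    unfolding f1_def[abs_def] f2_def[abs_def] by measurable
  have [measurable]: "p1 m \<in> borel_measurable (LB I)" "A m \<in> borel_measurable (LB I)" for m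
    unfolding p1_def A_def by measurable
  have [measurable]: "p2 m \<in> borel_measurable (LB I)" "B m \<in> borel_measurable (LB I)" for m
    unfolding p2_def B_def by measurable
  have f1_0: "f1 u \<ge> 0" and f2_0: "f2 u \<ge> 0" for u by (auto simp: f1_def f2_def intro!: sum_nonneg)
  \<comment> \<open>The two regions cover everything and overlap where
    \<open>f2 u2 = \<kappa> * f1 u1\<close>, which an upper bound tolerates. \<open>P\<close> keeps
    only decoder 1 and \<open>Q\<close> only decoder 2.\<close>
  define W where "W = (\<lambda>u1 u2. indicator {(u1, u2). f2 u2 \<le> \<kappa> * f1 u1} (u1, u2) :: ennreal)"
  define V where "V = (\<lambda>u2 u1. indicator {(u2, u1). f1 u1 \<le> (1 / \<kappa>) * f2 u2} (u2, u1) :: ennreal)"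
  define P where "P = (\<lambda>u1 u2. \<Sum>m1\<in>J1. \<Sum>m2\<in>J2. W u1 u2 * (A m1 u2 * (p1 m1 u1 * p2 m2 u2)))"
  define Q where "Q = (\<lambda>u2 u1. \<Sum>m2\<in>J2. \<Sum>m1\<in>J1. V u2 u1 * (B m2 u1 * (p2 m2 u2 * p1 m1 u1)))"
  have WV: "(\<lambda>p. W (fst p) (snd p)) \<in> borel_measurable (LB I \<Otimes>\<^sub>M LB I)"
       "(\<lambda>p. V (fst p) (snd p)) \<in> borel_measurable (LB I \<Otimes>\<^sub>M LB I)"
    unfolding W_def V_def by (auto simp: indicator_def) 
  have Pm: "(\<lambda>p. P (fst p) (snd p)) \<in> borel_measurable (LB I \<Otimes>\<^sub>M LB I)"
    unfolding P_def using WV by measurable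
  have Qm: "(\<lambda>p. Q (fst p) (snd p)) \<in> borel_measurable (LB I \<Otimes>\<^sub>M LB I)"
    unfolding Q_def using WV by measurable
  have Qm': "(\<lambda>p. Q (snd p) (fst p)) \<in> borel_measurable (LB I \<Otimes>\<^sub>M LB I)"
    using measurable_compose[OF measurable_pair_swap' Qm] by (simp add: split_beta)
  have half1: "(\<integral>\<^sup>+u1. \<integral>\<^sup>+u2. P u1 u2 \<partial>LB I \<partial>LB I)
      \<le> ennreal (\<kappa> * real (card J1) * (4 * pi\<^sup>2 * (4 * E + (cmod (a / c))\<^sup>2)) ^ card I)"
    unfolding P_def W_def A_def p1_def p2_def
    by (rule genie_half[OF I J disj(1) D(1) E x2 nz(1,3) \<kappa>]) (auto simp: f1_def f2_def)
  have half2: "(\<integral>\<^sup>+u2. \<integral>\<^sup>+u1. Q u2 u1 \<partial>LB I \<partial>LB I)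
      \<le> ennreal (1 / \<kappa> * real (card J2) * (4 * pi\<^sup>2 * (4 * E + (cmod (d / b))\<^sup>2)) ^ card I)"
    unfolding Q_def V_def B_def p1_def p2_def
    by (rule genie_half[OF I J(2,1) disj(2) D(2) E x1 nz(4,2)]) (use \<kappa> in \<open>auto simp: f1_def f2_def\<close>)
  have "(\<Sum>m1\<in>J1. \<Sum>m2\<in>J2.
      gprob I (D1 m1) (\<lambda>t. a * x1 m1 t + b * x2 m2 t) * gprob I (D2 m2) (\<lambda>t. c * x1 m1 t + d * x2 m2 t))
    = ennreal (1 / pi ^ ?n * (1 / pi ^ ?n)) * (\<integral>\<^sup>+u1. \<integral>\<^sup>+u2. (\<Sum>m1\<in>J1. \<Sum>m2\<in>J2. (A m1 u2 * p2 m2 u2) * (B m2 u1 * p1 m1 u1)) \<partial>LB I \<partial>LB I)"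
  proof -
    have "(\<integral>\<^sup>+u1. \<integral>\<^sup>+u2. (\<Sum>m1\<in>J1. \<Sum>m2\<in>J2. (A m1 u2 * p2 m2 u2) * (B m2 u1 * p1 m1 u1)) \<partial>LB I \<partial>LB I)
      = (\<Sum>m1\<in>J1. \<Sum>m2\<in>J2. (\<integral>\<^sup>+u2. A m1 u2 * p2 m2 u2 \<partial>LB I) * (\<integral>\<^sup>+u1. B m2 u1 * p1 m1 u1 \<partial>LB I))"
      by (simp add: nn_integral_sum nn_integral_cmult nn_integral_multc)
    moreover have "gprob I (D1 m1) (\<lambda>t. a * x1 m1 t + b * x2 m2 t) = ennreal (1 / pi ^ ?n) * (\<integral>\<^sup>+u2. A m1 u2 * p2 m2 u2 \<partial>LB I)" for m1 m2
      unfolding A_def p2_def by (rule gprob_translate[OF I D(1)])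
    moreover have "gprob I (D2 m2) (\<lambda>t. c * x1 m1 t + d * x2 m2 t) = ennreal (1 / pi ^ ?n) * (\<integral>\<^sup>+u1. B m2 u1 * p1 m1 u1 \<partial>LB I)" for m1 m2
      unfolding B_def p1_def using gprob_translate[OF I D(2), of m2 "\<lambda>t. d * x2 m2 t" "\<lambda>t. c * x1 m1 t"] by (simp add: add.commute)
    moreover have "ennreal (1 / pi ^ ?n * (1 / pi ^ ?n)) = ennreal (1 / pi ^ ?n) * ennreal (1 / pi ^ ?n)"
      by (rule ennreal_mult') simp
    ultimately show ?thesis
      by (simp only: sum_distrib_left mult_ac)
  qed
  also have "(\<integral>\<^sup>+u1. \<integral>\<^sup>+u2. (\<Sum>m1\<in>J1. \<Sum>m2\<in>J2. (A m1 u2 * p2 m2 u2) * (B m2 u1 * p1 m1 u1)) \<partial>LB I \<partial>LB I)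
     \<le> (\<integral>\<^sup>+u1. \<integral>\<^sup>+u2. P u1 u2 + Q u2 u1 \<partial>LB I \<partial>LB I)"
  proof (intro nn_integral_mono)
    fix u1 u2
    have WV1: "1 \<le> W u1 u2 + V u2 u1"
      using \<kappa> by (auto simp: W_def V_def indicator_def field_simps)
    have "(\<Sum>m1\<in>J1. \<Sum>m2\<in>J2. (A m1 u2 * p2 m2 u2) * (B m2 u1 * p1 m1 u1))
      \<le> (\<Sum>m1\<in>J1. \<Sum>m2\<in>J2. W u1 u2 * (A m1 u2 * (p1 m1 u1 * p2 m2 u2)) + V u2 u1 * (B m2 u1 * (p2 m2 u2 * p1 m1 u1)))"
    proof (intro sum_mono)
      fix m1 m2
      have "A m1 u2 = 0 \<or> A m1 u2 = 1" "B m2 u1 = 0 \<or> B m2 u1 = 1"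
        by (auto simp: A_def B_def indicator_def)
      then show "(A m1 u2 * p2 m2 u2) * (B m2 u1 * p1 m1 u1)
         \<le> W u1 u2 * (A m1 u2 * (p1 m1 u1 * p2 m2 u2)) + V u2 u1 * (B m2 u1 * (p2 m2 u2 * p1 m1 u1))"
        using mult_right_mono[OF WV1, of "p1 m1 u1 * p2 m2 u2"] by (auto simp: distrib_left distrib_right mult_ac)
    qed
    also have "\<dots> = P u1 u2 + Q u2 u1"
      unfolding P_def Q_def by (simp add: sum.distrib sum.swap[of _ J2 J1])
    finally show "(\<Sum>m1\<in>J1. \<Sum>m2\<in>J2. (A m1 u2 * p2 m2 u2) * (B m2 u1 * p1 m1 u1)) \<le> P u1 u2 + Q u2 u1" .
  qed
  also have "\<dots> = (\<integral>\<^sup>+u1. \<integral>\<^sup>+u2. P u1 u2 \<partial>LB I \<partial>LB I) + (\<integral>\<^sup>+u1. \<integral>\<^sup>+u2. Q u2 u1 \<partial>LB I \<partial>LB I)"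
  proof -
    have P1: "P u1 \<in> borel_measurable (LB I)" if "u1 \<in> space (LB I)" for u1
      using measurable_Pair2[OF Pm that] by simp
    have Q1: "(\<lambda>u2. Q u2 u1) \<in> borel_measurable (LB I)" if "u1 \<in> space (LB I)" for u1
      using measurable_Pair2[OF Qm' that] by simp
    have P2: "(\<lambda>u1. \<integral>\<^sup>+u2. P u1 u2 \<partial>LB I) \<in> borel_measurable (LB I)"
      by (rule LI.borel_measurable_nn_integral) (use Pm in \<open>simp add: split_beta\<close>)
    have Q2: "(\<lambda>u1. \<integral>\<^sup>+u2. Q u2 u1 \<partial>LB I) \<in> borel_measurable (LB I)"
      by (rule LI.borel_measurable_nn_integral) (use Qm' in \<open>simp add: split_beta\<close>)
    show ?thesis
      by (subst nn_integral_add[OF P2 Q2, symmetric]) (intro nn_integral_cong nn_integral_add P1 Q1)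
  qed
  also have "(\<integral>\<^sup>+u1. \<integral>\<^sup>+u2. Q u2 u1 \<partial>LB I \<partial>LB I) = (\<integral>\<^sup>+u2. \<integral>\<^sup>+u1. Q u2 u1 \<partial>LB I \<partial>LB I)"
    by (rule LL.Fubini'[symmetric]) (use Qm' in \<open>simp add: split_beta\<close>)
  also have "(\<integral>\<^sup>+u1. \<integral>\<^sup>+u2. P u1 u2 \<partial>LB I \<partial>LB I) + (\<integral>\<^sup>+u2. \<integral>\<^sup>+u1. Q u2 u1 \<partial>LB I \<partial>LB I)
    \<le> ennreal (\<kappa> * real (card J1) * (4 * pi\<^sup>2 * (4 * E + (cmod (a / c))\<^sup>2)) ^ ?n)
     + ennreal (1 / \<kappa> * real (card J2) * (4 * pi\<^sup>2 * (4 * E + (cmod (d / b))\<^sup>2)) ^ ?n)"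
    by (rule add_mono[OF half1 half2])
  also have "\<dots> \<le> ennreal (sqrt (M1 * M2) * (4 * pi\<^sup>2 * (4 * E + \<rho>)) ^ ?n)
     + ennreal (sqrt (M1 * M2) * (4 * pi\<^sup>2 * (4 * E + \<rho>)) ^ ?n)"
  proof (intro add_mono ennreal_leI mult_mono power_mono)
    have "\<kappa> * real (card J1) \<le> \<kappa> * M1" using M \<kappa> by simp
    also have "\<dots> = sqrt M2 * (M1 / sqrt M1)" by (simp add: \<kappa>_def real_sqrt_divide)
    also have "\<dots> = sqrt (M1 * M2)" using M by (simp add: real_div_sqrt real_sqrt_mult)
    finally show "\<kappa> * real (card J1) \<le> sqrt (M1 * M2)" .
    have "1 / \<kappa> * real (card J2) \<le> 1 / \<kappa> * M2" using M \<kappa> by (intro mult_left_mono) auto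
    also have "\<dots> = sqrt M1 * (M2 / sqrt M2)" by (simp add: \<kappa>_def real_sqrt_divide)
    also have "\<dots> = sqrt (M1 * M2)" using M by (simp add: real_div_sqrt real_sqrt_mult)
    finally show "1 / \<kappa> * real (card J2) \<le> sqrt (M1 * M2)" .
  qed (use E ratio M in auto)
  also have "\<dots> = ennreal (2 * (sqrt (M1 * M2) * (4 * pi\<^sup>2 * (4 * E + \<rho>)) ^ ?n))"
    using M E order_trans[OF zero_le_power2 ratio(1)] by (subst ennreal_plus[symmetric]) auto
  also have "ennreal (1 / pi ^ ?n * (1 / pi ^ ?n)) * \<dots> = ennreal (2 * sqrt (M1 * M2) * (4 * (4 * E + \<rho>)) ^ ?n)"
  proof -
    have "1 / pi ^ ?n * (1 / pi ^ ?n) * (2 * (sqrt (M1 * M2) * (4 * pi\<^sup>2 * (4 * E + \<rho>)) ^ ?n))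
      = 2 * sqrt (M1 * M2) * (1 / pi * (1 / pi) * (4 * pi\<^sup>2 * (4 * E + \<rho>))) ^ ?n"
      by (simp add: power_mult_distrib power_divide)
    also have "1 / pi * (1 / pi) * (4 * pi\<^sup>2 * (4 * E + \<rho>)) = 4 * (4 * E + \<rho>)" by (simp add: power2_eq_square)
    finally show ?thesis by (simp flip: ennreal_mult')
  qed
  finally show ?thesis by (simp add: mult_left_mono)
qed

section \<open>Minimum distance decoding\<close>

text \<open>Completing the square moves the centre to \<open>- v / 2\<close> and leaves - |v|^2 / 4.
  The cross term with the offset \<open>i\<close> is at most 2 |i|^2 + |v|^2 / 8, so half of the
  decay survives.\<close>

lemma tilted_exponent:
  fixes z i v :: complex
  shows "- (cmod z)\<^sup>2 + ((cmod (i + z))\<^sup>2 - (cmod (i + z + v))\<^sup>2) / 2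
       \<le> - (cmod (z + v / 2))\<^sup>2 + (2 * (cmod i)\<^sup>2 - (cmod v)\<^sup>2 / 8)"
proof -
  have "- (cmod z)\<^sup>2 + ((cmod (i + z))\<^sup>2 - (cmod (i + z + v))\<^sup>2) / 2
     = - (cmod (z + v / 2))\<^sup>2 - (cmod v)\<^sup>2 / 4 - i \<bullet> v"
    unfolding cmod_power2 inner_complex_def by (simp add: power2_eq_square field_simps)
  moreover have "- (i \<bullet> v) \<le> 2 * (cmod i)\<^sup>2 + (cmod v)\<^sup>2 / 8"
  proof -
    have "- (i \<bullet> v) \<le> cmod i * cmod v"
      using Cauchy_Schwarz_ineq2[of i v] by linarith
    moreover have "0 \<le> (4 * cmod i - cmod v)\<^sup>2" by simp
    ultimately show ?thesis by (simp add: power2_eq_square algebra_simps)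
  qed
  ultimately show ?thesis by simp
qed

text \<open>Chernoff bound with parameter \<open>1/2\<close>; the offset \<open>i\<close> is interference treated as noise.\<close>

lemma pairwise_error:
  assumes I: "finite I"
  shows "emeasure (PiM I (\<lambda>_. cgauss)) {x \<in> space (LB I). sqn I (\<lambda>t. i t + x t + v t) \<le> sqn I (\<lambda>t. i t + x t)}
    \<le> ennreal (\<Prod>t\<in>I. exp (2 * (cmod (i t))\<^sup>2 - (cmod (v t))\<^sup>2 / 8))"
proof -
  let ?A = "{x \<in> space (LB I). sqn I (\<lambda>t. i t + x t + v t) \<le> sqn I (\<lambda>t. i t + x t)}"
  have A: "?A \<in> sets (LB I)" by measurable
  have "emeasure (PiM I (\<lambda>_. cgauss)) ?A = (\<integral>\<^sup>+x. ennreal (exp (- sqn I x) / pi ^ card I) * indicator ?A x \<partial>LB I)"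
    unfolding PiM_cgauss_density[OF I] by (rule emeasure_density) (use A in measurable)
  also have "\<dots> \<le> (\<integral>\<^sup>+x. (\<Prod>t\<in>I. ennreal (exp (2 * (cmod (i t))\<^sup>2 - (cmod (v t))\<^sup>2 / 8) / pi) * gker 1 (x t - (- v t / 2))) \<partial>LB I)"
  proof (rule nn_integral_mono)
    fix x
    have "exp (- sqn I x) / pi ^ card I \<le> (\<Prod>t\<in>I. exp (2 * (cmod (i t))\<^sup>2 - (cmod (v t))\<^sup>2 / 8) / pi * exp (- (1 * (cmod (x t - (- v t / 2)))\<^sup>2)))"
      if "x \<in> ?A"
    proof -
      have "- sqn I x \<le> - sqn I x + (sqn I (\<lambda>t. i t + x t) - sqn I (\<lambda>t. i t + x t + v t)) / 2"
        using that by simp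
      also have "\<dots> = (\<Sum>t\<in>I. - (cmod (x t))\<^sup>2 + ((cmod (i t + x t))\<^sup>2 - (cmod (i t + x t + v t))\<^sup>2) / 2)"
        by (simp add: sqn_def sum.distrib sum_subtractf sum_negf diff_divide_distrib sum_divide_distrib)
      also have "\<dots> \<le> (\<Sum>t\<in>I. - (cmod (x t + v t / 2))\<^sup>2 + (2 * (cmod (i t))\<^sup>2 - (cmod (v t))\<^sup>2 / 8))"
        by (intro sum_mono tilted_exponent)
      finally have "exp (- sqn I x) \<le> exp \<dots>" by simp
      also have "\<dots> = (\<Prod>t\<in>I. exp (- (cmod (x t + v t / 2))\<^sup>2) * exp (2 * (cmod (i t))\<^sup>2 - (cmod (v t))\<^sup>2 / 8))"
        by (simp only: exp_sum[OF I] exp_add)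
      finally have "exp (- sqn I x) / pi ^ card I \<le> \<dots> / pi ^ card I" by (simp add: divide_right_mono)
      then show ?thesis by (simp add: prod_dividef mult_ac prod.distrib)
    qed
    then show "ennreal (exp (- sqn I x) / pi ^ card I) * indicator ?A x
      \<le> (\<Prod>t\<in>I. ennreal (exp (2 * (cmod (i t))\<^sup>2 - (cmod (v t))\<^sup>2 / 8) / pi) * gker 1 (x t - (- v t / 2)))"
      by (cases "x \<in> ?A") (simp_all add: ennreal_mult'[symmetric] prod_ennreal ennreal_leI)
  qed
  also have "\<dots> = (\<Prod>t\<in>I. \<integral>\<^sup>+z. ennreal (exp (2 * (cmod (i t))\<^sup>2 - (cmod (v t))\<^sup>2 / 8) / pi) * gker 1 (z - (- v t / 2)) \<partial>lborel)"
    by (rule lbp.product_nn_integral_prod[OF I]) measurable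
  also have "\<dots> = (\<Prod>t\<in>I. ennreal (exp (2 * (cmod (i t))\<^sup>2 - (cmod (v t))\<^sup>2 / 8) / pi) * ennreal (pi / 1))"
    by (intro prod.cong refl, subst nn_integral_cmult, measurable, subst nn_integral_gker) simp_all
  also have "\<dots> = ennreal (\<Prod>t\<in>I. exp (2 * (cmod (i t))\<^sup>2 - (cmod (v t))\<^sup>2 / 8))"
    by (simp add: ennreal_mult'[symmetric] prod_ennreal)
  finally show ?thesis .
qed

text \<open>Ties are broken by the least index in an enumeration of \<open>W\<close>, which makes
  the selection measurable.\<close>

lemma measurable_minimizer:
  fixes d :: "'b \<Rightarrow> 'a \<Rightarrow> real"
  assumes W: "finite W" "W \<noteq> {}" and d: "\<And>w. w \<in> W \<Longrightarrow> d w \<in> borel_measurable M"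
  obtains sel where "sel \<in> M \<rightarrow>\<^sub>M count_space UNIV"
    "\<And>y. sel y \<in> W" "\<And>y w. w \<in> W \<Longrightarrow> d (sel y) y \<le> d w y"
proof -
  obtain e where e: "bij_betw e {0..<card W} W" using ex_bij_betw_nat_finite[OF W(1)] by blast
  define Q where "Q i y \<longleftrightarrow> i < card W \<and> (\<forall>w\<in>W. d (e i) y \<le> d w y)" for i y
  define sel where "sel y = e (LEAST i. Q i y)" for y
  have Qm: "(\<lambda>y. Q i y) \<in> M \<rightarrow>\<^sub>M count_space UNIV" for i
  proof (cases "i < card W")
    case True
    then have "e i \<in> W" using e by (auto simp: bij_betw_def)
    then have "Measurable.pred M (\<lambda>y. \<forall>w\<in>W. d (e i) y \<le> d w y)"
      unfolding pred_def using W(1) d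
      by (intro sets.sets_Collect_finite_All borel_measurable_le) auto
    then show ?thesis using True by (simp add: Q_def)
  qed (simp add: Q_def)
  have ex: "\<exists>i. Q i y" for y
  proof -
    obtain w where w: "w \<in> W" "\<forall>w'\<in>W. d w y \<le> d w' y"
      using W finite_imp_inj_to_nat_seg ex_min_if_finite[of "(\<lambda>w. d w y) ` W"]
      by (auto simp: not_less)
    then have "w \<in> e ` {0..<card W}" using e by (simp add: bij_betw_def)
    then obtain i where "i < card W" "e i = w" by auto
    with w show ?thesis by (auto simp: Q_def)
  qed
  have Qs: "Q (LEAST i. Q i y) y" for y using LeastI_ex[OF ex] .
  show ?thesis
  proof
    show "sel \<in> M \<rightarrow>\<^sub>M count_space UNIV"
      unfolding sel_def by (rule measurable_compose[OF measurable_Least[OF Qm]]) simp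
    show "sel y \<in> W" for y using Qs[of y] e by (auto simp: sel_def Q_def bij_betw_def)
    show "d (sel y) y \<le> d w y" if "w \<in> W" for y w using Qs[of y] that by (auto simp: sel_def Q_def)
  qed
qed

text \<open>The decoder is fixed before the transmitted tuple \<open>w\<close> and the interference
  \<open>i\<close>. A wrong output means that a tuple with another output is at least as close to
  the observation. Tuples with the same output do no harm, so layers that \<open>out\<close> ignores
  may be decoded wrongly. Interference of modulus at most 1 costs the factor \<open>exp 2\<close>
  per symbol.\<close>

lemma min_distance_decoder:
  fixes c :: "'b \<Rightarrow> nat \<Rightarrow> complex" and out :: "'b \<Rightarrow> nat \<times> nat"
  assumes W: "finite W" "W \<noteq> {}"
  shows "\<exists>g. g \<in> outsp n \<rightarrow>\<^sub>M count_space UNIV \<and>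
    (\<forall>w i. w \<in> W \<longrightarrow> (\<forall>t\<in>{1..n}. cmod (i t) \<le> 1) \<longrightarrow>
       gprob {1..n} (space (LB {1..n}) - decs n g (out w)) (\<lambda>t. c w t + i t)
        \<le> ennreal (\<Sum>w'\<in>{w'\<in>W. out w' \<noteq> out w}. \<Prod>t\<in>{1..n}. exp 2 * exp (- (cmod (c w t - c w' t))\<^sup>2 / 8)))"
proof -
  let ?I = "{1..n}"
  define d where "d w y = sqn ?I (\<lambda>t. y t - c w t)" for w and y :: "nat \<Rightarrow> complex"
  have dm: "d w \<in> borel_measurable (LB ?I)" for w unfolding d_def by measurable
  from measurable_minimizer[OF W, of d "LB ?I"] dm obtain sel
    where sel: "sel \<in> LB ?I \<rightarrow>\<^sub>M count_space UNIV" "\<And>y. sel y \<in> W" "\<And>y w. w \<in> W \<Longrightarrow> d (sel y) y \<le> d w y"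
    by metis
  define g where "g y = out (sel y)" for y
  have gm: "g \<in> outsp n \<rightarrow>\<^sub>M count_space UNIV"
  proof -
    have "g \<in> LB ?I \<rightarrow>\<^sub>M count_space UNIV"
      unfolding g_def by (rule measurable_compose[OF sel(1)]) simp
    then show ?thesis by (simp cong: measurable_cong_sets add: measurable_cong_sets[OF sets_outsp refl])
  qed
  show ?thesis
  proof (intro exI conjI allI impI)
    show "g \<in> outsp n \<rightarrow>\<^sub>M count_space UNIV" by (rule gm)
    fix w i assume w: "w \<in> W" and i: "\<forall>t\<in>?I. cmod (i t) \<le> 1"
    let ?B = "{w'\<in>W. out w' \<noteq> out w}"
    let ?N = "PiM ?I (\<lambda>_. cgauss)"
    define E where "E w' = {x \<in> space (LB ?I). sqn ?I (\<lambda>t. i t + x t + (c w t - c w' t)) \<le> sqn ?I (\<lambda>t. i t + x t)}" for w'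
    have Em: "E w' \<in> sets ?N" for w' unfolding E_def sets_PiM_cgauss by measurable
    have D: "space (LB ?I) - decs n g (out w) \<in> sets (LB ?I)" using decs_sets[OF gm] by blast
    have "gprob ?I (space (LB ?I) - decs n g (out w)) (\<lambda>t. c w t + i t)
      = emeasure ?N {x \<in> space (LB ?I). (\<lambda>t\<in>?I. c w t + i t + x t) \<in> space (LB ?I) - decs n g (out w)}"
      by (rule emeasure_shifted_noise[symmetric]) (use D in auto)
    also have "\<dots> \<le> emeasure ?N (\<Union>w'\<in>?B. E w')"
    proof (rule emeasure_mono)
      show "(\<Union>w'\<in>?B. E w') \<in> sets ?N" using W Em by auto
      show "{x \<in> space (LB ?I). (\<lambda>t\<in>?I. c w t + i t + x t) \<in> space (LB ?I) - decs n g (out w)} \<subseteq> (\<Union>w'\<in>?B. E w')"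
      proof safe
        fix x assume x: "x \<in> space (LB ?I)" and y: "(\<lambda>t\<in>?I. c w t + i t + x t) \<notin> decs n g (out w)"
          "(\<lambda>t\<in>?I. c w t + i t + x t) \<in> space (LB ?I)"
        define y where "y = (\<lambda>t\<in>?I. c w t + i t + x t)"
        have "out (sel y) \<noteq> out w" using y unfolding decs_def y_def[symmetric] g_def by auto
        moreover have "d (sel y) y \<le> d w y" by (rule sel(3)[OF w])
        moreover have "d w' y = sqn ?I (\<lambda>t. i t + x t + (c w t - c w' t))" for w'
          unfolding d_def by (rule sqn_cong) (simp add: y_def)
        moreover have "sqn ?I (\<lambda>t. i t + x t + (c w t - c w t)) = sqn ?I (\<lambda>t. i t + x t)" by simp
        ultimately have "x \<in> E (sel y)" "sel y \<in> ?B"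
          using x sel(2)[of y] unfolding E_def by auto
        then show "x \<in> (\<Union>w'\<in>?B. E w')" by blast
      qed
    qed
    also have "\<dots> \<le> (\<Sum>w'\<in>?B. emeasure ?N (E w'))"
      using W Em by (intro emeasure_subadditive_finite) auto
    also have "\<dots> \<le> (\<Sum>w'\<in>?B. ennreal (\<Prod>t\<in>?I. exp 2 * exp (- (cmod (c w t - c w' t))\<^sup>2 / 8)))"
    proof (rule sum_mono)
      fix w'
      have "emeasure ?N (E w') \<le> ennreal (\<Prod>t\<in>?I. exp (2 * (cmod (i t))\<^sup>2 - (cmod (c w t - c w' t))\<^sup>2 / 8))"
        unfolding E_def by (rule pairwise_error) simp
      also have "\<dots> \<le> ennreal (\<Prod>t\<in>?I. exp 2 * exp (- (cmod (c w t - c w' t))\<^sup>2 / 8))"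
      proof (intro ennreal_leI prod_mono conjI)
        fix t assume "t \<in> ?I"
        with i have "(cmod (i t))\<^sup>2 \<le> 1" by (simp add: power_le_one)
        then show "exp (2 * (cmod (i t))\<^sup>2 - (cmod (c w t - c w' t))\<^sup>2 / 8) \<le> exp 2 * exp (- (cmod (c w t - c w' t))\<^sup>2 / 8)"
          by (simp add: exp_add[symmetric])
      qed simp
      finally show "emeasure ?N (E w') \<le> ennreal (\<Prod>t\<in>?I. exp 2 * exp (- (cmod (c w t - c w' t))\<^sup>2 / 8))" .
    qed
    also have "\<dots> = ennreal (\<Sum>w'\<in>?B. \<Prod>t\<in>?I. exp 2 * exp (- (cmod (c w t - c w' t))\<^sup>2 / 8))"
      by (rule sum_ennreal) (simp add: prod_nonneg)
    finally show "gprob ?I (space (LB ?I) - decs n g (out w)) (\<lambda>t. c w t + i t)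
        \<le> ennreal (\<Sum>w'\<in>?B. \<Prod>t\<in>?I. exp 2 * exp (- (cmod (c w t - c w' t))\<^sup>2 / 8))" .
  qed
qed

lemma error_prob_union:
  assumes g: "g1 \<in> outsp n \<rightarrow>\<^sub>M count_space UNIV" "g2 \<in> outsp n \<rightarrow>\<^sub>M count_space UNIV"
  shows "ennreal (measure (noise n) {z \<in> space (noise n).
           g1 (Y1 h n f1 f2 m0 m1 m2 z) \<noteq> d1 \<or> g2 (Y2 h n f1 f2 m0 m1 m2 z) \<noteq> d2})
    \<le> gprob {1..n} (space (LB {1..n}) - decs n g1 d1) (sig1 h f1 f2 m0 m1 m2)
      + gprob {1..n} (space (LB {1..n}) - decs n g2 d2) (sig2 h f1 f2 m0 m1 m2)"
proof -
  interpret prob_space "noise n" by (rule prob_space_noise)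
  let ?S = "space (LB {1..n})"
  let ?A1 = "?S - decs n g1 d1" and ?A2 = "?S - decs n g2 d2"
  have s: "?A1 \<in> sets (LB {1..n})" "?A2 \<in> sets (LB {1..n})" "?S \<in> sets (LB {1..n})"
    using decs_sets g by blast+
  let ?E1 = "{z \<in> space (noise n). Y1 h n f1 f2 m0 m1 m2 z \<in> ?A1 \<and> Y2 h n f1 f2 m0 m1 m2 z \<in> ?S}"
  let ?E2 = "{z \<in> space (noise n). Y1 h n f1 f2 m0 m1 m2 z \<in> ?S \<and> Y2 h n f1 f2 m0 m1 m2 z \<in> ?A2}"
  have in_S: "Y1 h n f1 f2 m0 m1 m2 z \<in> ?S" "Y2 h n f1 f2 m0 m1 m2 z \<in> ?S" for z
    by (auto simp: Y1_eq Y2_eq space_PiM)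
  note e1 = emeasure_correct_general[OF s(1,3), of h f1 f2 m0 m1 m2]
  note e2 = emeasure_correct_general[OF s(3,2), of h f1 f2 m0 m1 m2]
  have "emeasure (noise n) {z \<in> space (noise n). g1 (Y1 h n f1 f2 m0 m1 m2 z) \<noteq> d1 \<or> g2 (Y2 h n f1 f2 m0 m1 m2 z) \<noteq> d2}
     \<le> emeasure (noise n) (?E1 \<union> ?E2)"
  proof (rule emeasure_mono)
    show "{z \<in> space (noise n). g1 (Y1 h n f1 f2 m0 m1 m2 z) \<noteq> d1 \<or> g2 (Y2 h n f1 f2 m0 m1 m2 z) \<noteq> d2} \<subseteq> ?E1 \<union> ?E2"
      using in_S by (auto simp: Y1_in_decs Y2_in_decs)
  qed (use e1(1) e2(1) in blast)
  also have "\<dots> \<le> emeasure (noise n) ?E1 + emeasure (noise n) ?E2"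
    by (rule emeasure_subadditive[OF e1(1) e2(1)])
  finally show ?thesis unfolding e1(2) e2(2) by (simp add: emeasure_eq_measure gprob_space)
qed

section \<open>Random grid codebooks\<close>

lemma geometric_sum_finite_le:
  fixes r :: real
  assumes r: "0 \<le> r" "r < 1" and F: "finite (F :: nat set)"
  shows "(\<Sum>i\<in>F. r ^ i) \<le> 1 / (1 - r)"
proof -
  have "(\<Sum>i\<in>F. r ^ i) \<le> suminf (\<lambda>i. r ^ i)"
    using r F by (intro sum_le_suminf summable_geometric) auto
  then show ?thesis using r by (simp add: suminf_geometric)
qed

text \<open>On either side of \<open>m\<close> the distances to \<open>m\<close> are distinct, so
  each side is dominated by one geometric series.\<close>

lemma two_sided_geometric_sum_le:
  fixes r :: real and m :: int
  assumes r: "0 \<le> r" "r < 1"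
  shows "(\<Sum>a<q. r ^ nat \<bar>int a - m\<bar>) \<le> 2 / (1 - r)"
proof -
  have half: "(\<Sum>a\<in>A. r ^ nat \<bar>int a - m\<bar>) \<le> 1 / (1 - r)"
    if A: "finite A" "inj_on (\<lambda>a. nat \<bar>int a - m\<bar>) A" for A
  proof -
    have "(\<Sum>a\<in>A. r ^ nat \<bar>int a - m\<bar>) = (\<Sum>i\<in>(\<lambda>a. nat \<bar>int a - m\<bar>) ` A. r ^ i)"
      by (simp add: sum.reindex[OF A(2)])
    also have "\<dots> \<le> 1 / (1 - r)" using A by (intro geometric_sum_finite_le r) auto
    finally show ?thesis .
  qed
  define A1 A2 where "A1 = {a\<in>{..<q}. int a \<ge> m}" and "A2 = {a\<in>{..<q}. int a < m}"
  have A: "finite A1" "finite A2" "A1 \<inter> A2 = {}" "{..<q} = A1 \<union> A2" by (auto simp: A1_def A2_def)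
  have "(\<Sum>a<q. r ^ nat \<bar>int a - m\<bar>) = (\<Sum>a\<in>A1. r ^ nat \<bar>int a - m\<bar>) + (\<Sum>a\<in>A2. r ^ nat \<bar>int a - m\<bar>)"
    unfolding A(4) by (rule sum.union_disjoint[OF A(1-3)])
  also have "\<dots> \<le> 1 / (1 - r) + 1 / (1 - r)"
    by (intro add_mono half A) (auto simp: inj_on_def A1_def A2_def)
  finally show ?thesis by simp
qed

text \<open>A sum over points of spacing \<epsilon> \<le> 1 against a kernel of constant width is
  O(1 / \<epsilon>) wherever the centre lies. The constant is 3 * 2 * 4, from exp 1 \<le> 3, the two
  sides, and 1 - r \<ge> \<epsilon> / 4.\<close>

lemma gaussian_grid_sum:
  fixes \<epsilon> x :: real
  assumes e: "0 < \<epsilon>" "\<epsilon> \<le> 1"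
  shows "(\<Sum>a<q. exp (- (\<epsilon> * real a - x)\<^sup>2 / 8)) \<le> 24 / \<epsilon>"
proof -
  define m where "m = \<lfloor>x / \<epsilon>\<rfloor>"
  define r where "r = exp (- \<epsilon> / 2)"
  have r: "0 \<le> r" "r < 1" using e by (auto simp: r_def)
  have r1: "1 - r \<ge> \<epsilon> / 4"
  proof -
    have "r * (1 + \<epsilon> / 2) \<le> r * exp (\<epsilon> / 2)"
      by (intro mult_left_mono exp_ge_add_one_self) (simp add: r_def)
    also have "\<dots> = 1" by (simp add: r_def exp_add[symmetric])
    also have "1 \<le> (1 - \<epsilon> / 4) * (1 + \<epsilon> / 2)"
    proof -
      have "\<epsilon> * \<epsilon> \<le> \<epsilon>" using e by (simp add: mult_left_le)
      then show ?thesis using e by (simp add: algebra_simps)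
    qed
    finally show ?thesis using e by simp
  qed
  have "exp (- (\<epsilon> * real a - x)\<^sup>2 / 8) \<le> exp 1 * r ^ nat \<bar>int a - m\<bar>" for a
  proof -
    define u where "u = \<bar>\<epsilon> * real a - x\<bar>"
    \<comment> \<open>The tangent at \<open>u = 2\<close> replaces the Gaussian by an exponential,
      which sums as a geometric series.\<close>
    have "0 \<le> (u - 2)\<^sup>2" by simp
    then have 1: "- u\<^sup>2 / 8 \<le> 1 / 2 - u / 2" by (simp add: power2_eq_square algebra_simps)
    have "real (nat \<bar>int a - m\<bar>) = \<bar>real a - real_of_int m\<bar>" by simp
    also have "\<dots> \<le> \<bar>real a - x / \<epsilon>\<bar> + 1" unfolding m_def by linarith
    also have "\<bar>real a - x / \<epsilon>\<bar> = u / \<epsilon>"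
    proof -
      have "real a - x / \<epsilon> = (\<epsilon> * real a - x) / \<epsilon>" using e by (simp add: field_simps)
      then show ?thesis using e by (simp add: u_def abs_divide)
    qed
    finally have "\<epsilon> * real (nat \<bar>int a - m\<bar>) \<le> \<epsilon> * (u / \<epsilon> + 1)" using e by (intro mult_left_mono) auto
    also have "\<dots> \<le> u + 1" using e by (simp add: algebra_simps)
    finally have "\<epsilon> * real (nat \<bar>int a - m\<bar>) \<le> u + 1" .
    moreover have "real (nat \<bar>int a - m\<bar>) * (- \<epsilon> / 2) = - (\<epsilon> * real (nat \<bar>int a - m\<bar>)) / 2" by simp
    ultimately have 2: "- u / 2 \<le> 1 / 2 + real (nat \<bar>int a - m\<bar>) * (- \<epsilon> / 2)" by linarith
    have "exp (- (\<epsilon> * real a - x)\<^sup>2 / 8) = exp (- u\<^sup>2 / 8)" by (simp add: u_def)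
    also have "\<dots> \<le> exp (1 + real (nat \<bar>int a - m\<bar>) * (- \<epsilon> / 2))" using 1 2 by simp
    also have "\<dots> = exp 1 * r ^ nat \<bar>int a - m\<bar>" unfolding exp_add r_def exp_of_nat_mult ..
    finally show ?thesis .
  qed
  then have "(\<Sum>a<q. exp (- (\<epsilon> * real a - x)\<^sup>2 / 8)) \<le> (\<Sum>a<q. exp 1 * r ^ nat \<bar>int a - m\<bar>)"
    by (intro sum_mono)
  also have "\<dots> \<le> exp 1 * (2 / (1 - r))"
    unfolding sum_distrib_left[symmetric] by (intro mult_left_mono two_sided_geometric_sum_le r) auto
  also have "\<dots> \<le> 3 * (2 / (\<epsilon> / 4))"
    using e r r1 exp_le by (intro mult_mono divide_left_mono) auto
  finally show ?thesis by simp
qed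

text \<open>A finite alphabet turns random coding into counting: averages over codebooks are finite
  sums, and a good codebook exists because some term is at most the average.\<close>

definition grid :: "nat \<Rightarrow> complex set" where
  "grid q = (\<lambda>(a, b). Complex (real a / real q) (real b / real q)) ` ({..<q} \<times> {..<q})"

lemma grid_inj: "q \<ge> 1 \<Longrightarrow> inj_on (\<lambda>(a, b). Complex (real a / real q) (real b / real q)) ({..<q} \<times> {..<q})"
  by (auto simp: inj_on_def)

lemma finite_grid [simp]: "finite (grid q)"
  by (simp add: grid_def)

lemma card_grid: "q \<ge> 1 \<Longrightarrow> card (grid q) = q * q"
  unfolding grid_def by (subst card_image[OF grid_inj]) auto

lemma grid_norm: "x \<in> grid q \<Longrightarrow> cmod x \<le> 2"
proof -
  assume "x \<in> grid q"
  then obtain a b where x: "x = Complex (real a / real q) (real b / real q)" "a < q" "b < q"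
    by (auto simp: grid_def)
  then have "\<bar>Re x\<bar> \<le> 1" "\<bar>Im x\<bar> \<le> 1" by auto
  then show ?thesis using cmod_le[of x] by linarith
qed

text \<open>Measuring \<open>v\<close> in units of \<open>G\<close> absorbs the phase of
  \<open>G\<close>, and the sum splits into two real ones of spacing |G| / q. The condition |G|
  \<le> q keeps the received grid at least as fine as the noise; relative to the number of points
  the bound is then independent of \<open>q\<close>.\<close>

lemma grid_gaussian_average:
  assumes G: "1 \<le> cmod G" "cmod G \<le> real q"
  shows "(\<Sum>x\<in>grid q. exp (- (cmod (G * x - v))\<^sup>2 / 8)) \<le> 576 / (cmod G)\<^sup>2 * real (card (grid q))"
proof -
  have q: "q \<ge> 1" using G by linarith
  have G0: "G \<noteq> 0" using G by auto
  define \<epsilon> where "\<epsilon> = cmod G / real q"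
  have e: "0 < \<epsilon>" "\<epsilon> \<le> 1" using G G0 q by (auto simp: \<epsilon>_def)
  define X Y where "X = cmod G * Re (v / G)" and "Y = cmod G * Im (v / G)"
  have sp: "(cmod (G * Complex (real a / real q) (real b / real q) - v))\<^sup>2
     = (\<epsilon> * real a - X)\<^sup>2 + (\<epsilon> * real b - Y)\<^sup>2" for a b
  proof -
    have "G * Complex (real a / real q) (real b / real q) - v = G * (Complex (real a / real q) (real b / real q) - v / G)"
      using G0 by (simp add: field_simps)
    then have "(cmod (G * Complex (real a / real q) (real b / real q) - v))\<^sup>2
       = (cmod G)\<^sup>2 * ((real a / real q - Re (v / G))\<^sup>2 + (real b / real q - Im (v / G))\<^sup>2)"
      by (simp only: norm_mult power_mult_distrib cmod_power2 minus_complex.sel complex.sel)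
    also have "\<dots> = (cmod G * (real a / real q - Re (v / G)))\<^sup>2 + (cmod G * (real b / real q - Im (v / G)))\<^sup>2"
      by (simp only: power_mult_distrib distrib_left)
    also have "cmod G * (real a / real q - Re (v / G)) = \<epsilon> * real a - X"
      by (simp add: \<epsilon>_def X_def right_diff_distrib)
    also have "cmod G * (real b / real q - Im (v / G)) = \<epsilon> * real b - Y"
      by (simp add: \<epsilon>_def Y_def right_diff_distrib)
    finally show ?thesis .
  qed
  have "(\<Sum>x\<in>grid q. exp (- (cmod (G * x - v))\<^sup>2 / 8))
     = (\<Sum>(a, b)\<in>{..<q} \<times> {..<q}. exp (- (\<epsilon> * real a - X)\<^sup>2 / 8) * exp (- (\<epsilon> * real b - Y)\<^sup>2 / 8))"
    unfolding grid_def by (subst sum.reindex[OF grid_inj[OF q]])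
      (auto intro!: sum.cong simp: sp exp_add[symmetric] add_divide_distrib diff_divide_distrib)
  also have "\<dots> = (\<Sum>a<q. exp (- (\<epsilon> * real a - X)\<^sup>2 / 8)) * (\<Sum>b<q. exp (- (\<epsilon> * real b - Y)\<^sup>2 / 8))"
    by (simp add: sum_product sum.cartesian_product)
  also have "\<dots> \<le> (24 / \<epsilon>) * (24 / \<epsilon>)"
    using e by (intro mult_mono gaussian_grid_sum sum_nonneg) auto
  also have "\<dots> = 576 / (cmod G)\<^sup>2 * real (card (grid q))"
    using q G0 by (simp add: \<epsilon>_def card_grid power2_eq_square field_simps)
  finally show ?thesis .
qed

lemma sum_PiE_resample:
  fixes F :: "('j \<Rightarrow> 'x) \<Rightarrow> real"
  assumes J: "finite J" "j \<in> J" and Q: "finite Q" "Q \<noteq> {}"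
    and le: "\<And>b. b \<in> PiE J (\<lambda>_. Q) \<Longrightarrow> (\<Sum>a\<in>Q. F (b(j := a))) \<le> \<rho> * real (card Q)"
  shows "(\<Sum>b\<in>PiE J (\<lambda>_. Q). F b) \<le> \<rho> * real (card (PiE J (\<lambda>_. Q)))"
proof -
  define J' where "J' = J - {j}"
  have J': "finite J'" "j \<notin> J'" "J = insert j J'" using J by (auto simp: J'_def)
  have "(\<Sum>b\<in>PiE J (\<lambda>_. Q). F b) = (\<Sum>p\<in>Q \<times> PiE J' (\<lambda>_. Q). F ((snd p)(j := fst p)))"
    unfolding J'(3) PiE_insert_eq using inj_combinator[OF J'(2), of "\<lambda>_. Q"]
    by (subst sum.reindex) (auto simp: split_beta)
  also have "\<dots> = (\<Sum>g\<in>PiE J' (\<lambda>_. Q). \<Sum>a\<in>Q. F (g(j := a)))"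
    by (subst sum.swap) (simp add: sum.cartesian_product split_beta)
  also have "\<dots> \<le> (\<Sum>g\<in>PiE J' (\<lambda>_. Q). \<rho> * real (card Q))"
  proof (rule sum_mono)
    fix g assume g: "g \<in> PiE J' (\<lambda>_. Q)"
    obtain a0 where a0: "a0 \<in> Q" using Q by auto
    have "g(j := a0) \<in> PiE J (\<lambda>_. Q)" using g a0 unfolding J'(3) by (auto simp: PiE_iff extensional_def)
    from le[OF this] show "(\<Sum>a\<in>Q. F (g(j := a))) \<le> \<rho> * real (card Q)" by simp
  qed
  also have "\<dots> = \<rho> * real (card (PiE J (\<lambda>_. Q)))"
    using J' by (simp add: card_PiE mult_ac)
  finally show ?thesis .
qed

text \<open>\<open>\<omega> t (k, i)\<close> is the symbol at time \<open>t\<close> of codeword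
  \<open>i\<close> in layer \<open>k\<close>. Time is the outer index, so that sums over codebooks
  of products over time factor.\<close>

definition codebooks :: "nat \<Rightarrow> nat \<Rightarrow> nat set \<Rightarrow> (nat \<Rightarrow> nat) \<Rightarrow> (nat \<Rightarrow> nat \<times> nat \<Rightarrow> complex) set" where
  "codebooks n q K M = PiE {1..n} (\<lambda>_. PiE (SIGMA k:K. {..<M k}) (\<lambda>_. grid q))"

text \<open>The competitor's symbol at \<open>(k0, w' k0)\<close> does not occur in the transmitted
  tuple. It can be averaged alone with all other symbols frozen, because
  \<open>grid_gaussian_average\<close> holds for any offset.\<close>

lemma codebook_average:
  fixes G :: "nat \<Rightarrow> complex"
  assumes K: "finite K" "C \<subseteq> K" and w: "\<And>k. k \<in> C \<Longrightarrow> w k < M k" "\<And>k. k \<in> C \<Longrightarrow> w' k < M k"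
    and k0: "k0 \<in> C" "w k0 \<noteq> w' k0" and G: "1 \<le> cmod (G k0)" "cmod (G k0) \<le> real q"
  shows "(\<Sum>\<omega>\<in>codebooks n q K M. \<Prod>t\<in>{1..n}. exp 2 *
       exp (- (cmod ((\<Sum>k\<in>C. G k * \<omega> t (k, w k)) - (\<Sum>k\<in>C. G k * \<omega> t (k, w' k))))\<^sup>2 / 8))
     \<le> (exp 2 * (576 / (cmod (G k0))\<^sup>2)) ^ n * real (card (codebooks n q K M))"
proof -
  define J where "J = (SIGMA k:K. {..<M k})"
  have finC: "finite C" using K finite_subset by blast
  have J: "finite J" unfolding J_def using K by auto
  have q: "q \<ge> 1" using G by linarith
  define \<rho> where "\<rho> = exp 2 * (576 / (cmod (G k0))\<^sup>2)"
  define S where "S = PiE J (\<lambda>_. grid q)"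
  define F where "F b = exp 2 * exp (- (cmod ((\<Sum>k\<in>C. G k * b (k, w k)) - (\<Sum>k\<in>C. G k * b (k, w' k))))\<^sup>2 / 8)" for b
  have finS: "finite S" unfolding S_def using J by (simp add: finite_PiE)
  have "(\<Sum>b\<in>S. F b) \<le> \<rho> * real (card S)"
    unfolding S_def
  proof (rule sum_PiE_resample[OF J])
    show "(k0, w' k0) \<in> J" using k0 K w by (auto simp: J_def)
    show "grid q \<noteq> {}" using card_grid[OF q] q by auto
    fix b :: "nat \<times> nat \<Rightarrow> complex"
    define v where "v = (\<Sum>k\<in>C. G k * b (k, w k)) - (\<Sum>k\<in>C - {k0}. G k * b (k, w' k))"
    have "F (b((k0, w' k0) := a)) = exp 2 * exp (- (cmod (G k0 * a - v))\<^sup>2 / 8)" for a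
    proof -
      let ?b = "b((k0, w' k0) := a)"
      have "(\<Sum>k\<in>C. G k * ?b (k, w k)) = (\<Sum>k\<in>C. G k * b (k, w k))"
        using k0 by (intro sum.cong) auto
      moreover have "(\<Sum>k\<in>C. G k * ?b (k, w' k)) = G k0 * a + (\<Sum>k\<in>C - {k0}. G k * b (k, w' k))"
        using k0 finC by (subst sum.remove[OF finC k0(1)]) (auto intro!: sum.cong)
      ultimately have "(\<Sum>k\<in>C. G k * ?b (k, w k)) - (\<Sum>k\<in>C. G k * ?b (k, w' k)) = - (G k0 * a - v)"
        by (simp add: v_def)
      then show ?thesis unfolding F_def by (simp only: norm_minus_cancel)
    qed
    then have "(\<Sum>a\<in>grid q. F (b((k0, w' k0) := a))) = exp 2 * (\<Sum>a\<in>grid q. exp (- (cmod (G k0 * a - v))\<^sup>2 / 8))"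
      by (simp add: sum_distrib_left)
    also have "\<dots> \<le> exp 2 * (576 / (cmod (G k0))\<^sup>2 * real (card (grid q)))"
      by (intro mult_left_mono grid_gaussian_average G) auto
    finally show "(\<Sum>a\<in>grid q. F (b((k0, w' k0) := a))) \<le> \<rho> * real (card (grid q))" by (simp add: \<rho>_def)
  qed auto
  then have "(\<Prod>t\<in>{1..n}. \<Sum>b\<in>S. F b) \<le> (\<Prod>t\<in>{1..n}. \<rho> * real (card S))"
    by (intro prod_mono conjI sum_nonneg) (auto simp: F_def)
  moreover have "(\<Prod>t\<in>{1..n}. \<Sum>b\<in>S. F b) = (\<Sum>\<omega>\<in>codebooks n q K M. \<Prod>t\<in>{1..n}. F (\<omega> t))"
    unfolding codebooks_def J_def[symmetric] S_def[symmetric] by (rule prod_sum_PiE) (auto simp: finS)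
  moreover have "card (codebooks n q K M) = card S ^ n"
    unfolding codebooks_def J_def[symmetric] S_def[symmetric] by (simp add: card_PiE)
  ultimately have "(\<Sum>\<omega>\<in>codebooks n q K M. \<Prod>t\<in>{1..n}. F (\<omega> t)) \<le> \<rho> ^ n * real (card (codebooks n q K M))"
    by (simp add: power_mult_distrib)
  then show ?thesis unfolding F_def \<rho>_def .
qed

lemma finite_codebooks: "finite K \<Longrightarrow> finite (codebooks n q K M)"
  unfolding codebooks_def by (intro finite_PiE) auto

lemma codebooks_nonempty: "q \<ge> 1 \<Longrightarrow> codebooks n q K M \<noteq> {}"
  unfolding codebooks_def PiE_eq_empty_iff using card_grid[of q] by (auto simp: PiE_eq_empty_iff)

text \<open>Sum over all competing tuples, grouped by the set \<open>S\<close> of wrongly decoded layers; only an error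
  in a layer of \<open>D\<close> counts.\<close>

lemma codebook_union_bound:
  fixes G :: "nat \<Rightarrow> complex"
  assumes K: "finite K" "C \<subseteq> K" and w: "\<And>k. k \<in> C \<Longrightarrow> w k < M k" and q: "q \<ge> 1"
    and cond: "\<And>S. S \<subseteq> C \<Longrightarrow> S \<inter> D \<noteq> {} \<Longrightarrow> (\<And>k. k \<in> S \<Longrightarrow> M k \<ge> 2) \<Longrightarrow>
      \<exists>k\<in>S. 1 \<le> cmod (G k) \<and> cmod (G k) \<le> real q \<and>
        (\<Prod>k\<in>S. real (M k)) * (exp 2 * (576 / (cmod (G k))\<^sup>2)) ^ n \<le> \<eta>"
    and \<eta>: "\<eta> \<ge> 0"
  shows "(\<Sum>\<omega>\<in>codebooks n q K M. \<Sum>w'\<in>{w'\<in>PiE C (\<lambda>k. {..<M k}). \<exists>k\<in>C \<inter> D. w' k \<noteq> w k}.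
      \<Prod>t\<in>{1..n}. exp 2 * exp (- (cmod ((\<Sum>k\<in>C. G k * \<omega> t (k, w k)) - (\<Sum>k\<in>C. G k * \<omega> t (k, w' k))))\<^sup>2 / 8))
     \<le> 2 ^ card C * \<eta> * real (card (codebooks n q K M))"
proof -
  define W where "W = PiE C (\<lambda>k. {..<M k})"
  have finC: "finite C" using K finite_subset by blast
  have finW: "finite W" unfolding W_def using finC by (simp add: finite_PiE)
  let ?\<Omega> = "codebooks n q K M"
  define f where "f \<omega> w' = (\<Prod>t\<in>{1..n}. exp 2 * exp (- (cmod ((\<Sum>k\<in>C. G k * \<omega> t (k, w k)) - (\<Sum>k\<in>C. G k * \<omega> t (k, w' k))))\<^sup>2 / 8))"
    for \<omega> :: "nat \<Rightarrow> nat \<times> nat \<Rightarrow> complex" and w'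
  define df where "df w' = {k\<in>C. w' k \<noteq> w k}" for w'
  define B where "B = {w'\<in>W. \<exists>k\<in>C \<inter> D. w' k \<noteq> w k}"
  have finB: "finite B" using finW by (simp add: B_def)
  have "(\<Sum>\<omega>\<in>?\<Omega>. \<Sum>w'\<in>B. f \<omega> w') = (\<Sum>w'\<in>B. \<Sum>\<omega>\<in>?\<Omega>. f \<omega> w')" by (rule sum.swap)
  also have "\<dots> = (\<Sum>S\<in>Pow C. \<Sum>w'\<in>{w'\<in>B. df w' = S}. \<Sum>\<omega>\<in>?\<Omega>. f \<omega> w')"
    using finC finB by (intro sum.group[symmetric]) (auto simp: df_def)
  also have "\<dots> \<le> (\<Sum>S\<in>Pow C. \<eta> * real (card ?\<Omega>))"
  proof (rule sum_mono)
    fix S assume S: "S \<in> Pow C"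
    then have finS: "finite S" using finC finite_subset by blast
    show "(\<Sum>w'\<in>{w'\<in>B. df w' = S}. \<Sum>\<omega>\<in>?\<Omega>. f \<omega> w') \<le> \<eta> * real (card ?\<Omega>)"
    proof (cases "{w'\<in>B. df w' = S} = {}")
      case True
      then show ?thesis using \<eta> by (simp only: sum.empty) simp
    next
      case False
      then obtain w1 where w1: "w1 \<in> B" "df w1 = S" by auto
      \<comment> \<open>A wrong index needs a second codeword, so layers with a single codeword
        never enter an error pattern.\<close>
      have "M k \<ge> 2" if "k \<in> S" for k
      proof -
        have "k \<in> C" "w1 k \<noteq> w k" using that w1 by (auto simp: df_def)
        moreover have "w1 k < M k" using w1 \<open>k \<in> C\<close> by (auto simp: B_def W_def)
        ultimately show ?thesis using w[of k] by linarith
      qed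
      moreover have "S \<inter> D \<noteq> {}" using w1 by (auto simp: B_def df_def)
      ultimately obtain k0 where k0: "k0 \<in> S" "1 \<le> cmod (G k0)" "cmod (G k0) \<le> real q"
        and le: "(\<Prod>k\<in>S. real (M k)) * (exp 2 * (576 / (cmod (G k0))\<^sup>2)) ^ n \<le> \<eta>"
        using cond[of S] S by auto
      define X where "X = (exp 2 * (576 / (cmod (G k0))\<^sup>2)) ^ n"
      have "(\<Sum>w'\<in>{w'\<in>B. df w' = S}. \<Sum>\<omega>\<in>?\<Omega>. f \<omega> w') \<le> (\<Sum>w'\<in>{w'\<in>B. df w' = S}. X * real (card ?\<Omega>))"
        unfolding f_def X_def
      proof (intro sum_mono codebook_average K w k0(2,3))
        fix w' assume "w' \<in> {w'\<in>B. df w' = S}"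
        then show "k0 \<in> C" "w k0 \<noteq> w' k0" "\<And>k. k \<in> C \<Longrightarrow> w' k < M k"
          using k0 by (auto simp: df_def B_def W_def)
      qed
      also have "\<dots> = real (card {w'\<in>B. df w' = S}) * X * real (card ?\<Omega>)" by simp
      also have "\<dots> \<le> (\<Prod>k\<in>S. real (M k)) * X * real (card ?\<Omega>)"
      proof (intro mult_right_mono)
        \<comment> \<open>A competitor with error pattern \<open>S\<close> agrees with
          \<open>w\<close> on the rest of \<open>C\<close>, so its values on \<open>S\<close>
          determine it.\<close>
        have "card {w'\<in>B. df w' = S} \<le> card (PiE S (\<lambda>k. {..<M k}))"
        proof (rule card_inj_on_le[where f = "\<lambda>w'. restrict w' S"])
          show "inj_on (\<lambda>w'. restrict w' S) {w'\<in>B. df w' = S}"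
          proof (rule inj_onI)
            fix u v assume uv: "u \<in> {w'\<in>B. df w' = S}" "v \<in> {w'\<in>B. df w' = S}" "restrict u S = restrict v S"
            show "u = v"
            proof
              fix k
              have "u k = v k" if "k \<in> S" using fun_cong[OF uv(3), of k] that by simp
              moreover have "u k = v k" if "k \<in> C" "k \<notin> S"
              proof -
                have "k \<notin> df u" "k \<notin> df v" using uv(1,2) that(2) by simp_all
                then show ?thesis using that(1) by (simp add: df_def)
              qed
              moreover have "u k = v k" if "k \<notin> C" using uv(1,2) that by (auto simp: B_def W_def PiE_iff extensional_def)
              ultimately show "u k = v k" by blast
            qed
          qed
          show "(\<lambda>w'. restrict w' S) ` {w'\<in>B. df w' = S} \<subseteq> PiE S (\<lambda>k. {..<M k})"
            using S by (auto simp: B_def W_def)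
          show "finite (PiE S (\<lambda>k. {..<M k}))" using finS by (simp add: finite_PiE)
        qed
        then have "card {w'\<in>B. df w' = S} \<le> (\<Prod>k\<in>S. M k)" using finS by (simp add: card_PiE)
        then have "real (card {w'\<in>B. df w' = S}) \<le> real (\<Prod>k\<in>S. M k)" by (simp only: of_nat_le_iff)
        then show "real (card {w'\<in>B. df w' = S}) \<le> (\<Prod>k\<in>S. real (M k))" by (simp only: of_nat_prod)
      qed (auto simp: X_def)
      also have "\<dots> \<le> \<eta> * real (card ?\<Omega>)" using le by (intro mult_right_mono) (auto simp: X_def)
      finally show ?thesis .
    qed
  qed
  also have "\<dots> = 2 ^ card C * \<eta> * real (card ?\<Omega>)" using finC by (simp add: card_Pow)
  finally show ?thesis unfolding B_def f_def W_def .
qed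

declare One_nat_def [simp del]

section \<open>Outer bounds\<close>

definition succ_prob where
  "succ_prob h n f1 f2 g1 g2 m0 m1 m2 = 1 - measure (noise n) {z \<in> space (noise n).
     g1 (Y1 h n f1 f2 m0 m1 m2 z) \<noteq> (m0, m1) \<or> g2 (Y2 h n f1 f2 m0 m1 m2 z) \<noteq> (m0, m2)}"

lemma succ_prob_bounds: "0 \<le> succ_prob h n f1 f2 g1 g2 m0 m1 m2" "succ_prob h n f1 f2 g1 g2 m0 m1 m2 \<le> 1"
  using prob_space.prob_le_1[OF prob_space_noise] by (auto simp: succ_prob_def)

text \<open>The threshold is 8 times the permitted average energy, so that each user loses at most
  1/8 of its messages, counted jointly with the common one.\<close>

definition lowpow :: "nat \<Rightarrow> nat \<Rightarrow> (nat \<Rightarrow> nat \<Rightarrow> nat \<Rightarrow> complex) \<Rightarrow> nat \<Rightarrow> nat set" where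
  "lowpow n N f m0 = {m \<in> {1..N}. sqn {1..n} (f m0 m) \<le> 8 * real n}"

lemma finite_lowpow [simp]: "finite (lowpow n N f m0)"
  by (simp add: lowpow_def)

lemma power_sum_le:
  assumes "n \<ge> 1" "N0 \<ge> 1" "N \<ge> 1"
    and "(1 / real n) * (\<Sum>t\<in>{1..n}. (\<Sum>m0\<in>{1..N0}. \<Sum>m\<in>{1..N}. (cmod (f m0 m t))\<^sup>2)
         / (real N0 * real N)) \<le> 1"
  shows "(\<Sum>m0\<in>{1..N0}. \<Sum>m\<in>{1..N}. sqn {1..n} (f m0 m)) \<le> real n * real N0 * real N"
proof -
  have "(\<Sum>m0\<in>{1..N0}. \<Sum>m\<in>{1..N}. sqn {1..n} (f m0 m))
     = (\<Sum>m0\<in>{1..N0}. \<Sum>t\<in>{1..n}. \<Sum>m\<in>{1..N}. (cmod (f m0 m t))\<^sup>2)"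
    unfolding sqn_def by (intro sum.cong refl sum.swap)
  also have "\<dots> = (\<Sum>t\<in>{1..n}. \<Sum>m0\<in>{1..N0}. \<Sum>m\<in>{1..N}. (cmod (f m0 m t))\<^sup>2)"
    by (rule sum.swap)
  finally show ?thesis
    using assms by (simp add: sum_divide_distrib[symmetric] field_simps)
qed

text \<open>Success has average at least 3/4, and Markov's inequality for the energies removes at
  most 1/8 for each user, which leaves 1/2.\<close>

lemma success_low_power:
  assumes v: "valid_code n R0 R1 R2 f1 f2 g1 g2" and R: "R0 \<ge> 0" "R1 \<ge> 0" "R2 \<ge> 0"
    and e: "perr h n R0 R1 R2 f1 f2 g1 g2 \<le> 1 / 4"
  shows "real (nmsg n R0) * real (nmsg n R1) * real (nmsg n R2) / 2 \<le>
    (\<Sum>m0\<in>{1..nmsg n R0}. \<Sum>m1\<in>lowpow n (nmsg n R1) f1 m0. \<Sum>m2\<in>lowpow n (nmsg n R2) f2 m0.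
       succ_prob h n f1 f2 g1 g2 m0 m1 m2)"
proof -
  define N0 N1 N2 where "N0 = nmsg n R0" and "N1 = nmsg n R1" and "N2 = nmsg n R2"
  have N: "N0 \<ge> 1" "N1 \<ge> 1" "N2 \<ge> 1" using R nmsg_ge_1 by (auto simp: N0_def N1_def N2_def)
  have n: "n \<ge> 1" using v by (simp add: valid_code_def)
  let ?s = "succ_prob h n f1 f2 g1 g2"
  have p1: "(\<Sum>m0\<in>{1..N0}. \<Sum>m\<in>{1..N1}. sqn {1..n} (f1 m0 m)) \<le> real n * real N0 * real N1"
    by (rule power_sum_le[OF n N(1,2)]) (use v in \<open>simp add: valid_code_def N0_def N1_def\<close>)
  have p2: "(\<Sum>m0\<in>{1..N0}. \<Sum>m\<in>{1..N2}. sqn {1..n} (f2 m0 m)) \<le> real n * real N0 * real N2"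
    by (rule power_sum_le[OF n N(1,3)]) (use v in \<open>simp add: valid_code_def N0_def N2_def\<close>)
  define T where "T = real N0 * real N1 * real N2"
  have "(\<Sum>m0\<in>{1..N0}. \<Sum>m1\<in>{1..N1}. \<Sum>m2\<in>{1..N2}. ?s m0 m1 m2) = T - T * perr h n R0 R1 R2 f1 f2 g1 g2"
    using N by (simp add: succ_prob_def sum_subtractf perr_def T_def N0_def N1_def N2_def)
  moreover have "T * perr h n R0 R1 R2 f1 f2 g1 g2 \<le> T * (1 / 4)"
    by (intro mult_left_mono e) (simp add: T_def)
  ultimately have tot: "3 / 4 * T \<le> (\<Sum>m0\<in>{1..N0}. \<Sum>m1\<in>{1..N1}. \<Sum>m2\<in>{1..N2}. ?s m0 m1 m2)" by simp
  define G1 where "G1 m0 m1 = (if m1 \<in> lowpow n N1 f1 m0 then 1 else 0 :: real)" for m0 m1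
  define G2 where "G2 m0 m2 = (if m2 \<in> lowpow n N2 f2 m0 then 1 else 0 :: real)" for m0 m2
  have "(\<Sum>m0\<in>{1..N0}. \<Sum>m1\<in>{1..N1}. \<Sum>m2\<in>{1..N2}. ?s m0 m1 m2)
     \<le> (\<Sum>m0\<in>{1..N0}. \<Sum>m1\<in>{1..N1}. \<Sum>m2\<in>{1..N2}. G1 m0 m1 * (G2 m0 m2 * ?s m0 m1 m2)
         + sqn {1..n} (f1 m0 m1) / (8 * real n) + sqn {1..n} (f2 m0 m2) / (8 * real n))"
  proof (intro sum_mono)
    fix m0 m1 m2 assume m: "m1 \<in> {1..N1}" "m2 \<in> {1..N2}"
    \<comment> \<open>For a discarded message the energy term alone is at least 1 and covers the
      success probability, so the energy terms do the counting.\<close>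
    have b1: "1 \<le> sqn {1..n} (f1 m0 m1) / (8 * real n)" if "G1 m0 m1 = 0"
      using that m n by (auto simp: G1_def lowpow_def split: if_splits)
    have b2: "1 \<le> sqn {1..n} (f2 m0 m2) / (8 * real n)" if "G2 m0 m2 = 0"
      using that m n by (auto simp: G2_def lowpow_def split: if_splits)
    have pos: "0 \<le> sqn {1..n} (f1 m0 m1) / (8 * real n)" "0 \<le> sqn {1..n} (f2 m0 m2) / (8 * real n)" by auto
    have sp: "0 \<le> ?s m0 m1 m2" "?s m0 m1 m2 \<le> 1" by (rule succ_prob_bounds)+
    have "G1 m0 m1 = 0 \<or> G1 m0 m1 = 1" "G2 m0 m2 = 0 \<or> G2 m0 m2 = 1" by (auto simp: G1_def G2_def)
    then show "?s m0 m1 m2 \<le> G1 m0 m1 * (G2 m0 m2 * ?s m0 m1 m2)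
         + sqn {1..n} (f1 m0 m1) / (8 * real n) + sqn {1..n} (f2 m0 m2) / (8 * real n)"
    proof (elim disjE)
      assume "G1 m0 m1 = 0" "G2 m0 m2 = 0"
      with b1 b2 pos sp show ?thesis by (simp only: mult_zero_left) linarith
    next
      assume "G1 m0 m1 = 0" "G2 m0 m2 = 1"
      with b1 pos sp show ?thesis by (simp only: mult_zero_left) linarith
    next
      assume "G1 m0 m1 = 1" "G2 m0 m2 = 0"
      with b2 pos sp show ?thesis by (simp only: mult_zero_left mult_1) linarith
    next
      assume "G1 m0 m1 = 1" "G2 m0 m2 = 1"
      with pos sp show ?thesis by (simp only: mult_1)
    qed
  qed
  also have "\<dots> = (\<Sum>m0\<in>{1..N0}. \<Sum>m1\<in>{1..N1}. G1 m0 m1 * (\<Sum>m2\<in>{1..N2}. G2 m0 m2 * ?s m0 m1 m2))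
      + real N2 * (\<Sum>m0\<in>{1..N0}. \<Sum>m1\<in>{1..N1}. sqn {1..n} (f1 m0 m1)) / (8 * real n)
      + real N1 * (\<Sum>m0\<in>{1..N0}. \<Sum>m2\<in>{1..N2}. sqn {1..n} (f2 m0 m2)) / (8 * real n)"
    by (simp add: sum.distrib sum_distrib_left sum_divide_distrib)
  also have "(\<Sum>m0\<in>{1..N0}. \<Sum>m1\<in>{1..N1}. G1 m0 m1 * (\<Sum>m2\<in>{1..N2}. G2 m0 m2 * ?s m0 m1 m2))
     = (\<Sum>m0\<in>{1..N0}. \<Sum>m1\<in>lowpow n N1 f1 m0. \<Sum>m2\<in>lowpow n N2 f2 m0. ?s m0 m1 m2)"
  proof (rule sum.cong[OF refl])
    fix m0
    have "(\<Sum>m\<in>{1..N}. (if m \<in> lowpow n N f m0 then 1 else 0) * F m) = (\<Sum>m\<in>lowpow n N f m0. F m)"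
      for F :: "nat \<Rightarrow> real" and N f
      by (intro sum.mono_neutral_cong_right) (auto simp: lowpow_def)
    then show "(\<Sum>m1\<in>{1..N1}. G1 m0 m1 * (\<Sum>m2\<in>{1..N2}. G2 m0 m2 * ?s m0 m1 m2))
      = (\<Sum>m1\<in>lowpow n N1 f1 m0. \<Sum>m2\<in>lowpow n N2 f2 m0. ?s m0 m1 m2)"
      unfolding G1_def G2_def by simp
  qed
  also have "real N2 * (\<Sum>m0\<in>{1..N0}. \<Sum>m1\<in>{1..N1}. sqn {1..n} (f1 m0 m1)) / (8 * real n) \<le> real N2 * (real n * real N0 * real N1) / (8 * real n)"
    by (intro divide_right_mono mult_left_mono p1) auto
  also have "\<dots> = T / 8" using n by (simp add: T_def)
  also have "real N1 * (\<Sum>m0\<in>{1..N0}. \<Sum>m2\<in>{1..N2}. sqn {1..n} (f2 m0 m2)) / (8 * real n) \<le> real N1 * (real n * real N0 * real N2) / (8 * real n)"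
    by (intro divide_right_mono mult_left_mono p2) auto
  also have "\<dots> = T / 8" using n by (simp add: T_def)
  finally show ?thesis using tot by (simp add: T_def N0_def N1_def N2_def)
qed

lemma ennreal_succ_prob:
  assumes "valid_code n R0 R1 R2 f1 f2 g1 g2"
  shows "ennreal (succ_prob h n f1 f2 g1 g2 m0 m1 m2) =
    gprob {1..n} (decs n g1 (m0, m1)) (\<lambda>t. h 1 1 * f1 m0 m1 t + h 1 2 * f2 m0 m2 t) *
    gprob {1..n} (decs n g2 (m0, m2)) (\<lambda>t. h 2 1 * f1 m0 m1 t + h 2 2 * f2 m0 m2 t)"
  unfolding succ_prob_def
  by (subst error_prob_eq) (use assms in \<open>auto simp: valid_code_def sig1_def[abs_def] sig2_def[abs_def]\<close>)

lemma disjoint_decs: "inj_on f J \<Longrightarrow> disjoint_family_on (\<lambda>m. decs n g (f m)) J"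
  by (auto simp: disjoint_family_on_def decs_def inj_on_def)

section \<open>The three rate bounds for one channel\<close>

locale sym_channel =
  fixes h :: chan and P \<alpha> :: real
  assumes P: "P \<ge> 1" and a0: "\<alpha> \<ge> 0"
    and h: "(cmod (h 1 1))\<^sup>2 = P" "(cmod (h 2 2))\<^sup>2 = P"
      "(cmod (h 1 2))\<^sup>2 = P powr \<alpha>" "(cmod (h 2 1))\<^sup>2 = P powr \<alpha>"
begin

lemma h_nz: "h 1 1 \<noteq> 0" "h 2 2 \<noteq> 0" "h 1 2 \<noteq> 0" "h 2 1 \<noteq> 0"
  using P h by auto

lemma ratio: "(cmod (h 1 1 / h 2 1))\<^sup>2 = P powr (1 - \<alpha>)" "(cmod (h 2 2 / h 1 2))\<^sup>2 = P powr (1 - \<alpha>)"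
  using P h by (auto simp: norm_divide power_divide powr_diff)

lemma P_powr_a: "P powr \<alpha> \<ge> 1" using P a0 by (simp add: ge_one_powr_ge_zero)

context
  fixes n R0 R1 R2 f1 f2 g1 g2
  assumes v: "valid_code n R0 R1 R2 f1 f2 g1 g2" and R: "R0 \<ge> 0" "R1 \<ge> 0" "R2 \<ge> 0"
    and e: "perr h n R0 R1 R2 f1 f2 g1 g2 \<le> 1 / 4"
begin

lemma g_meas: "g1 \<in> outsp n \<rightarrow>\<^sub>M count_space UNIV" "g2 \<in> outsp n \<rightarrow>\<^sub>M count_space UNIV"
  using v by (auto simp: valid_code_def)

text \<open>The success probabilities over low-power messages add up to at least half the number of
  message triples, so an upper bound on the sum limits that number.\<close>

lemma success_le:
  assumes "(\<Sum>m0\<in>{1..nmsg n R0}. \<Sum>m1\<in>lowpow n (nmsg n R1) f1 m0. \<Sum>m2\<in>lowpow n (nmsg n R2) f2 m0.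
       gprob {1..n} (decs n g1 (m0, m1)) (\<lambda>t. h 1 1 * f1 m0 m1 t + h 1 2 * f2 m0 m2 t) *
       gprob {1..n} (decs n g2 (m0, m2)) (\<lambda>t. h 2 1 * f1 m0 m1 t + h 2 2 * f2 m0 m2 t)) \<le> ennreal B"
    and "B \<ge> 0"
  shows "real (nmsg n R0) * real (nmsg n R1) * real (nmsg n R2) \<le> 2 * B"
proof -
  let ?S = "\<Sum>m0\<in>{1..nmsg n R0}. \<Sum>m1\<in>lowpow n (nmsg n R1) f1 m0. \<Sum>m2\<in>lowpow n (nmsg n R2) f2 m0.
       succ_prob h n f1 f2 g1 g2 m0 m1 m2"
  have "ennreal ?S \<le> ennreal B"
    using assms(1) by (simp add: ennreal_succ_prob[OF v, symmetric] succ_prob_bounds sum_nonneg)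
  then have "?S \<le> B" using assms(2) by simp
  then show ?thesis using success_low_power[OF v R e] by linarith
qed

lemma nmsg_pos: "real (nmsg n R0) \<ge> 1" "real (nmsg n R1) \<ge> 1" "real (nmsg n R2) \<ge> 1"
  using nmsg_ge_1 R by (metis of_nat_1 of_nat_mono)+

text \<open>Receiver 2 is dropped by bounding its factor by 1. For fixed \<open>m0\<close> and
  \<open>m2\<close> the interference is a constant shift, and \<open>m1\<close> ranges over one
  packing.\<close>

lemma single_rate_code: "real (nmsg n R1) \<le> 2 * (64 * P) ^ n"
proof -
  let ?g1 = "\<lambda>m0 m1 m2. gprob {1..n} (decs n g1 (m0, m1)) (\<lambda>t. h 1 1 * f1 m0 m1 t + h 1 2 * f2 m0 m2 t)"
  let ?g2 = "\<lambda>m0 m1 m2. gprob {1..n} (decs n g2 (m0, m2)) (\<lambda>t. h 2 1 * f1 m0 m1 t + h 2 2 * f2 m0 m2 t)"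
  let ?N0 = "real (nmsg n R0)" and ?N2 = "real (nmsg n R2)"
  have "(\<Sum>m0\<in>{1..nmsg n R0}. \<Sum>m1\<in>lowpow n (nmsg n R1) f1 m0. \<Sum>m2\<in>lowpow n (nmsg n R2) f2 m0.
       ?g1 m0 m1 m2 * ?g2 m0 m1 m2)
     \<le> (\<Sum>m0\<in>{1..nmsg n R0}. \<Sum>m2\<in>lowpow n (nmsg n R2) f2 m0. \<Sum>m1\<in>lowpow n (nmsg n R1) f1 m0. ?g1 m0 m1 m2)"
  proof (intro sum_mono, subst sum.swap, intro sum_mono)
    fix m0 m1 m2
    have "?g2 m0 m1 m2 \<le> 1" by (intro gprob_le_1 decs_sets g_meas) simp
    then show "?g1 m0 m1 m2 * ?g2 m0 m1 m2 \<le> ?g1 m0 m1 m2"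
      using mult_left_mono[of "?g2 m0 m1 m2" 1 "?g1 m0 m1 m2"] by simp
  qed
  also have "\<dots> \<le> (\<Sum>m0\<in>{1..nmsg n R0}. \<Sum>m2\<in>lowpow n (nmsg n R2) f2 m0. ennreal ((64 * P) ^ n))"
  proof (intro sum_mono)
    fix m0 m2
    have "(\<Sum>m1\<in>lowpow n (nmsg n R1) f1 m0. gprob {1..n} (decs n g1 (m0, m1)) (\<lambda>t. h 1 1 * f1 m0 m1 t + h 1 2 * f2 m0 m2 t))
      \<le> ennreal ((8 * (8 * P)) ^ card {1..n})"
    proof (rule single_user_packing)
      fix m assume "m \<in> lowpow n (nmsg n R1) f1 m0"
      then have "sqn {1..n} (f1 m0 m) \<le> 8 * real n" by (simp add: lowpow_def)
      then show "sqn {1..n} (\<lambda>t. h 1 1 * f1 m0 m t) \<le> 8 * P * real (card {1..n})"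
        unfolding sqn_scale h using P by simp
    qed (use P in \<open>auto intro!: disjoint_decs decs_sets g_meas simp: inj_on_def\<close>)
    then show "(\<Sum>m1\<in>lowpow n (nmsg n R1) f1 m0. ?g1 m0 m1 m2) \<le> ennreal ((64 * P) ^ n)" by simp
  qed
  also have "\<dots> \<le> (\<Sum>m0\<in>{1..nmsg n R0}. \<Sum>m2\<in>{1..nmsg n R2}. ennreal ((64 * P) ^ n))"
    by (intro sum_mono sum_mono2) (auto simp: lowpow_def)
  also have "\<dots> = ennreal (?N0 * ?N2 * (64 * P) ^ n)"
    using P by (simp add: ennreal_mult' ennreal_of_nat_eq_real_of_nat mult_ac)
  finally have "?N0 * real (nmsg n R1) * ?N2 \<le> 2 * (?N0 * ?N2 * (64 * P) ^ n)"
    by (rule success_le) (use P in auto)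
  then have "(?N0 * ?N2) * real (nmsg n R1) \<le> (?N0 * ?N2) * (2 * (64 * P) ^ n)" by (simp add: mult_ac)
  then show ?thesis using nmsg_pos by simp
qed

lemma sum_rate_code:
  "real (nmsg n R0) * real (nmsg n R1) * real (nmsg n R2) \<le> 2 * (256 * (P + P powr \<alpha>) * (1 + P powr (1 - \<alpha>))) ^ n"
proof -
  have "(\<Sum>m0\<in>{1..nmsg n R0}. \<Sum>m1\<in>lowpow n (nmsg n R1) f1 m0. \<Sum>m2\<in>lowpow n (nmsg n R2) f2 m0.
       gprob {1..n} (decs n g1 (m0, m1)) (\<lambda>t. h 1 1 * f1 m0 m1 t + h 1 2 * f2 m0 m2 t) *
       gprob {1..n} (decs n g2 (m0, m2)) (\<lambda>t. h 2 1 * f1 m0 m1 t + h 2 2 * f2 m0 m2 t))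
     \<le> ennreal ((16 * (16 * (P + P powr \<alpha>)) * (1 + (cmod (h 2 2 / h 1 2))\<^sup>2)) ^ card {1..n})"
  proof (rule sum_rate_packing)
    show "disjoint_family_on (\<lambda>(m0, m1). decs n g1 (m0, m1)) (SIGMA m0:{1..nmsg n R0}. lowpow n (nmsg n R1) f1 m0)"
      using disjoint_decs[of "\<lambda>x. x" _ n g1] by (simp add: split_beta)
    show "disjoint_family_on (\<lambda>m. decs n g2 (m0, m)) (lowpow n (nmsg n R2) f2 m0)" for m0
      by (rule disjoint_decs) (auto simp: inj_on_def)
    show "16 * (P + P powr \<alpha>) \<ge> 1" using P P_powr_a by simp
    fix m0 m1 m2 assume m: "m1 \<in> lowpow n (nmsg n R1) f1 m0" "m2 \<in> lowpow n (nmsg n R2) f2 m0"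
    \<comment> \<open>Adding two signals costs a factor 2 in energy, which turns the 8 of
      \<open>lowpow\<close> into 16.\<close>
    have "sqn {1..n} (\<lambda>t. h 1 1 * f1 m0 m1 t - (- h 1 2 * f2 m0 m2 t)) / (1 + 1)
       \<le> sqn {1..n} (\<lambda>t. h 1 1 * f1 m0 m1 t) / 1 + sqn {1..n} (\<lambda>t. - h 1 2 * f2 m0 m2 t) / 1"
      by (rule sqn_diff_weighted) auto
    also have "\<dots> = P * sqn {1..n} (f1 m0 m1) + P powr \<alpha> * sqn {1..n} (f2 m0 m2)"
      unfolding sqn_scale by (simp add: h)
    also have "\<dots> \<le> P * (8 * real n) + P powr \<alpha> * (8 * real n)"
      using m P by (intro add_mono mult_left_mono) (auto simp: lowpow_def)
    finally show "sqn {1..n} (\<lambda>t. h 1 1 * f1 m0 m1 t + h 1 2 * f2 m0 m2 t) \<le> 16 * (P + P powr \<alpha>) * real (card {1..n})"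
      by (simp add: algebra_simps)
  qed (auto intro!: decs_sets g_meas simp: h_nz)
  then have "real (nmsg n R0) * real (nmsg n R1) * real (nmsg n R2)
     \<le> 2 * (16 * (16 * (P + P powr \<alpha>)) * (1 + (cmod (h 2 2 / h 1 2))\<^sup>2)) ^ card {1..n}"
    by (rule success_le) (use P P_powr_a in auto)
  then show ?thesis by (simp only: ratio card_atLeastAtMost) (simp add: mult.assoc[symmetric])
qed

text \<open>The genie argument runs for each common message separately. Its bound contains the
  square root of the number of individual message pairs; cancelling it leaves a bound on that square
  root, which is then squared.\<close>

lemma genie_code:
  "real (nmsg n R1) * real (nmsg n R2) \<le> 16 * (4 * (32 * P powr \<alpha> + P powr (1 - \<alpha>))) ^ (2 * n)"
proof -
  let ?N0 = "real (nmsg n R0)" and ?N1 = "real (nmsg n R1)" and ?N2 = "real (nmsg n R2)"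
  define K where "K = 4 * (4 * (8 * P powr \<alpha>) + P powr (1 - \<alpha>))"
  have K: "K \<ge> 0" using P by (simp add: K_def)
  have "(\<Sum>m0\<in>{1..nmsg n R0}. \<Sum>m1\<in>lowpow n (nmsg n R1) f1 m0. \<Sum>m2\<in>lowpow n (nmsg n R2) f2 m0.
       gprob {1..n} (decs n g1 (m0, m1)) (\<lambda>t. h 1 1 * f1 m0 m1 t + h 1 2 * f2 m0 m2 t) *
       gprob {1..n} (decs n g2 (m0, m2)) (\<lambda>t. h 2 1 * f1 m0 m1 t + h 2 2 * f2 m0 m2 t))
     \<le> (\<Sum>m0\<in>{1..nmsg n R0}. ennreal (2 * sqrt (?N1 * ?N2) * K ^ card {1..n}))"
    unfolding K_def
  proof (intro sum_mono genie_packing)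
    fix m0 m
    show "8 * P powr \<alpha> \<ge> 1" using P_powr_a by simp
    show "sqn {1..n} (\<lambda>t. h 2 1 * f1 m0 m t) \<le> 8 * P powr \<alpha> * real (card {1..n})" if "m \<in> lowpow n (nmsg n R1) f1 m0"
      using that mult_left_mono[of "sqn {1..n} (f1 m0 m)" "8 * real n" "P powr \<alpha>"]
      unfolding sqn_scale h by (simp add: lowpow_def mult_ac)
    show "sqn {1..n} (\<lambda>t. h 1 2 * f2 m0 m t) \<le> 8 * P powr \<alpha> * real (card {1..n})" if "m \<in> lowpow n (nmsg n R2) f2 m0"
      using that mult_left_mono[of "sqn {1..n} (f2 m0 m)" "8 * real n" "P powr \<alpha>"]
      unfolding sqn_scale h by (simp add: lowpow_def mult_ac)
    have "card (lowpow n N f m0) \<le> N" for N f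
    proof -
      have "lowpow n N f m0 \<subseteq> {1..N}" by (auto simp: lowpow_def)
      from card_mono[OF _ this] show ?thesis by simp
    qed
    then show "real (card (lowpow n (nmsg n R1) f1 m0)) \<le> ?N1" "real (card (lowpow n (nmsg n R2) f2 m0)) \<le> ?N2" by auto
  qed (use nmsg_pos in \<open>auto intro!: decs_sets g_meas disjoint_decs simp: h_nz inj_on_def ratio\<close>)
  also have "\<dots> = ennreal (?N0 * (2 * sqrt (?N1 * ?N2) * K ^ n))"
    using K by (simp add: ennreal_mult' ennreal_of_nat_eq_real_of_nat mult_ac)
  finally have "?N0 * ?N1 * ?N2 \<le> 2 * (?N0 * (2 * sqrt (?N1 * ?N2) * K ^ n))"
    by (rule success_le) (use K in auto)
  then have "?N0 * (?N1 * ?N2) \<le> ?N0 * (4 * sqrt (?N1 * ?N2) * K ^ n)" by (simp add: mult_ac)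
  then have "?N1 * ?N2 \<le> 4 * sqrt (?N1 * ?N2) * K ^ n" using nmsg_pos by simp
  moreover define s where "s = sqrt (?N1 * ?N2)"
  have s: "s * s = ?N1 * ?N2" "s > 0" using nmsg_pos by (auto simp: s_def)
  ultimately have "s * s \<le> s * (4 * K ^ n)" by (simp add: s_def[symmetric] mult_ac)
  then have "s \<le> 4 * K ^ n" using s(2) mult_le_cancel_left_pos by blast
  then have "s * s \<le> (4 * K ^ n) * (4 * K ^ n)" using s K by (intro mult_mono) auto
  also have "\<dots> = 16 * K ^ (2 * n)" by (simp add: power_mult power2_eq_square power_mult_distrib)
  finally show ?thesis using s by (simp add: K_def)
qed

end

lemma rate_le_of_growth:
  fixes R B C :: real
  assumes ev: "\<forall>\<^sub>F n in sequentially. 2 powr (real n * R) \<le> C * B ^ n" and B: "B > 0" and C: "C > 0"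
  shows "R \<le> log 2 B"
proof -
  have "(\<lambda>n. log 2 C / real n + log 2 B) \<longlonglongrightarrow> 0 + log 2 B"
    by (intro tendsto_add tendsto_const lim_const_over_n)
  moreover have "\<forall>\<^sub>F n in sequentially. R \<le> log 2 C / real n + log 2 B"
    using ev eventually_gt_at_top[of 0]
  proof eventually_elim
    case (elim n)
    have "log 2 (2 powr (real n * R)) \<le> log 2 (C * B ^ n)"
      using elim B C by (subst log_le_cancel_iff) auto
    then have "real n * R \<le> log 2 C + real n * log 2 B"
      using B C by (simp add: log_mult log_nat_power)
    then show ?case using elim by (simp add: field_simps)
  qed
  ultimately show ?thesis
    using tendsto_lowerbound[of "\<lambda>n. log 2 C / real n + log 2 B" "0 + log 2 B" sequentially R] by simp
qed

lemma achievable_bounds: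
  assumes "(R0, R1, R2) \<in> achievable h"
  shows "R1 \<le> log 2 (64 * P)"
    and "R0 + R1 + R2 \<le> log 2 (256 * (P + P powr \<alpha>) * (1 + P powr (1 - \<alpha>)))"
    and "R1 + R2 \<le> 2 * log 2 (4 * (32 * P powr \<alpha> + P powr (1 - \<alpha>)))"
proof -
  obtain F1 F2 G1 G2 where R: "R0 \<ge> 0" "R1 \<ge> 0" "R2 \<ge> 0"
    and v: "\<And>n. n \<ge> 1 \<Longrightarrow> valid_code n R0 R1 R2 (F1 n) (F2 n) (G1 n) (G2 n)"
    and lim: "(\<lambda>n. perr h n R0 R1 R2 (F1 n) (F2 n) (G1 n) (G2 n)) \<longlonglongrightarrow> 0"
    using assms unfolding achievable_def by blast
  have ev: "\<forall>\<^sub>F n in sequentially. n \<ge> 1 \<and> perr h n R0 R1 R2 (F1 n) (F2 n) (G1 n) (G2 n) \<le> 1 / 4"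
    using eventually_conj[OF eventually_ge_at_top[of 1] order_tendstoD(2)[OF lim, of "1/4"]]
    by (auto elim!: eventually_mono)
  have pa: "P powr \<alpha> > 0" "P powr (1 - \<alpha>) > 0" using P by auto
  have pb: "256 * (P + P powr \<alpha>) * (1 + P powr (1 - \<alpha>)) > 0"
    using P pa by (intro mult_pos_pos add_pos_pos) auto
  show "R1 \<le> log 2 (64 * P)"
  proof (rule rate_le_of_growth[where C = 2])
    show "\<forall>\<^sub>F n in sequentially. 2 powr (real n * R1) \<le> 2 * (64 * P) ^ n"
      using ev
    proof eventually_elim
      case (elim n)
      then show ?case using single_rate_code[OF v[of n] R] nmsg_ge[of n R1] by fastforce
    qed
  qed (use P in auto)
  show "R0 + R1 + R2 \<le> log 2 (256 * (P + P powr \<alpha>) * (1 + P powr (1 - \<alpha>)))"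
  proof (rule rate_le_of_growth[where C = 2])
    show "\<forall>\<^sub>F n in sequentially. 2 powr (real n * (R0 + R1 + R2)) \<le> 2 * (256 * (P + P powr \<alpha>) * (1 + P powr (1 - \<alpha>))) ^ n"
      using ev
    proof eventually_elim
      case (elim n)
      have "2 powr (real n * (R0 + R1 + R2)) = 2 powr (real n * R0) * 2 powr (real n * R1) * 2 powr (real n * R2)"
        by (simp add: powr_add[symmetric] algebra_simps)
      also have "\<dots> \<le> real (nmsg n R0) * real (nmsg n R1) * real (nmsg n R2)"
        by (intro mult_mono nmsg_ge) auto
      also have "\<dots> \<le> 2 * (256 * (P + P powr \<alpha>) * (1 + P powr (1 - \<alpha>))) ^ n"
        using sum_rate_code[OF v[of n] R] elim by blast
      finally show ?case .
    qed
  qed (use pb in auto)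
  have pc: "4 * (32 * P powr \<alpha> + P powr (1 - \<alpha>)) > 0" using pa by (intro mult_pos_pos add_pos_pos) auto
  have "R1 + R2 \<le> log 2 ((4 * (32 * P powr \<alpha> + P powr (1 - \<alpha>)))\<^sup>2)"
  proof (rule rate_le_of_growth[where C = 16])
    show "\<forall>\<^sub>F n in sequentially. 2 powr (real n * (R1 + R2)) \<le> 16 * ((4 * (32 * P powr \<alpha> + P powr (1 - \<alpha>)))\<^sup>2) ^ n"
      using ev
    proof eventually_elim
      case (elim n)
      have "2 powr (real n * (R1 + R2)) = 2 powr (real n * R1) * 2 powr (real n * R2)"
        by (simp add: powr_add[symmetric] algebra_simps)
      also have "\<dots> \<le> real (nmsg n R1) * real (nmsg n R2)"
        by (intro mult_mono nmsg_ge) auto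
      also have "\<dots> \<le> 16 * (4 * (32 * P powr \<alpha> + P powr (1 - \<alpha>))) ^ (2 * n)"
        using genie_code[OF v[of n] R] elim by blast
      finally show ?case by (simp only: power_mult)
    qed
  qed (use pc in \<open>simp_all del: distrib_left_numeral\<close>)
  then show "R1 + R2 \<le> 2 * log 2 (4 * (32 * P powr \<alpha> + P powr (1 - \<alpha>)))"
    using pc by (subst (asm) log_nat_power) auto
qed

text \<open>The three bounds cut out closed half-spaces, so they extend from the achievable set to
  its closure.\<close>

lemma capacity_bounds:
  assumes "(R0, R1, R2) \<in> capacity_region h"
  shows "R1 \<le> log 2 (64 * P)"
    and "R0 + R1 + R2 \<le> log 2 (256 * (P + P powr \<alpha>) * (1 + P powr (1 - \<alpha>)))"
    and "R1 + R2 \<le> 2 * log 2 (4 * (32 * P powr \<alpha> + P powr (1 - \<alpha>)))"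
proof -
  let ?S = "{x :: real \<times> real \<times> real. fst (snd x) \<le> log 2 (64 * P)} \<inter>
    {x. fst x + fst (snd x) + snd (snd x) \<le> log 2 (256 * (P + P powr \<alpha>) * (1 + P powr (1 - \<alpha>)))} \<inter>
    {x. fst (snd x) + snd (snd x) \<le> 2 * log 2 (4 * (32 * P powr \<alpha> + P powr (1 - \<alpha>)))}"
  have "closed ?S" by (intro closed_Int closed_Collect_le continuous_intros)
  moreover have "achievable h \<subseteq> ?S" using achievable_bounds by auto
  ultimately have "capacity_region h \<subseteq> ?S" unfolding capacity_region_def by (rule closure_minimal[rotated])
  with assms show "R1 \<le> log 2 (64 * P)"
    and "R0 + R1 + R2 \<le> log 2 (256 * (P + P powr \<alpha>) * (1 + P powr (1 - \<alpha>)))"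
    and "R1 + R2 \<le> 2 * log 2 (4 * (32 * P powr \<alpha> + P powr (1 - \<alpha>)))" by auto
qed

end

section \<open>Passing to large P\<close>

lemma log_ratio_limit: "((\<lambda>P. C / log 2 P + k) \<longlongrightarrow> k) at_top" for C k :: real
proof -
  have "filterlim (\<lambda>P. log 2 P) at_top (at_top :: real filter)"
  proof (subst filterlim_cong[OF refl refl, where g = "\<lambda>P. 1 / ln 2 * ln P"])
    show "filterlim (\<lambda>P::real. 1 / ln 2 * ln P) at_top at_top"
      by (rule filterlim_tendsto_pos_mult_at_top[OF tendsto_const _ ln_at_top]) simp
  qed (simp add: log_def)
  then have "((\<lambda>P. C / log 2 P) \<longlongrightarrow> 0) at_top"
    by (intro tendsto_divide_0[OF tendsto_const] filterlim_at_top_imp_at_infinity)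
  from tendsto_add[OF this tendsto_const[of k]] show ?thesis by simp
qed

lemma gdof_limit_le:
  assumes lim: "((\<lambda>P. r P / log 2 P) \<longlongrightarrow> d) at_top"
    and le: "\<And>P. P \<ge> 2 \<Longrightarrow> r P \<le> C + k * log 2 P"
  shows "d \<le> k"
proof (rule tendsto_le[OF _ log_ratio_limit lim])
  show "\<forall>\<^sub>F P in at_top. r P / log 2 P \<le> C / log 2 P + k"
    using eventually_ge_at_top[of 2]
  proof eventually_elim
    case (elim P)
    then have "log 2 P > 0" by simp
    then show ?case using le[OF elim] by (simp add: field_simps)
  qed
qed simp

text \<open>A member of the region must be attained for every channel with the prescribed
  magnitudes, so it is enough to test one with real coefficients.\<close>

lemma gdof_outer_bounds:
  assumes a: "\<alpha> \<ge> 0" and d: "(d0, d1, d2) \<in> gdof_region (alpha_sym \<alpha>)"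
  shows "d1 \<le> 1" "d0 + d1 + d2 \<le> max (2 - \<alpha>) \<alpha>" "d1 + d2 \<le> 2 * max \<alpha> (1 - \<alpha>)"
proof -
  define H :: "real \<Rightarrow> chan" where "H P i j = complex_of_real (P powr (alpha_sym \<alpha> i j / 2))" for P i j
  have H: "(cmod (H P i j))\<^sup>2 = P powr alpha_sym \<alpha> i j" for P i j
    by (simp add: H_def power2_eq_square powr_add[symmetric])
  then obtain R where R: "\<And>P. P > 0 \<Longrightarrow> R P \<in> capacity_region (H P)"
    and lim: "((\<lambda>P. fst (R P) / log 2 P) \<longlongrightarrow> d0) at_top"
      "((\<lambda>P. fst (snd (R P)) / log 2 P) \<longlongrightarrow> d1) at_top"
      "((\<lambda>P. snd (snd (R P)) / log 2 P) \<longlongrightarrow> d2) at_top"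
    using d unfolding gdof_region_def by blast
  have sc: "sym_channel (H P) P \<alpha>" if "P \<ge> 1" for P
    by standard (use that a H in \<open>simp_all add: alpha_sym_def\<close>)
  have inC: "(fst (R P), fst (snd (R P)), snd (snd (R P))) \<in> capacity_region (H P)" if "P \<ge> 1" for P
    using R[of P] that by simp
  note bnd = sym_channel.capacity_bounds[OF sc inC]
  show "d1 \<le> 1"
  proof (rule gdof_limit_le[OF lim(2), where C = "log 2 64"])
    fix P :: real assume P: "P \<ge> 2"
    then have "fst (snd (R P)) \<le> log 2 (64 * P)" by (intro bnd(1)) (use P in auto)
    also have "\<dots> = log 2 64 + 1 * log 2 P" using P by (simp add: log_mult)
    finally show "fst (snd (R P)) \<le> log 2 64 + 1 * log 2 P" .
  qed
  show "d0 + d1 + d2 \<le> max (2 - \<alpha>) \<alpha>"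
  proof (rule gdof_limit_le[where C = "log 2 1024"])
    show "((\<lambda>P. (fst (R P) + fst (snd (R P)) + snd (snd (R P))) / log 2 P) \<longlongrightarrow> d0 + d1 + d2) at_top"
      using tendsto_add[OF tendsto_add[OF lim(1,2)] lim(3)] by (simp add: add_divide_distrib)
    fix P :: real assume P: "P \<ge> 2"
    \<comment> \<open>Exponents of the two factors of the sum-rate bound; they add up to
      \<open>max (2 - \<alpha>) \<alpha>\<close>. Each factor is at most twice its larger power,
      hence 1024 = 256 * 2 * 2.\<close>
    define m k where "m = max 1 \<alpha>" and "k = max 0 (1 - \<alpha>)"
    have p: "P powr 1 \<le> P powr m" "P powr \<alpha> \<le> P powr m" "P powr 0 \<le> P powr k" "P powr (1 - \<alpha>) \<le> P powr k"
      unfolding m_def k_def by (intro powr_mono; use P in simp)+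
    have "P powr 1 = P" "P powr 0 = 1" using P by auto
    then have q: "P + P powr \<alpha> \<le> 2 * P powr m" "1 + P powr (1 - \<alpha>) \<le> 2 * P powr k"
      using p by linarith+
    have "fst (R P) + fst (snd (R P)) + snd (snd (R P)) \<le> log 2 (256 * (P + P powr \<alpha>) * (1 + P powr (1 - \<alpha>)))"
      by (intro bnd(2)) (use P in auto)
    also have "\<dots> \<le> log 2 (256 * (2 * P powr m) * (2 * P powr k))"
    proof (subst log_le_cancel_iff)
      show "256 * (P + P powr \<alpha>) * (1 + P powr (1 - \<alpha>)) \<le> 256 * (2 * P powr m) * (2 * P powr k)"
        using q P by (intro mult_mono) auto
      show "0 < 256 * (P + P powr \<alpha>) * (1 + P powr (1 - \<alpha>))"
        using P by (intro mult_pos_pos add_pos_pos) auto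
    qed (use P in auto)
    also have "256 * (2 * P powr m) * (2 * P powr k) = 1024 * P powr (m + k)" by (simp add: powr_add)
    also have "log 2 \<dots> = log 2 1024 + (m + k) * log 2 P" using P by (simp add: log_mult log_powr)
    also have "m + k = max (2 - \<alpha>) \<alpha>" by (simp add: m_def k_def)
    finally show "fst (R P) + fst (snd (R P)) + snd (snd (R P)) \<le> log 2 1024 + max (2 - \<alpha>) \<alpha> * log 2 P" .
  qed
  show "d1 + d2 \<le> 2 * max \<alpha> (1 - \<alpha>)"
  proof (rule gdof_limit_le[where C = "2 * log 2 132"])
    show "((\<lambda>P. (fst (snd (R P)) + snd (snd (R P))) / log 2 P) \<longlongrightarrow> d1 + d2) at_top"
      using tendsto_add[OF lim(2,3)] by (simp add: add_divide_distrib)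
    fix P :: real assume P: "P \<ge> 2"
    define m where "m = max \<alpha> (1 - \<alpha>)"
    have p: "P powr \<alpha> \<le> P powr m" "P powr (1 - \<alpha>) \<le> P powr m"
      unfolding m_def by (intro powr_mono; use P in simp)+
    have gen: "4 * (32 * A + B) \<le> 132 * M" if "A \<le> M" "B \<le> M" for A B M :: real
      using that by (simp add: algebra_simps)
    have "fst (snd (R P)) + snd (snd (R P)) \<le> 2 * log 2 (4 * (32 * P powr \<alpha> + P powr (1 - \<alpha>)))"
      by (intro bnd(3)) (use P in auto)
    also have "\<dots> \<le> 2 * log 2 (132 * P powr m)"
    proof (intro mult_left_mono, subst log_le_cancel_iff)
      show "0 < 4 * (32 * P powr \<alpha> + P powr (1 - \<alpha>))"
        using P by (intro mult_pos_pos add_pos_pos) auto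
        show "4 * (32 * P powr \<alpha> + P powr (1 - \<alpha>)) \<le> 132 * P powr m" by (rule gen[OF p])
    qed (use P in auto)
    also have "\<dots> = 2 * log 2 132 + 2 * m * log 2 P" using P by (simp add: log_mult log_powr algebra_simps)
    finally show "fst (snd (R P)) + snd (snd (R P)) \<le> 2 * log 2 132 + 2 * max \<alpha> (1 - \<alpha>) * log 2 P"
      by (simp add: m_def)
  qed
qed

section \<open>Layered codes\<close>

lemma nmsg_zero [simp]: "nmsg n 0 = 1"
  by (simp add: nmsg_def)

lemma nmsg_le: "R \<ge> 0 \<Longrightarrow> real (nmsg n R) \<le> 2 * 2 powr (real n * R)"
proof -
  assume "R \<ge> 0"
  then have "2 powr (real n * R) \<ge> 1" by (simp add: ge_one_powr_ge_zero)
  then show ?thesis unfolding nmsg_def by linarith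
qed

text \<open>For rate splitting: despite the rounding in \<open>nmsg\<close>, there are enough pairs
  of layer indices to represent every message of rate \<open>R + R'\<close>.\<close>

lemma nmsg_add_le:
  assumes "R \<ge> 0" "R' \<ge> 0"
  shows "nmsg n (R + R') \<le> nmsg n R * nmsg n R'"
proof -
  have "2 powr (real n * (R + R')) = 2 powr (real n * R) * 2 powr (real n * R')"
    by (simp add: powr_add[symmetric] algebra_simps)
  also have "\<dots> \<le> real (nmsg n R) * real (nmsg n R')"
    by (intro mult_mono nmsg_ge) auto
  finally have "2 powr (real n * (R + R')) \<le> real_of_int (int (nmsg n R * nmsg n R'))" by simp
  then have "\<lceil>2 powr (real n * (R + R'))\<rceil> \<le> int (nmsg n R * nmsg n R')" by (simp only: ceiling_le_iff)
  then show ?thesis unfolding nmsg_def[of n "R + R'"] by (simp only: nat_le_iff)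
qed

text \<open>\<open>(exp 2 * 576) \<le> 2 ^ 13\<close> is absorbed by the gap of 14 bits, leaving a factor \<open>1 / 2\<close> per symbol.\<close>

lemma union_bound_decay:
  assumes S: "finite S" "card S \<le> 4" and r: "\<And>k. k \<in> S \<Longrightarrow> r k \<ge> 0"
    and g: "g \<ge> 1" and le: "(\<Sum>k\<in>S. r k) + 14 \<le> log 2 (g\<^sup>2)"
  shows "(\<Prod>k\<in>S. real (nmsg n (r k))) * (exp 2 * (576 / g\<^sup>2)) ^ n \<le> 16 * (1 / 2) ^ n"
proof -
  define \<sigma> where "\<sigma> = (\<Sum>k\<in>S. r k)"
  have "(\<Prod>k\<in>S. real (nmsg n (r k))) \<le> (\<Prod>k\<in>S. 2 * 2 powr (real n * r k))"
    using r by (intro prod_mono conjI nmsg_le) auto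
  also have "\<dots> = 2 ^ card S * 2 powr (real n * \<sigma>)"
    using S by (simp add: prod.distrib \<sigma>_def sum_distrib_left powr_sum)
  \<comment> \<open>Rounding message counts up costs at most a factor 2 per layer, hence the
    16.\<close>
  also have "\<dots> \<le> 2 ^ 4 * 2 powr (real n * \<sigma>)"
    using S by (intro mult_right_mono power_increasing) auto
  also have "2 powr (real n * \<sigma>) = (2 powr \<sigma>) ^ n"
    by (simp add: powr_powr[symmetric] powr_realpow[symmetric] mult.commute)
  finally have A: "(\<Prod>k\<in>S. real (nmsg n (r k))) \<le> 16 * (2 powr \<sigma>) ^ n" by simp
  have "2 powr (\<sigma> + 14) \<le> 2 powr (log 2 (g\<^sup>2))" using le by (simp add: \<sigma>_def)
  then have B: "2 powr \<sigma> * 2 ^ 14 \<le> g\<^sup>2" using g by (simp add: powr_add)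
  have e2: "exp 2 \<le> (9 :: real)"
  proof -
    have "exp 2 = exp 1 * exp (1 :: real)" by (simp add: exp_add[symmetric])
    also have "\<dots> \<le> 3 * 3" by (intro mult_mono exp_le) auto
    finally show ?thesis by simp
  qed
  have "2 powr \<sigma> * (exp 2 * (576 / g\<^sup>2)) \<le> 2 powr \<sigma> * (9 * (576 / g\<^sup>2))"
    using e2 by (intro mult_left_mono mult_right_mono) auto
  also have "\<dots> = 5184 * (2 powr \<sigma>) / g\<^sup>2" by simp
  also have "\<dots> \<le> 5184 * (g\<^sup>2 / 2 ^ 14) / g\<^sup>2"
    using B by (intro divide_right_mono mult_left_mono) auto
  also have "\<dots> \<le> 1 / 2" using g by simp
  finally have C: "2 powr \<sigma> * (exp 2 * (576 / g\<^sup>2)) \<le> 1 / 2" .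
  have "(\<Prod>k\<in>S. real (nmsg n (r k))) * (exp 2 * (576 / g\<^sup>2)) ^ n
     \<le> 16 * (2 powr \<sigma>) ^ n * (exp 2 * (576 / g\<^sup>2)) ^ n"
    using A by (intro mult_right_mono) auto
  also have "\<dots> = 16 * (2 powr \<sigma> * (exp 2 * (576 / g\<^sup>2))) ^ n" by (simp only: power_mult_distrib mult.assoc)
  also have "\<dots> \<le> 16 * (1 / 2) ^ n"
    using C by (intro mult_left_mono power_mono) auto
  finally show ?thesis .
qed

lemma exists_le_average:
  fixes f :: "'a \<Rightarrow> real"
  assumes "finite A" "A \<noteq> {}" "(\<Sum>x\<in>A. f x) \<le> c * real (card A)"
  shows "\<exists>x\<in>A. f x \<le> c"
proof (rule ccontr)
  assume "\<not> ?thesis"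
  then have "\<And>x. x \<in> A \<Longrightarrow> c < f x" by auto
  then have "(\<Sum>x\<in>A. c) < (\<Sum>x\<in>A. f x)" using assms by (intro sum_strict_mono) auto
  then show False using assms by (simp add: mult.commute)
qed

lemma average_power_le:
  fixes f :: "nat \<Rightarrow> nat \<Rightarrow> nat \<Rightarrow> complex"
  assumes "\<And>m0 m t. m0 \<in> {1..N0} \<Longrightarrow> m \<in> {1..N} \<Longrightarrow> t \<in> {1..n} \<Longrightarrow> cmod (f m0 m t) \<le> 1"
    and N: "N0 \<ge> 1" "N \<ge> 1" "n \<ge> 1"
  shows "(1 / real n) * (\<Sum>t\<in>{1..n}. (\<Sum>m0\<in>{1..N0}. \<Sum>m\<in>{1..N}. (cmod (f m0 m t))\<^sup>2) / (real N0 * real N)) \<le> 1"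
proof -
  have "(\<Sum>t\<in>{1..n}. (\<Sum>m0\<in>{1..N0}. \<Sum>m\<in>{1..N}. (cmod (f m0 m t))\<^sup>2) / (real N0 * real N))
    \<le> (\<Sum>t\<in>{1..n}. (\<Sum>m0\<in>{1..N0}. \<Sum>m\<in>{1..N}. 1) / (real N0 * real N))"
    using assms(1) by (intro sum_mono divide_right_mono) (auto simp: power_le_one)
  also have "\<dots> = real n" using N by simp
  finally show ?thesis using N by simp
qed

text \<open>Layers: 0 is the common message (sent by both users), 1 and 3 are decoded by both receivers,
  2 and 4 are private to receiver 1 and 2. The grid points have modulus at most 2, so a private
  amplitude \<open>b\<close> keeps the undecoded interference below 1.\<close>

definition gain1 :: "chan \<Rightarrow> real \<Rightarrow> nat \<Rightarrow> complex" where
  "gain1 h b k = (if k = 0 then (h 1 1 + h 1 2) / 8 else if k = 1 then h 1 1 / 8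
     else if k = 2 then h 1 1 * of_real b else h 1 2 / 8)"

definition gain2 :: "chan \<Rightarrow> real \<Rightarrow> nat \<Rightarrow> complex" where
  "gain2 h b k = (if k = 0 then (h 2 1 + h 2 2) / 8 else if k = 1 then h 2 1 / 8
     else if k = 4 then h 2 2 * of_real b else h 2 2 / 8)"

text \<open>Resembles the multiple access constraints for the layers in \<open>C\<close>, one for
  each set \<open>S\<close> of wrong layers that touches the wanted set \<open>D\<close>. The
  received power of a single layer of \<open>S\<close> stands in for the total, which costs only a
  constant factor when the strongest is taken. Layers of rate 0 cannot be wrong and are
  exempt.\<close>

definition layer_cond :: "nat set \<Rightarrow> nat set \<Rightarrow> (nat \<Rightarrow> complex) \<Rightarrow> (nat \<Rightarrow> real) \<Rightarrow> bool" where
  "layer_cond C D G r \<longleftrightarrow> (\<forall>S. S \<subseteq> C \<longrightarrow> S \<inter> D \<noteq> {} \<longrightarrow> (\<forall>k\<in>S. r k > 0) \<longrightarrow>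
     (\<exists>k\<in>S. 1 \<le> cmod (G k) \<and> (\<Sum>k\<in>S. r k) + 14 \<le> log 2 ((cmod (G k))\<^sup>2)))"

text \<open>The error bounds of both receivers, summed over all message triples, are averaged over
  codebooks together, so that one codebook serves both receivers. The 512 is 16 * 2 * 16: error
  patterns, receivers, and the constant of \<open>union_bound_decay\<close>.\<close>

lemma layered_code_exists:
  fixes r :: "nat \<Rightarrow> real"
  assumes n: "n \<ge> 1" and r: "\<And>k. r k \<ge> 0" and b: "0 \<le> b" "b \<le> 1 / 8"
    and weak: "cmod (h 1 2) * b \<le> 1 / 2" "cmod (h 2 1) * b \<le> 1 / 2"
    and c1: "layer_cond {0, 1, 2, 3} {0, 1, 2} (gain1 h b) r"
    and c2: "layer_cond {0, 1, 3, 4} {0, 3, 4} (gain2 h b) r"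
  shows "\<exists>f1 f2 g1 g2. valid_code n (r 0) (r 1 + r 2) (r 3 + r 4) f1 f2 g1 g2 \<and>
      perr h n (r 0) (r 1 + r 2) (r 3 + r 4) f1 f2 g1 g2 \<le> 512 * (1 / 2) ^ n"
proof -
  define M where "M k = nmsg n (r k)" for k
  define K where "K = {0, 1, 2, 3, 4 :: nat}"
  define C1 C2 D1 D2 where "C1 = {0, 1, 2, 3 :: nat}" and "C2 = {0, 1, 3, 4 :: nat}"
    and "D1 = {0, 1, 2 :: nat}" and "D2 = {0, 3, 4 :: nat}"
  note CD = C1_def C2_def D1_def D2_def K_def
  define N0 N1 N2 where "N0 = nmsg n (r 0)" and "N1 = nmsg n (r 1 + r 2)" and "N2 = nmsg n (r 3 + r 4)"
  have M1: "M k \<ge> 1" for k using nmsg_ge_1 r by (simp add: M_def)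
  have N: "N0 \<ge> 1" "N1 \<ge> 1" "N2 \<ge> 1" using nmsg_ge_1 r by (auto simp: N0_def N1_def N2_def)
  have NM: "N0 = M 0" "N1 \<le> M 1 * M 2" "N2 \<le> M 3 * M 4"
    using nmsg_add_le r by (auto simp: N0_def N1_def N2_def M_def)
  \<comment> \<open>The grid has to be fine enough for every gain at both receivers; the extra 1
    keeps it nonempty.\<close>
  define q where "q = nat \<lceil>\<Sum>k\<in>K. cmod (gain1 h b k) + cmod (gain2 h b k)\<rceil> + 1"
  have q1: "q \<ge> 1" by (simp add: q_def)
  have qg: "cmod (gain1 h b k) \<le> real q \<and> cmod (gain2 h b k) \<le> real q" if "k \<in> K" for k
  proof -
    have "cmod (gain1 h b k) + cmod (gain2 h b k) \<le> (\<Sum>k\<in>K. cmod (gain1 h b k) + cmod (gain2 h b k))"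
      by (rule member_le_sum[OF that]) (auto simp: K_def)
    then have "cmod (gain1 h b k) + cmod (gain2 h b k) \<le> real q" unfolding q_def by linarith
    then show ?thesis using norm_ge_zero[of "gain1 h b k"] norm_ge_zero[of "gain2 h b k"] by linarith
  qed
  define \<eta> where "\<eta> = 16 * (1 / 2 :: real) ^ n"
  have cond: "\<exists>k\<in>S. 1 \<le> cmod (G k) \<and> cmod (G k) \<le> real q \<and>
        (\<Prod>k\<in>S. real (M k)) * (exp 2 * (576 / (cmod (G k))\<^sup>2)) ^ n \<le> \<eta>"
    if lc: "layer_cond C D G r" and C: "C \<subseteq> K" "card C \<le> 4" and Gq: "\<And>k. k \<in> K \<Longrightarrow> cmod (G k) \<le> real q"
      and S: "S \<subseteq> C" "S \<inter> D \<noteq> {}" "\<And>k. k \<in> S \<Longrightarrow> M k \<ge> 2" for C D G S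
  proof -
    have "r k > 0" if "k \<in> S" for k
      using S(3)[OF that] r[of k] by (cases "r k = 0") (auto simp: M_def)
    then obtain k where k: "k \<in> S" "1 \<le> cmod (G k)" "(\<Sum>k\<in>S. r k) + 14 \<le> log 2 ((cmod (G k))\<^sup>2)"
      using lc S unfolding layer_cond_def by blast
    have "finite C" using C(1) finite_subset[of C K] by (simp add: K_def)
    then have "finite S" "card S \<le> 4" using S(1) C(2) card_mono[of C S] finite_subset by auto
    from union_bound_decay[OF this r k(2,3)] k Gq S C show ?thesis
      unfolding \<eta>_def M_def by blast
  qed
  \<comment> \<open>Messages start at 1 and codeword indices at 0. Each individual message is split
    by \<open>mod\<close> and \<open>div\<close> into a part decoded by both receivers and a private
    part.\<close>
  define u where "u m0 m1 m2 k = (if k = 0 then m0 - 1 else if k = 1 then (m1 - 1) mod M 1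
    else if k = 2 then (m1 - 1) div M 1 else if k = 3 then (m2 - 1) mod M 3 else (m2 - 1) div M 3)"
    for m0 m1 m2 k :: nat
  have u: "u m0 m1 m2 k < M k"
    if m: "m0 \<in> {1..N0}" "m1 \<in> {1..N1}" "m2 \<in> {1..N2}" and k: "k \<in> K" for m0 m1 m2 k
  proof -
    have "m0 - 1 < M 0" using m NM by auto
    moreover have "(m1 - 1) mod M 1 < M 1" "(m2 - 1) mod M 3 < M 3"
      using M1[of 1] M1[of 3] by (auto intro!: mod_less_divisor)
    moreover have "(m1 - 1) div M 1 < M 2"
      by (rule less_mult_imp_div_less) (use m NM in \<open>auto simp: mult.commute\<close>)
    moreover have "(m2 - 1) div M 3 < M 4"
      by (rule less_mult_imp_div_less) (use m NM in \<open>auto simp: mult.commute\<close>)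
    ultimately show ?thesis using k by (auto simp: u_def K_def)
  qed
  define E where "E C D G \<omega> w = (\<Sum>w'\<in>{w'\<in>PiE C (\<lambda>k. {..<M k}). \<exists>k\<in>C \<inter> D. w' k \<noteq> w k}.
      \<Prod>t\<in>{1..n}. exp 2 * exp (- (cmod ((\<Sum>k\<in>C. G k * \<omega> t (k, w k)) - (\<Sum>k\<in>C. G k * \<omega> t (k, w' k))))\<^sup>2 / 8))"
    for C D :: "nat set" and G :: "nat \<Rightarrow> complex" and \<omega> :: "nat \<Rightarrow> nat \<times> nat \<Rightarrow> complex" and w :: "nat \<Rightarrow> nat"
  let ?\<Omega> = "codebooks n q K M"
  define T where "T = real N0 * real N1 * real N2"
  define Z where "Z \<omega> = (\<Sum>m0\<in>{1..N0}. \<Sum>m1\<in>{1..N1}. \<Sum>m2\<in>{1..N2}.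
       E C1 D1 (gain1 h b) \<omega> (u m0 m1 m2) + E C2 D2 (gain2 h b) \<omega> (u m0 m1 m2))" for \<omega>
  have "(\<Sum>\<omega>\<in>?\<Omega>. Z \<omega>) = (\<Sum>m0\<in>{1..N0}. \<Sum>m1\<in>{1..N1}. \<Sum>m2\<in>{1..N2}. \<Sum>\<omega>\<in>?\<Omega>.
       E C1 D1 (gain1 h b) \<omega> (u m0 m1 m2) + E C2 D2 (gain2 h b) \<omega> (u m0 m1 m2))"
    unfolding Z_def by (subst sum.swap, intro sum.cong refl, subst sum.swap, intro sum.cong refl, rule sum.swap)
  also have "\<dots> \<le> (\<Sum>m0\<in>{1..N0}. \<Sum>m1\<in>{1..N1}. \<Sum>m2\<in>{1..N2}. 32 * \<eta> * real (card ?\<Omega>))"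
  proof (intro sum_mono)
    fix m0 m1 m2 assume m: "m0 \<in> {1..N0}" "m1 \<in> {1..N1}" "m2 \<in> {1..N2}"
    have "(\<Sum>\<omega>\<in>?\<Omega>. E C1 D1 (gain1 h b) \<omega> (u m0 m1 m2)) \<le> 2 ^ card C1 * \<eta> * real (card ?\<Omega>)"
      unfolding E_def
    proof (rule codebook_union_bound)
      show "\<exists>k\<in>S. 1 \<le> cmod (gain1 h b k) \<and> cmod (gain1 h b k) \<le> real q \<and>
        (\<Prod>k\<in>S. real (M k)) * (exp 2 * (576 / (cmod (gain1 h b k))\<^sup>2)) ^ n \<le> \<eta>"
        if "S \<subseteq> C1" "S \<inter> D1 \<noteq> {}" "\<And>k. k \<in> S \<Longrightarrow> M k \<ge> 2" for S
        by (rule cond[OF c1[folded C1_def D1_def] _ _ _ that]) (use qg in \<open>auto simp: CD\<close>)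
    qed (use u[OF m] q1 in \<open>auto simp: CD \<eta>_def\<close>)
    moreover have "(\<Sum>\<omega>\<in>?\<Omega>. E C2 D2 (gain2 h b) \<omega> (u m0 m1 m2)) \<le> 2 ^ card C2 * \<eta> * real (card ?\<Omega>)"
      unfolding E_def
    proof (rule codebook_union_bound)
      show "\<exists>k\<in>S. 1 \<le> cmod (gain2 h b k) \<and> cmod (gain2 h b k) \<le> real q \<and>
        (\<Prod>k\<in>S. real (M k)) * (exp 2 * (576 / (cmod (gain2 h b k))\<^sup>2)) ^ n \<le> \<eta>"
        if "S \<subseteq> C2" "S \<inter> D2 \<noteq> {}" "\<And>k. k \<in> S \<Longrightarrow> M k \<ge> 2" for S
        by (rule cond[OF c2[folded C2_def D2_def] _ _ _ that]) (use qg in \<open>auto simp: CD\<close>)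
    qed (use u[OF m] q1 in \<open>auto simp: CD \<eta>_def\<close>)
    moreover have "card C1 = 4" "card C2 = 4" by (simp_all add: CD)
    ultimately show "(\<Sum>\<omega>\<in>?\<Omega>. E C1 D1 (gain1 h b) \<omega> (u m0 m1 m2) + E C2 D2 (gain2 h b) \<omega> (u m0 m1 m2))
       \<le> 32 * \<eta> * real (card ?\<Omega>)" by (simp add: sum.distrib)
  qed
  also have "\<dots> = (T * (32 * \<eta>)) * real (card ?\<Omega>)" by (simp add: T_def)
  finally have avg: "(\<Sum>\<omega>\<in>?\<Omega>. Z \<omega>) \<le> (T * (32 * \<eta>)) * real (card ?\<Omega>)" .
  have finK: "finite K" by (simp add: K_def)
  from exists_le_average[OF finite_codebooks[OF finK] codebooks_nonempty[OF q1] avg]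
  obtain \<omega> where \<omega>: "\<omega> \<in> ?\<Omega>" and Z_le: "Z \<omega> \<le> T * (32 * \<eta>)" by (elim bexE)
  note \<omega>_err = Z_le[unfolded Z_def]
  have \<omega>_norm: "cmod (\<omega> t (k, i)) \<le> 2" if "t \<in> {1..n}" "k \<in> K" "i < M k" for t k i
    using \<omega> that unfolding codebooks_def by (intro grid_norm[of _ q]) (auto simp: PiE_iff)
  define f1 where "f1 m0 m1 t = \<omega> t (0, m0 - 1) / 8 + \<omega> t (1, (m1 - 1) mod M 1) / 8
     + of_real b * \<omega> t (2, (m1 - 1) div M 1)" for m0 m1 t
  define f2 where "f2 m0 m2 t = \<omega> t (0, m0 - 1) / 8 + \<omega> t (3, (m2 - 1) mod M 3) / 8
     + of_real b * \<omega> t (4, (m2 - 1) div M 3)" for m0 m2 t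
  \<comment> \<open>Three layers of amplitude at most 2 / 8 each stay below 1, so the power
    constraint even holds symbol by symbol.\<close>
  have pow: "cmod (x / 8 + y / 8 + of_real b * z) \<le> 1" if "cmod x \<le> 2" "cmod y \<le> 2" "cmod z \<le> 2" for x y z
  proof -
    have "cmod (x / 8 + y / 8 + of_real b * z) \<le> cmod (x / 8) + cmod (y / 8) + cmod (of_real b * z)"
      by (rule order_trans[OF norm_triangle_ineq add_right_mono[OF norm_triangle_ineq]])
    also have "cmod (of_real b * z) \<le> 1 / 8 * 2" unfolding norm_mult using b that by (intro mult_mono) auto
    finally show ?thesis using that by (simp add: norm_divide)
  qed
  have u_eq: "u m0 m1 m2 0 = m0 - 1" "u m0 m1 m2 1 = (m1 - 1) mod M 1" "u m0 m1 m2 2 = (m1 - 1) div M 1"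
    "u m0 m1 m2 3 = (m2 - 1) mod M 3" "u m0 m1 m2 4 = (m2 - 1) div M 3" for m0 m1 m2
    by (simp_all add: u_def)
  \<comment> \<open>Each encoder sees only one individual message; the other argument of
    \<open>u\<close> is filled with the dummy message 1.\<close>
  have "1 \<in> {1..N1}" "1 \<in> {1..N2}" using N by auto
  note u1 = u[OF _ _ this(2)] and u2 = u[OF _ this(1)]
  have f1_norm: "cmod (f1 m0 m1 t) \<le> 1" if "m0 \<in> {1..N0}" "m1 \<in> {1..N1}" "t \<in> {1..n}" for m0 m1 t
    unfolding f1_def using u1[OF that(1,2), of 0] u1[OF that(1,2), of 1] u1[OF that(1,2), of 2]
    unfolding u_eq by (intro pow \<omega>_norm that(3)) (simp_all add: K_def)
  have f2_norm: "cmod (f2 m0 m2 t) \<le> 1" if "m0 \<in> {1..N0}" "m2 \<in> {1..N2}" "t \<in> {1..n}" for m0 m2 t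
    unfolding f2_def using u2[OF that(1,2), of 0] u2[OF that(1,2), of 3] u2[OF that(1,2), of 4]
    unfolding u_eq by (intro pow \<omega>_norm that(3)) (simp_all add: K_def)
  define W where "W C = PiE C (\<lambda>k. {..<M k})" for C :: "nat set"
  have W: "finite (W C)" "W C \<noteq> {}" if "finite C" for C
    using that M1 unfolding W_def by (auto intro!: finite_PiE simp: PiE_eq_empty_iff lessThan_empty_iff Suc_le_eq)
       (metis One_nat_def Suc_le_eq)
  define c1 where "c1 w t = (\<Sum>k\<in>C1. gain1 h b k * \<omega> t (k, w k))" for w :: "nat \<Rightarrow> nat" and t
  define c2 where "c2 w t = (\<Sum>k\<in>C2. gain2 h b k * \<omega> t (k, w k))" for w :: "nat \<Rightarrow> nat" and t
  \<comment> \<open>Inverse of the splitting in \<open>u\<close>. Layer 3 is left out, so an error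
    in it alone is no error for receiver 1; \<open>out2\<close> treats layer 1 likewise.\<close>
  define out1 where "out1 w = (w 0 + 1, w 1 + M 1 * w 2 + 1)" for w :: "nat \<Rightarrow> nat"
  define out2 where "out2 w = (w 0 + 1, w 3 + M 3 * w 4 + 1)" for w :: "nat \<Rightarrow> nat"
  have finC: "finite C1" "finite C2" by (simp_all add: CD)
  from min_distance_decoder[OF W[OF finC(1)], of n out1 c1]
  obtain g1 where g1: "g1 \<in> outsp n \<rightarrow>\<^sub>M count_space UNIV"
    "\<forall>w i. w \<in> W C1 \<longrightarrow> (\<forall>t\<in>{1..n}. cmod (i t) \<le> 1) \<longrightarrow>
       gprob {1..n} (space (LB {1..n}) - decs n g1 (out1 w)) (\<lambda>t. c1 w t + i t)
        \<le> ennreal (\<Sum>w'\<in>{w'\<in>W C1. out1 w' \<noteq> out1 w}. \<Prod>t\<in>{1..n}. exp 2 * exp (- (cmod (c1 w t - c1 w' t))\<^sup>2 / 8))"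
    by (elim exE conjE)
  from min_distance_decoder[OF W[OF finC(2)], of n out2 c2]
  obtain g2 where g2: "g2 \<in> outsp n \<rightarrow>\<^sub>M count_space UNIV"
    "\<forall>w i. w \<in> W C2 \<longrightarrow> (\<forall>t\<in>{1..n}. cmod (i t) \<le> 1) \<longrightarrow>
       gprob {1..n} (space (LB {1..n}) - decs n g2 (out2 w)) (\<lambda>t. c2 w t + i t)
        \<le> ennreal (\<Sum>w'\<in>{w'\<in>W C2. out2 w' \<noteq> out2 w}. \<Prod>t\<in>{1..n}. exp 2 * exp (- (cmod (c2 w t - c2 w' t))\<^sup>2 / 8))"
    by (elim exE conjE)
  have err: "measure (noise n) {z \<in> space (noise n).
           g1 (Y1 h n f1 f2 m0 m1 m2 z) \<noteq> (m0, m1) \<or> g2 (Y2 h n f1 f2 m0 m1 m2 z) \<noteq> (m0, m2)}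
      \<le> E C1 D1 (gain1 h b) \<omega> (u m0 m1 m2) + E C2 D2 (gain2 h b) \<omega> (u m0 m1 m2)"
    if m: "m0 \<in> {1..N0}" "m1 \<in> {1..N1}" "m2 \<in> {1..N2}" for m0 m1 m2
  proof -
    define w1 w2 where "w1 = restrict (u m0 m1 m2) C1" and "w2 = restrict (u m0 m1 m2) C2"
    have w: "w1 \<in> W C1" "w2 \<in> W C2" using u[OF m] by (auto simp: w1_def w2_def W_def CD)
    have ws: "w1 0 = m0 - 1" "w1 1 = (m1 - 1) mod M 1" "w1 2 = (m1 - 1) div M 1"
      "w2 0 = m0 - 1" "w2 3 = (m2 - 1) mod M 3" "w2 4 = (m2 - 1) div M 3"
      unfolding w1_def w2_def CD by (simp_all only: restrict_apply u_eq) simp_all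
    have "m0 - 1 + 1 = m0" "m1 - 1 + 1 = m1" "m2 - 1 + 1 = m2" using m by auto
    then have out: "out1 w1 = (m0, m1)" "out2 w2 = (m0, m2)"
      unfolding out1_def out2_def ws mod_mult_div_eq by simp_all
    have E0: "E C D G \<omega> v \<ge> 0" for C D G v unfolding E_def by (intro sum_nonneg prod_nonneg) auto
    have weak': "cmod (x * of_real b * \<omega> t (k, u m0 m1 m2 k)) \<le> 1"
      if "t \<in> {1..n}" "k \<in> K" "cmod x * b \<le> 1 / 2" for x t k
    proof -
      have "cmod x * b * cmod (\<omega> t (k, u m0 m1 m2 k)) \<le> 1 / 2 * 2"
        using that b \<omega>_norm[OF that(1,2) u[OF m that(2)]] by (intro mult_mono) auto
      then show ?thesis using b by (simp add: norm_mult)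
    qed
    \<comment> \<open>Layer 4 is the only one that receiver 1 does not decode; it stays in the
      signal as bounded interference.\<close>
    have s1: "sig1 h f1 f2 m0 m1 m2 = (\<lambda>t. c1 w1 t + h 1 2 * of_real b * \<omega> t (4, u m0 m1 m2 4))"
      by (auto simp: sig1_def f1_def f2_def c1_def CD w1_def gain1_def u_eq algebra_simps add_divide_distrib)
    have s2: "sig2 h f1 f2 m0 m1 m2 = (\<lambda>t. c2 w2 t + h 2 1 * of_real b * \<omega> t (2, u m0 m1 m2 2))"
      by (auto simp: sig2_def f1_def f2_def c2_def CD w2_def gain2_def u_eq algebra_simps add_divide_distrib)
    have "gprob {1..n} (space (LB {1..n}) - decs n g1 (m0, m1)) (sig1 h f1 f2 m0 m1 m2)
      \<le> ennreal (\<Sum>w'\<in>{w'\<in>W C1. out1 w' \<noteq> out1 w1}. \<Prod>t\<in>{1..n}. exp 2 * exp (- (cmod (c1 w1 t - c1 w' t))\<^sup>2 / 8))"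
      unfolding s1 out(1)[symmetric] by (intro g1(2)[rule_format] w weak' weak) (auto simp: K_def)
    also have "\<dots> \<le> ennreal (E C1 D1 (gain1 h b) \<omega> (u m0 m1 m2))"
    proof (intro ennreal_leI)
      have ce: "c1 w1 = c1 (u m0 m1 m2)"
        by (rule ext) (simp add: c1_def w1_def)
      have "{w'\<in>W C1. out1 w' \<noteq> out1 w1} \<subseteq> {w'\<in>W C1. \<exists>k\<in>C1 \<inter> D1. w' k \<noteq> u m0 m1 m2 k}"
        by (auto simp: out1_def w1_def CD)
      then show "(\<Sum>w'\<in>{w'\<in>W C1. out1 w' \<noteq> out1 w1}. \<Prod>t\<in>{1..n}. exp 2 * exp (- (cmod (c1 w1 t - c1 w' t))\<^sup>2 / 8))
         \<le> E C1 D1 (gain1 h b) \<omega> (u m0 m1 m2)"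
        unfolding E_def W_def[symmetric] c1_def[symmetric] ce using W(1)[OF finC(1)]
        by (intro sum_mono2) (auto intro!: prod_nonneg)
    qed
    finally have e1: "gprob {1..n} (space (LB {1..n}) - decs n g1 (m0, m1)) (sig1 h f1 f2 m0 m1 m2)
       \<le> ennreal (E C1 D1 (gain1 h b) \<omega> (u m0 m1 m2))" .
    have "gprob {1..n} (space (LB {1..n}) - decs n g2 (m0, m2)) (sig2 h f1 f2 m0 m1 m2)
      \<le> ennreal (\<Sum>w'\<in>{w'\<in>W C2. out2 w' \<noteq> out2 w2}. \<Prod>t\<in>{1..n}. exp 2 * exp (- (cmod (c2 w2 t - c2 w' t))\<^sup>2 / 8))"
      unfolding s2 out(2)[symmetric] by (intro g2(2)[rule_format] w weak' weak) (auto simp: K_def)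
    also have "\<dots> \<le> ennreal (E C2 D2 (gain2 h b) \<omega> (u m0 m1 m2))"
    proof (intro ennreal_leI)
      have ce: "c2 w2 = c2 (u m0 m1 m2)"
        by (rule ext) (simp add: c2_def w2_def)
      have "{w'\<in>W C2. out2 w' \<noteq> out2 w2} \<subseteq> {w'\<in>W C2. \<exists>k\<in>C2 \<inter> D2. w' k \<noteq> u m0 m1 m2 k}"
        by (auto simp: out2_def w2_def CD)
      then show "(\<Sum>w'\<in>{w'\<in>W C2. out2 w' \<noteq> out2 w2}. \<Prod>t\<in>{1..n}. exp 2 * exp (- (cmod (c2 w2 t - c2 w' t))\<^sup>2 / 8))
         \<le> E C2 D2 (gain2 h b) \<omega> (u m0 m1 m2)"
        unfolding E_def W_def[symmetric] c2_def[symmetric] ce using W(1)[OF finC(2)]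
        by (intro sum_mono2) (auto intro!: prod_nonneg)
    qed
    finally have e2: "gprob {1..n} (space (LB {1..n}) - decs n g2 (m0, m2)) (sig2 h f1 f2 m0 m1 m2)
       \<le> ennreal (E C2 D2 (gain2 h b) \<omega> (u m0 m1 m2))" .
    have "ennreal (measure (noise n) {z \<in> space (noise n).
           g1 (Y1 h n f1 f2 m0 m1 m2 z) \<noteq> (m0, m1) \<or> g2 (Y2 h n f1 f2 m0 m1 m2 z) \<noteq> (m0, m2)})
      \<le> ennreal (E C1 D1 (gain1 h b) \<omega> (u m0 m1 m2)) + ennreal (E C2 D2 (gain2 h b) \<omega> (u m0 m1 m2))"
      by (rule order_trans[OF error_prob_union[OF g1(1) g2(1)] add_mono[OF e1 e2]])
    then show ?thesis using E0 by (simp add: ennreal_plus[symmetric] del: ennreal_plus)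
  qed
  have "valid_code n (r 0) (r 1 + r 2) (r 3 + r 4) f1 f2 g1 g2"
    unfolding valid_code_def N0_def[symmetric] N1_def[symmetric] N2_def[symmetric]
    by (intro conjI n average_power_le f1_norm f2_norm N g1(1) g2(1))
  moreover have "perr h n (r 0) (r 1 + r 2) (r 3 + r 4) f1 f2 g1 g2 \<le> 512 * (1 / 2) ^ n"
  proof -
    have "perr h n (r 0) (r 1 + r 2) (r 3 + r 4) f1 f2 g1 g2 \<le> (T * (32 * \<eta>)) / T"
      unfolding perr_def N0_def[symmetric] N1_def[symmetric] N2_def[symmetric] T_def[symmetric]
      by (intro divide_right_mono order_trans[OF _ \<omega>_err] sum_mono err) (auto simp: T_def)
    also have "\<dots> = 512 * (1 / 2) ^ n" using N by (simp add: T_def \<eta>_def)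
    finally show ?thesis .
  qed
  ultimately show ?thesis by blast
qed

lemma achievable_layered:
  fixes r :: "nat \<Rightarrow> real"
  assumes r: "\<And>k. r k \<ge> 0" and b: "0 \<le> b" "b \<le> 1 / 8"
    and weak: "cmod (h 1 2) * b \<le> 1 / 2" "cmod (h 2 1) * b \<le> 1 / 2"
    and c1: "layer_cond {0, 1, 2, 3} {0, 1, 2} (gain1 h b) r"
    and c2: "layer_cond {0, 1, 3, 4} {0, 3, 4} (gain2 h b) r"
  shows "(r 0, r 1 + r 2, r 3 + r 4) \<in> achievable h"
proof -
  let ?V = "\<lambda>n f1 f2 g1 g2. valid_code n (r 0) (r 1 + r 2) (r 3 + r 4) f1 f2 g1 g2 \<and>
      perr h n (r 0) (r 1 + r 2) (r 3 + r 4) f1 f2 g1 g2 \<le> 512 * (1 / 2) ^ n"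
  have "\<forall>n. \<exists>c. n \<ge> 1 \<longrightarrow> ?V n (fst c) (fst (snd c)) (fst (snd (snd c))) (snd (snd (snd c)))"
  proof
    fix n
    show "\<exists>c. n \<ge> 1 \<longrightarrow> ?V n (fst c) (fst (snd c)) (fst (snd (snd c))) (snd (snd (snd c)))"
    proof (cases "n \<ge> 1")
      case True
      from layered_code_exists[OF True assms] obtain f1 f2 g1 g2 where "?V n f1 f2 g1 g2" by (elim exE)
      then show ?thesis by (intro exI[of _ "(f1, f2, g1, g2)"]) simp
    qed simp
  qed
  from choice[OF this] obtain c where
    c: "\<forall>n. n \<ge> 1 \<longrightarrow> ?V n (fst (c n)) (fst (snd (c n))) (fst (snd (snd (c n)))) (snd (snd (snd (c n))))" by (elim exE)
  define F1 F2 G1 G2 where "F1 n = fst (c n)" and "F2 n = fst (snd (c n))"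
    and "G1 n = fst (snd (snd (c n)))" and "G2 n = snd (snd (snd (c n)))" for n
  have v: "valid_code n (r 0) (r 1 + r 2) (r 3 + r 4) (F1 n) (F2 n) (G1 n) (G2 n)"
    and p: "perr h n (r 0) (r 1 + r 2) (r 3 + r 4) (F1 n) (F2 n) (G1 n) (G2 n) \<le> 512 * (1 / 2) ^ n"
    if "n \<ge> 1" for n
    using c that by (simp_all add: F1_def F2_def G1_def G2_def)
  have "(\<lambda>n. perr h n (r 0) (r 1 + r 2) (r 3 + r 4) (F1 n) (F2 n) (G1 n) (G2 n)) \<longlonglongrightarrow> 0"
  proof (rule tendsto_sandwich[OF _ _ tendsto_const])
    show "(\<lambda>n. 512 * (1 / 2 :: real) ^ n) \<longlonglongrightarrow> 0"
      by (intro tendsto_mult_right_zero LIMSEQ_realpow_zero) auto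
    show "\<forall>\<^sub>F n in sequentially. perr h n (r 0) (r 1 + r 2) (r 3 + r 4) (F1 n) (F2 n) (G1 n) (G2 n) \<le> 512 * (1 / 2) ^ n"
      using eventually_ge_at_top[of 1] by eventually_elim (rule p)
    show "\<forall>\<^sub>F n in sequentially. 0 \<le> perr h n (r 0) (r 1 + r 2) (r 3 + r 4) (F1 n) (F2 n) (G1 n) (G2 n)"
      unfolding perr_def by (intro always_eventually allI divide_nonneg_nonneg sum_nonneg) auto
  qed
  then show ?thesis unfolding achievable_def using r v by auto
qed

section \<open>The GDoF of the symmetric channel\<close>

text \<open>Translates exponents into rates. The 22 bits are 14 for the union bound and 8 for the
  factor 1 / 16 in the amplitude; they vanish after division by \<open>log 2 P\<close>. A layer
  whose budget is at most 22 bits is truncated to rate 0 and then cannot occur in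
  \<open>S\<close>.\<close>

lemma layer_condI:
  fixes \<delta> e :: "nat \<Rightarrow> real"
  assumes P: "P \<ge> 2" and C: "finite C" and \<delta>: "\<And>k. \<delta> k \<ge> 0"
    and ex: "\<And>S. S \<subseteq> C \<Longrightarrow> S \<inter> D \<noteq> {} \<Longrightarrow> (\<And>k. k \<in> S \<Longrightarrow> \<delta> k > 0) \<Longrightarrow>
      \<exists>k\<in>S. P powr (e k / 2) / 16 \<le> cmod (G k) \<and> (\<Sum>k\<in>S. \<delta> k) \<le> e k"
  shows "layer_cond C D G (\<lambda>k. max 0 (\<delta> k * log 2 P - 22))"
  unfolding layer_cond_def
proof (intro allI impI)
  fix S assume S: "S \<subseteq> C" "S \<inter> D \<noteq> {}" and pos: "\<forall>k\<in>S. 0 < max 0 (\<delta> k * log 2 P - 22)"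
  have l: "log 2 P > 0" using P by simp
  have d: "\<delta> k * log 2 P - 22 > 0" if "k \<in> S" for k using pos that by fastforce
  have "\<delta> k > 0" if "k \<in> S" for k
    using d[OF that] \<delta>[of k] by (cases "\<delta> k = 0") auto
  with ex S obtain k where k: "k \<in> S" "P powr (e k / 2) / 16 \<le> cmod (G k)" "(\<Sum>k\<in>S. \<delta> k) \<le> e k" by blast
  have finS: "finite S" using S C finite_subset by blast
  have "(\<Sum>k\<in>S. max 0 (\<delta> k * log 2 P - 22)) = (\<Sum>k\<in>S. \<delta> k) * log 2 P - 22 * real (card S)"
    using d by (simp add: max_def less_imp_le sum_subtractf sum_distrib_right)
  also have "\<dots> \<le> e k * log 2 P - 22 * 1"
  proof (intro diff_mono mult_right_mono mult_left_mono)
    show "1 \<le> real (card S)" using k finS card_gt_0_iff[of S] by (auto simp: Suc_le_eq)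
  qed (use k l in auto)
  finally have sum_le: "(\<Sum>k\<in>S. max 0 (\<delta> k * log 2 P - 22)) + 14 \<le> e k * log 2 P - 8" by simp
  have "P powr e k / 2 ^ 8 = (P powr (e k / 2) / 16)\<^sup>2"
    by (simp add: power_divide power2_eq_square powr_add[symmetric])
  also have "\<dots> \<le> (cmod (G k))\<^sup>2" by (intro power_mono k) auto
  finally have G2: "P powr e k / 2 ^ 8 \<le> (cmod (G k))\<^sup>2" .
  have "e k * log 2 P - 8 = log 2 (P powr e k / 2 ^ 8)"
    using P log_nat_power[of "2 :: real" 2 8] by (simp add: log_divide log_powr)
  also have "\<dots> \<le> log 2 ((cmod (G k))\<^sup>2)"
    using G2 P less_le_trans[OF _ G2] by (subst log_le_cancel_iff) auto
  finally have lg: "(\<Sum>k\<in>S. max 0 (\<delta> k * log 2 P - 22)) + 14 \<le> log 2 ((cmod (G k))\<^sup>2)"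
    using sum_le by linarith
  have "0 \<le> (\<Sum>k\<in>S. max 0 (\<delta> k * log 2 P - 22))" by (intro sum_nonneg) auto
  \<comment> \<open>The gap of 14 bits itself forces the amplitude to be at least 1.\<close>
  with lg have "log 2 ((cmod (G k))\<^sup>2) > 0" by linarith
  moreover have "(cmod (G k))\<^sup>2 > 0" using G2 P by (intro less_le_trans[OF _ G2]) auto
  ultimately have "(cmod (G k))\<^sup>2 \<ge> 1" by (simp add: zero_less_log_cancel_iff)
  then have "1 \<le> cmod (G k)" by - (rule power2_le_imp_le, simp_all)
  with lg k(1) show "\<exists>k\<in>S. 1 \<le> cmod (G k) \<and> (\<Sum>k\<in>S. max 0 (\<delta> k * log 2 P - 22)) + 14 \<le> log 2 ((cmod (G k))\<^sup>2)"
    by blast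
qed

text \<open>Which of the wrongly decoded layers makes the union bound small. Here \<open>k1\<close> and \<open>k2\<close> are the
  receiver's own common and private layers, \<open>k3\<close> is the common layer of the interferer, and
  \<open>e k\<close> is the received power exponent of layer \<open>k\<close>.\<close>

lemma dominant_layer:
  fixes \<delta> e :: "nat \<Rightarrow> real"
  assumes dist: "k0 \<noteq> k1" "k0 \<noteq> k2" "k0 \<noteq> k3" "k1 \<noteq> k2" "k1 \<noteq> k3" "k2 \<noteq> k3"
    and \<delta>: "\<And>k. \<delta> k \<ge> 0" "\<delta> k1 = c" "\<delta> k3 = c" "\<delta> k2 = p"
    and e: "e k0 = max 1 \<alpha>" "e k1 = 1" "e k2 = 1 - \<alpha>" "e k3 = \<alpha>"
    and T0: "\<delta> k0 > 0 \<Longrightarrow> \<alpha> \<noteq> 1 \<and> \<delta> k0 + 2 * c + p \<le> max 1 \<alpha>"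
    and T1: "c > 0 \<Longrightarrow> 2 * c + p \<le> max 1 \<alpha> \<and> c + p \<le> 1"
    and T2: "c > 0 \<Longrightarrow> p > 0 \<Longrightarrow> c + p \<le> \<alpha>"
    and T3: "p > 0 \<Longrightarrow> p \<le> 1 - \<alpha>"
    and S: "S \<subseteq> {k0, k1, k2, k3}" "S \<inter> {k0, k1, k2} \<noteq> {}" and pos: "\<And>k. k \<in> S \<Longrightarrow> \<delta> k > 0"
  shows "\<exists>k\<in>S. (k = k0 \<longrightarrow> \<alpha> \<noteq> 1) \<and> (\<Sum>k\<in>S. \<delta> k) \<le> e k"
proof -
  have le: "(\<Sum>k\<in>S. \<delta> k) \<le> (\<Sum>k\<in>B. \<delta> k)" if "S \<subseteq> B" "finite B" for B
    by (intro sum_mono2 that \<delta>(1))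
  \<comment> \<open>If \<open>k0\<close> is wrong it is taken, having the largest exponent.
    Otherwise the choice is the stronger of \<open>k1\<close> and \<open>k3\<close> if both are
    wrong, then whichever of them is wrong, and \<open>k2\<close> only if it is wrong alone.\<close>
  consider "k0 \<in> S" | "k0 \<notin> S" "k1 \<in> S" "k3 \<in> S" | "k0 \<notin> S" "k1 \<in> S" "k3 \<notin> S"
    | "k0 \<notin> S" "k1 \<notin> S" "k2 \<in> S" "k3 \<in> S" | "k0 \<notin> S" "k1 \<notin> S" "k2 \<in> S" "k3 \<notin> S"
    using S by blast
  then show ?thesis
  proof cases
    case 1
    have "(\<Sum>k\<in>S. \<delta> k) \<le> \<delta> k0 + 2 * c + p" using le[OF S(1)] dist \<delta> by simp
    also have "\<dots> \<le> e k0" using T0[OF pos[OF 1]] e(1) by simp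
    finally show ?thesis using T0[OF pos[OF 1]] 1 by (intro bexI[of _ k0]) simp_all
  next
    case 2
    have "S \<subseteq> {k1, k2, k3}" using S 2 by auto
    then have "(\<Sum>k\<in>S. \<delta> k) \<le> 2 * c + p" using le[of "{k1, k2, k3}"] dist \<delta> by simp
    moreover have "c > 0" using pos[OF 2(2)] \<delta> by simp
    ultimately have m: "(\<Sum>k\<in>S. \<delta> k) \<le> max 1 \<alpha>" using T1 by linarith
    show ?thesis
    proof (cases "\<alpha> \<le> 1")
      case True
      then have "(\<Sum>k\<in>S. \<delta> k) \<le> e k1" using m e(2) by simp
      then show ?thesis using 2(2) dist(1) by (intro bexI[of _ k1]) simp_all
    next
      case False
      then have "(\<Sum>k\<in>S. \<delta> k) \<le> e k3" using m e(4) by simp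
      then show ?thesis using 2(3) dist(3) by (intro bexI[of _ k3]) simp_all
    qed
  next
    case 3
    have "S \<subseteq> {k1, k2}" using S 3 by auto
    then have "(\<Sum>k\<in>S. \<delta> k) \<le> c + p" using le[of "{k1, k2}"] dist \<delta> by simp
    also have "\<dots> \<le> e k1" using T1 pos[OF 3(2)] \<delta>(2) e(2) by simp
    finally show ?thesis using 3(2) dist(1) by (intro bexI[of _ k1]) simp_all
  next
    case 4
    have "S \<subseteq> {k2, k3}" using S 4 by auto
    then have "(\<Sum>k\<in>S. \<delta> k) \<le> c + p" using le[of "{k2, k3}"] dist \<delta> by simp
    also have "\<dots> \<le> e k3" using T2 pos[OF 4(3)] pos[OF 4(4)] \<delta>(3,4) e(4) by simp
    finally show ?thesis using 4(4) dist(3) by (intro bexI[of _ k3]) simp_all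
  next
    case 5
    have "S \<subseteq> {k2}" using S 5 by auto
    then have "(\<Sum>k\<in>S. \<delta> k) \<le> p" using le[of "{k2}"] \<delta> by simp
    also have "\<dots> \<le> e k2" using T3 pos[OF 5(3)] \<delta>(4) e(3) by simp
    finally show ?thesis using 5(3) dist(2) by (intro bexI[of _ k2]) simp_all
  qed
qed

text \<open>\<open>gdof_region\<close> wants a rate triple for every P > 0; this one fills in where
  P is too small for the scheme.\<close>

lemma zero_rate_achievable: "(0, 0, 0) \<in> achievable h"
proof -
  have "layer_cond C D G (\<lambda>_. 0)" for C D G unfolding layer_cond_def by auto
  then show ?thesis using achievable_layered[of "\<lambda>_. 0" 0 h] by simp
qed

lemma half_power_gap:
  fixes x y P :: real
  assumes P: "P \<ge> 2" "P \<ge> 2 powr (2 / (y - x))" and xy: "x < y"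
  shows "P powr (y / 2) - P powr (x / 2) \<ge> P powr (y / 2) / 2"
proof -
  \<comment> \<open>The threshold is the value of P at which the ratio of the two amplitudes reaches
    2.\<close>
  have "2 / (y - x) * ((y - x) / 2) = 1" using xy by simp
  then have "2 = (2 powr (2 / (y - x))) powr ((y - x) / 2)" by (simp only: powr_powr) simp
  also have "\<dots> \<le> P powr ((y - x) / 2)" using P xy by (intro powr_mono2) auto
  finally have "2 * P powr (x / 2) \<le> P powr ((y - x) / 2) * P powr (x / 2)" by (intro mult_right_mono) auto
  also have "\<dots> = P powr (y / 2)" by (simp add: powr_add[symmetric] diff_divide_distrib)
  finally show ?thesis by simp
qed

text \<open>The phases of \<open>x\<close> and \<open>y\<close> are arbitrary, so the reverse
  triangle inequality must do. For \<alpha> \<noteq> 1 and large P the stronger amplitude is at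
  least twice the weaker one; for \<alpha> = 1 the two might cancel.\<close>

lemma half_power_sum:
  fixes x y :: complex
  assumes P: "P \<ge> 2" "P \<ge> 2 powr (2 / \<bar>1 - \<alpha>\<bar>)" and "\<alpha> \<noteq> 1"
    and x: "cmod x = P powr (1 / 2)" and y: "cmod y = P powr (\<alpha> / 2)"
  shows "P powr (max 1 \<alpha> / 2) / 16 \<le> cmod ((x + y) / 8)"
proof (cases "\<alpha> < 1")
  case True
  then have "P powr (1 / 2) / 2 \<le> cmod x - cmod y"
    using half_power_gap[of P 1 \<alpha>] P x y by simp
  also have "\<dots> \<le> cmod (x + y)" using norm_diff_ineq[of x y] by simp
  finally show ?thesis using True by (simp add: norm_divide max_def)
next
  case False
  then have a: "\<alpha> > 1" using assms by simp
  then have "P powr (\<alpha> / 2) / 2 \<le> cmod y - cmod x"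
    using half_power_gap[of P \<alpha> 1] P x y by simp
  also have "\<dots> \<le> cmod (x + y)" using norm_diff_ineq[of y x] by (simp add: add.commute)
  finally show ?thesis using a by (simp add: norm_divide max_def)
qed

lemma gdof_rate_limit:
  assumes "d \<ge> 0"
  shows "((\<lambda>P. max 0 (d * log 2 P - 22) / log 2 P) \<longlongrightarrow> d) at_top"
proof -
  have "((\<lambda>P. max 0 (-22 / log 2 P + d)) \<longlongrightarrow> max 0 d) at_top"
    by (intro tendsto_max tendsto_const log_ratio_limit)
  moreover have "\<forall>\<^sub>F P in at_top. max 0 (-22 / log 2 P + d) = max 0 (d * log 2 P - 22) / log 2 P"
    using eventually_ge_at_top[of 2]
  proof eventually_elim
    case (elim P)
    then have "log 2 P > 0" by simp
    then show ?case by (auto simp: max_def field_simps)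
  qed
  ultimately show ?thesis using assms by (simp add: filterlim_cong)
qed

text \<open>The conditions mirror error patterns: \<open>T0\<close> for the common layer,
  \<open>T1\<close> for the own decoded layer with or without the interferer's, \<open>T2\<close>
  for the private layer with the interferer's, \<open>T3\<close> for the private layer alone. The
  positivity guards let a scheme switch layers off: the private one for \<alpha> > 1, where it has
  no room, and the common one for \<alpha> = 1, where its gain may vanish.\<close>

theorem gdof_inner_bound:
  fixes \<alpha> d0 c p :: real
  assumes a: "\<alpha> \<ge> 0" and nn: "d0 \<ge> 0" "c \<ge> 0" "p \<ge> 0"
    and T0: "d0 > 0 \<Longrightarrow> \<alpha> \<noteq> 1 \<and> d0 + 2 * c + p \<le> max 1 \<alpha>"
    and T1: "c > 0 \<Longrightarrow> 2 * c + p \<le> max 1 \<alpha> \<and> c + p \<le> 1"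
    and T2: "c > 0 \<Longrightarrow> p > 0 \<Longrightarrow> c + p \<le> \<alpha>"
    and T3: "p > 0 \<Longrightarrow> p \<le> 1 - \<alpha>"
  shows "(d0, c + p, c + p) \<in> gdof_region (alpha_sym \<alpha>)"
  unfolding gdof_region_def
proof (clarsimp simp only: mem_Collect_eq prod.case, intro conjI allI impI)
  show "0 \<le> d0" "0 \<le> c + p" "0 \<le> c + p" using nn by auto
  fix H :: "real \<Rightarrow> chan"
  assume H: "\<forall>P>0. \<forall>i\<in>{1, 2}. \<forall>j\<in>{1, 2}. (cmod (H P i j))\<^sup>2 = P powr alpha_sym \<alpha> i j"
  define \<delta> where "\<delta> k = (if k = 0 then d0 else if k = 1 \<or> k = 3 then c else p)" for k :: nat
  define r where "r P k = max 0 (\<delta> k * log 2 P - 22)" for P k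
  define P0 where "P0 = max 2 (2 powr (2 / \<bar>1 - \<alpha>\<bar>))"
  have \<delta>: "\<delta> k \<ge> 0" for k using nn by (simp add: \<delta>_def)
  have ach: "(r P 0, r P 1 + r P 2, r P 3 + r P 4) \<in> achievable (H P)" if "P \<ge> P0" for P
  proof -
    have P: "P \<ge> 2" "P \<ge> 2 powr (2 / \<bar>1 - \<alpha>\<bar>)" using that by (auto simp: P0_def)
    have hP: "cmod (H P i j) = P powr (alpha_sym \<alpha> i j / 2)" if "i \<in> {1, 2}" "j \<in> {1, 2}" for i j
    proof -
      have "(cmod (H P i j))\<^sup>2 = (P powr (alpha_sym \<alpha> i j / 2))\<^sup>2"
        using H[rule_format, OF _ that, of P] P by (simp add: power2_eq_square powr_add[symmetric])
      then show ?thesis by (rule power2_eq_imp_eq) auto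
    qed
    have h: "cmod (H P 1 1) = P powr (1 / 2)" "cmod (H P 2 2) = P powr (1 / 2)"
      "cmod (H P 1 2) = P powr (\<alpha> / 2)" "cmod (H P 2 1) = P powr (\<alpha> / 2)"
      using hP[of 1 1] hP[of 2 2] hP[of 1 2] hP[of 2 1] by (simp_all add: alpha_sym_def)
    define b where "b = P powr (- \<alpha> / 2) / 8"
    have cancel: "P powr (\<alpha> / 2) * b = 1 / 8"
      using P by (simp add: b_def powr_add[symmetric])
    have pb: "P powr ((1 - \<alpha>) / 2) / 16 \<le> P powr (1 / 2) * b"
      by (simp add: b_def powr_add[symmetric] diff_divide_distrib)
    have half: "P powr x / 16 \<le> P powr x / 8" for x by simp
    show ?thesis
    proof (rule achievable_layered)
      show "r P k \<ge> 0" for k by (simp add: r_def)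
      show "0 \<le> b" by (simp add: b_def)
      have "P powr (- \<alpha> / 2) \<le> P powr 0" using P a by (intro powr_mono) auto
      then show "b \<le> 1 / 8" using P by (simp add: b_def)
      show "cmod (H P 1 2) * b \<le> 1 / 2" "cmod (H P 2 1) * b \<le> 1 / 2"
        unfolding h cancel by simp_all
      define e1 where "e1 k = (if k = 0 then max 1 \<alpha> else if k = 1 then 1 else if k = 2 then 1 - \<alpha> else \<alpha>)" for k :: nat
      define e2 where "e2 k = (if k = 0 then max 1 \<alpha> else if k = 3 then 1 else if k = 4 then 1 - \<alpha> else \<alpha>)" for k :: nat
      have g1: "P powr (e1 k / 2) / 16 \<le> cmod (gain1 (H P) b k)"
        if "k \<in> {0, 1, 2, 3}" "k = 0 \<longrightarrow> \<alpha> \<noteq> 1" for k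
        using that half_power_sum[OF P _ h(1,3)] half h pb \<open>0 \<le> b\<close>
        by (auto simp: gain1_def e1_def norm_divide norm_mult)
      have g2: "P powr (e2 k / 2) / 16 \<le> cmod (gain2 (H P) b k)"
        if "k \<in> {0, 1, 3, 4}" "k = 0 \<longrightarrow> \<alpha> \<noteq> 1" for k
        using that half_power_sum[OF P _ h(2,4)] half h pb \<open>0 \<le> b\<close>
        by (auto simp: gain2_def e2_def norm_divide norm_mult add.commute)
      show "layer_cond {0, 1, 2, 3} {0, 1, 2} (gain1 (H P) b) (r P)"
        unfolding r_def[abs_def]
      proof (rule layer_condI[OF P(1), where e = e1])
        fix S assume S: "S \<subseteq> {0, 1, 2, 3 :: nat}" "S \<inter> {0, 1, 2} \<noteq> {}" and pos: "\<And>k. k \<in> S \<Longrightarrow> \<delta> k > 0"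
        have "\<exists>k\<in>S. (k = 0 \<longrightarrow> \<alpha> \<noteq> 1) \<and> (\<Sum>k\<in>S. \<delta> k) \<le> e1 k"
        proof (rule dominant_layer[where ?k0.0 = 0 and ?k1.0 = 1 and ?k2.0 = 2 and ?k3.0 = 3 and c = c and p = p])
          show "\<alpha> \<noteq> 1 \<and> \<delta> 0 + 2 * c + p \<le> max 1 \<alpha>" if "\<delta> 0 > 0"
            using T0 that by (simp add: \<delta>_def)
          show "S \<subseteq> {0, 1, 2, 3}" "S \<inter> {0, 1, 2} \<noteq> {}" using S by auto
          show "\<delta> k \<ge> 0" "k \<in> S \<Longrightarrow> \<delta> k > 0" for k by (fact \<delta>, fact pos)
        qed (fact T1 T2 T3 | simp add: \<delta>_def e1_def)+
        then obtain k where k: "k \<in> S" "k = 0 \<longrightarrow> \<alpha> \<noteq> 1" "(\<Sum>k\<in>S. \<delta> k) \<le> e1 k" by (elim bexE conjE)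
        from g1[OF subsetD[OF S(1) k(1)] k(2)] k
        show "\<exists>k\<in>S. P powr (e1 k / 2) / 16 \<le> cmod (gain1 (H P) b k) \<and> (\<Sum>k\<in>S. \<delta> k) \<le> e1 k"
          by (intro bexI[of _ k] conjI)
      qed (simp_all add: \<delta>)
      show "layer_cond {0, 1, 3, 4} {0, 3, 4} (gain2 (H P) b) (r P)"
        unfolding r_def[abs_def]
      proof (rule layer_condI[OF P(1), where e = e2])
        fix S assume S: "S \<subseteq> {0, 1, 3, 4 :: nat}" "S \<inter> {0, 3, 4} \<noteq> {}" and pos: "\<And>k. k \<in> S \<Longrightarrow> \<delta> k > 0"
        have "\<exists>k\<in>S. (k = 0 \<longrightarrow> \<alpha> \<noteq> 1) \<and> (\<Sum>k\<in>S. \<delta> k) \<le> e2 k"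
        \<comment> \<open>At receiver 2 the roles of layers 1 and 3 are exchanged, and layer 4
          replaces layer 2.\<close>
        proof (rule dominant_layer[where ?k0.0 = 0 and ?k1.0 = 3 and ?k2.0 = 4 and ?k3.0 = 1 and c = c and p = p])
          show "\<alpha> \<noteq> 1 \<and> \<delta> 0 + 2 * c + p \<le> max 1 \<alpha>" if "\<delta> 0 > 0"
            using T0 that by (simp add: \<delta>_def)
          show "S \<subseteq> {0, 3, 4, 1}" "S \<inter> {0, 3, 4} \<noteq> {}" using S by auto
          show "\<delta> k \<ge> 0" "k \<in> S \<Longrightarrow> \<delta> k > 0" for k by (fact \<delta>, fact pos)
        qed (fact T1 T2 T3 | simp add: \<delta>_def e2_def)+
        then obtain k where k: "k \<in> S" "k = 0 \<longrightarrow> \<alpha> \<noteq> 1" "(\<Sum>k\<in>S. \<delta> k) \<le> e2 k" by (elim bexE conjE)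
        from g2[OF subsetD[OF S(1) k(1)] k(2)] k
        show "\<exists>k\<in>S. P powr (e2 k / 2) / 16 \<le> cmod (gain2 (H P) b k) \<and> (\<Sum>k\<in>S. \<delta> k) \<le> e2 k"
          by (intro bexI[of _ k] conjI)
      qed (simp_all add: \<delta>)
    qed
  qed
  define R where "R P = (if P \<ge> P0 then (r P 0, r P 1 + r P 2, r P 3 + r P 4) else (0, 0, 0))" for P
  have "R P \<in> capacity_region (H P)" for P
    using ach[of P] zero_rate_achievable[of "H P"] closure_subset[of "achievable (H P)"]
    by (auto simp: R_def capacity_region_def)
  moreover have lim: "((\<lambda>P. r P k / log 2 P) \<longlongrightarrow> \<delta> k) at_top" for k
    unfolding r_def by (rule gdof_rate_limit[OF \<delta>])
  have ev: "\<forall>\<^sub>F P in at_top. R P = (r P 0, r P 1 + r P 2, r P 3 + r P 4)"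
    using eventually_ge_at_top[of P0] by eventually_elim (simp add: R_def)
  have "((\<lambda>P. fst (R P) / log 2 P) \<longlongrightarrow> d0) at_top"
  proof (rule Lim_transform_eventually)
    show "((\<lambda>P. r P 0 / log 2 P) \<longlongrightarrow> d0) at_top" using lim[of 0] by (simp add: \<delta>_def)
    show "\<forall>\<^sub>F P in at_top. r P 0 / log 2 P = fst (R P) / log 2 P" using ev by eventually_elim simp
  qed
  moreover have "((\<lambda>P. fst (snd (R P)) / log 2 P) \<longlongrightarrow> c + p) at_top"
  proof (rule Lim_transform_eventually)
    show "((\<lambda>P. r P 1 / log 2 P + r P 2 / log 2 P) \<longlongrightarrow> c + p) at_top"
      using tendsto_add[OF lim[of 1] lim[of 2]] by (simp add: \<delta>_def)
    show "\<forall>\<^sub>F P in at_top. r P 1 / log 2 P + r P 2 / log 2 P = fst (snd (R P)) / log 2 P"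
      using ev by eventually_elim (simp add: add_divide_distrib)
  qed
  moreover have "((\<lambda>P. snd (snd (R P)) / log 2 P) \<longlongrightarrow> c + p) at_top"
  proof (rule Lim_transform_eventually)
    show "((\<lambda>P. r P 3 / log 2 P + r P 4 / log 2 P) \<longlongrightarrow> c + p) at_top"
      using tendsto_add[OF lim[of 3] lim[of 4]] by (simp add: \<delta>_def)
    show "\<forall>\<^sub>F P in at_top. r P 3 / log 2 P + r P 4 / log 2 P = snd (snd (R P)) / log 2 P"
      using ev by eventually_elim (simp add: add_divide_distrib)
  qed
  ultimately show "\<exists>R. (\<forall>P>0. R P \<in> capacity_region (H P)) \<and>
      ((\<lambda>P. fst (R P) / log 2 P) \<longlongrightarrow> d0) at_top \<and>
      ((\<lambda>P. fst (snd (R P)) / log 2 P) \<longlongrightarrow> c + p) at_top \<and>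
      ((\<lambda>P. snd (snd (R P)) / log 2 P) \<longlongrightarrow> c + p) at_top" by blast
qed

text \<open>The sum bound is met by common rate \<alpha> and private rates 1 - \<alpha> for \<alpha>
  < 1, by jointly decoded layers of rate \<alpha> / 2 for 1 \<le> \<alpha> < 2, and by the common
  message alone for \<alpha> \<ge> 2. The middle scheme covers \<alpha> = 1, where the gains of
  layer 0 may cancel.\<close>

lemma ICCI_greatest:
  assumes a: "\<alpha> \<ge> 0"
  shows "max (2 - \<alpha>) \<alpha> / 2 \<in> obj_ICCI \<alpha>" "\<And>y. y \<in> obj_ICCI \<alpha> \<Longrightarrow> y \<le> max (2 - \<alpha>) \<alpha> / 2"
proof -
  show "y \<le> max (2 - \<alpha>) \<alpha> / 2" if y: "y \<in> obj_ICCI \<alpha>" for y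
    using y gdof_outer_bounds(2)[OF a] by (fastforce simp: obj_ICCI_def)
  have mem: "max (2 - \<alpha>) \<alpha> / 2 \<in> obj_ICCI \<alpha>"
    if "(d0, d, d) \<in> gdof_region (alpha_sym \<alpha>)" "d0 + d + d = max (2 - \<alpha>) \<alpha>" for d0 d
    unfolding obj_ICCI_def mem_Collect_eq using that by (intro exI[of _ d0] exI[of _ d]) simp
  consider "\<alpha> < 1" | "1 \<le> \<alpha>" "\<alpha> < 2" | "2 \<le> \<alpha>" by linarith
  then show "max (2 - \<alpha>) \<alpha> / 2 \<in> obj_ICCI \<alpha>"
  proof cases
    case 1
    then show ?thesis
      by (intro mem[of \<alpha> "0 + (1 - \<alpha>)"] gdof_inner_bound) (use a in auto)
  next
    case 2
    then show ?thesis
      by (intro mem[of 0 "\<alpha> / 2 + 0"] gdof_inner_bound) (use a in auto)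
  next
    case 3
    then show ?thesis
      by (intro mem[of \<alpha> "0 + 0"] gdof_inner_bound) (use a in auto)
  qed
qed

text \<open>The Etkin-Tse-Wang W curve, established below as the maximum rather than
  assumed.\<close>

definition w_curve :: "real \<Rightarrow> real" where
  "w_curve \<alpha> = (if \<alpha> < 1/2 then 1 - \<alpha> else if \<alpha> < 2/3 then \<alpha> else if \<alpha> < 1 then 1 - \<alpha> / 2
     else if \<alpha> < 2 then \<alpha> / 2 else 1)"

text \<open>The curve is the minimum of the three outer bounds at d1 = d2. For 1/2 \<le> \<alpha> <
  1 the private layer is filled to 1 - \<alpha>, and the decoded rate is limited by c + p = \<alpha>
  below 2/3 and by 2 c + p = 1 from there on. Below 1/2 only private layers are used, from 1 on only
  decoded ones.\<close>

lemma IC_greatest: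
  assumes a: "\<alpha> \<ge> 0"
  shows "w_curve \<alpha> \<in> obj_IC \<alpha>" "\<And>y. y \<in> obj_IC \<alpha> \<Longrightarrow> y \<le> w_curve \<alpha>"
proof -
  show "y \<le> w_curve \<alpha>" if y: "y \<in> obj_IC \<alpha>" for y
  proof -
    obtain d where d: "y = d" "(0, d, d) \<in> gdof_region (alpha_sym \<alpha>)"
      using y by (auto simp: obj_IC_def)
    from gdof_outer_bounds[OF a d(2)] show ?thesis
      unfolding d(1) w_curve_def by (auto simp: max_def split: if_splits)
  qed
  have mem: "w_curve \<alpha> \<in> obj_IC \<alpha>"
    if "(0, d, d) \<in> gdof_region (alpha_sym \<alpha>)" "d = w_curve \<alpha>" for d
    unfolding obj_IC_def mem_Collect_eq using that by (intro exI[of _ 0] exI[of _ d]) simp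
  consider "\<alpha> < 1/2" | "1/2 \<le> \<alpha>" "\<alpha> < 2/3" | "2/3 \<le> \<alpha>" "\<alpha> < 1" | "1 \<le> \<alpha>" "\<alpha> < 2" | "2 \<le> \<alpha>" by linarith
  then show "w_curve \<alpha> \<in> obj_IC \<alpha>"
  proof cases
    case 1
    then show ?thesis
      by (intro mem[of "0 + (1 - \<alpha>)"] gdof_inner_bound) (use a in \<open>auto simp: w_curve_def\<close>)
  next
    case 2
    then show ?thesis
      by (intro mem[of "(2 * \<alpha> - 1) + (1 - \<alpha>)"] gdof_inner_bound) (use a in \<open>auto simp: w_curve_def\<close>)
  next
    case 3
    then show ?thesis
      by (intro mem[of "\<alpha> / 2 + (1 - \<alpha>)"] gdof_inner_bound) (use a in \<open>auto simp: w_curve_def\<close>)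
  next
    case 4
    then show ?thesis
      by (intro mem[of "\<alpha> / 2 + 0"] gdof_inner_bound) (use a in \<open>auto simp: w_curve_def\<close>)
  next
    case 5
    then show ?thesis
      by (intro mem[of "1 + 0"] gdof_inner_bound) (use a in \<open>auto simp: w_curve_def\<close>)
  qed
qed

theorem theorem7:
  fixes \<alpha> :: real
  assumes "\<alpha> \<ge> 0"
  shows "(\<exists>v\<in>obj_ICCI \<alpha>. \<forall>y\<in>obj_ICCI \<alpha>. y \<le> v) \<and>
         (\<exists>v\<in>obj_IC \<alpha>. \<forall>y\<in>obj_IC \<alpha>. y \<le> v) \<and>
         d_ICCI \<alpha> = (if \<alpha> < 1/2 then d_IC \<alpha> + \<alpha> / 2
                      else if \<alpha> < 2/3 then d_IC \<alpha> + (2 - 3 * \<alpha>) / 2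
                      else if \<alpha> < 2 then d_IC \<alpha>
                      else d_IC \<alpha> + (\<alpha> - 2) / 2) \<and>
         d_ICCI \<alpha> - d_IC \<alpha> = (if \<alpha> < 1/2 then \<alpha> / 2
                      else if \<alpha> < 2/3 then (2 - 3 * \<alpha>) / 2
                      else if \<alpha> < 2 then 0
                      else (\<alpha> - 2) / 2)"
proof -
  \<comment> \<open>Since both maxima are attained, \<open>GREATEST\<close> evaluates to them, and
    the gap is the difference of two explicit piecewise formulas.\<close>
  note I = ICCI_greatest[OF assms] and J = IC_greatest[OF assms]
  have 1: "d_ICCI \<alpha> = max (2 - \<alpha>) \<alpha> / 2"
    unfolding d_ICCI_def by (rule Greatest_equality) (use I in auto)
  have 2: "d_IC \<alpha> = w_curve \<alpha>"
    unfolding d_IC_def by (rule Greatest_equality) (use J in auto)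
  have "(\<exists>v\<in>obj_ICCI \<alpha>. \<forall>y\<in>obj_ICCI \<alpha>. y \<le> v) \<and> (\<exists>v\<in>obj_IC \<alpha>. \<forall>y\<in>obj_IC \<alpha>. y \<le> v)"
    using I J by blast
  then show ?thesis
    unfolding 1 2 w_curve_def by (auto simp: max_def field_simps)
qed

end
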